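(* Let $$X:=\{x_1^2+x_2^2+x_3^2+x_4^2+x_5^2=0\}\subset\mathbb{P}^4,$$ with the action of the Weyl group $W(\mathsf{D}_5)$ by signed permutations of the coordinates. The actions on $X$ of the following subgroups $G\subset W(\mathsf{D}_5)$ are linearizable: - the unique (up to conjugation) subgroup $G\simeq C_4\wr C_2$ of $W(\mathsf{D}_5)$; - the unique (up to conjugation) semidihedral subgroup $G\simeq SD16$ of $W(\mathsf{D}_5)$; - the unique (up to conjugation) dihedral subgroup $G\simeq\mathfrak{D}_8$ of $W(\mathsf{D}_5)$.
   Context: The base field $k$ is algebraically closed of characteristic zero. $W(\mathsf{D}_5)$ is the Weyl group of type $\mathsf{D}_5$, acting on $k^5$ by signed permutations of the coordinates $x_1,\dots,x_5$ with an even number of sign changes. $C_4\wr C_2=(C_4\times C_4)\rtimes C_2$ is the wreath product (order $32$), $SD16$ is the semidihedral group of order $16$, and $\mathfrak{D}_8$ is the dihedral group of order $16$. For a finite group $G$, a smooth variety $X$ over $k$ with a generically free regular action of $G$ is called linearizable if there is a $G$-equivariant birational map $\mathbb{P}(V)\dashrightarrow X$ for some linear representation $V$ of $G$. *)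

theory Defs
  imports
    "HOL-Library.Poly_Mapping"
    "HOL-Computational_Algebra.Polynomial"
    "HOL-Combinatorics.Permutations"
    "HOL-Algebra.Coset"
    "HOL-Algebra.Elementary_Groups"
    "HOL-Analysis.Abstract_Topology"
    "Jordan_Normal_Form.Matrix"
begin

section \<open>Homogeneous polynomials\<close>

text \<open>
  A polynomial is a finitely supported map from exponent vectors to coefficients; the variables
  are indexed by natural numbers.
\<close>

type_synonym 'k mpoly = "(nat \<Rightarrow>\<^sub>0 nat) \<Rightarrow>\<^sub>0 'k"

definition homogeneous :: "nat \<Rightarrow> nat \<Rightarrow> 'k::zero mpoly \<Rightarrow> bool" where
  "homogeneous n d f \<longleftrightarrow>
     (\<forall>e\<in>Poly_Mapping.keys f.
        Poly_Mapping.keys e \<subseteq> {..<n} \<and>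
        (\<Sum>i\<in>Poly_Mapping.keys e. Poly_Mapping.lookup e i) = d)"

definition eval_mpoly :: "'k::comm_semiring_1 mpoly \<Rightarrow> 'k vec \<Rightarrow> 'k" where
  "eval_mpoly f v =
     (\<Sum>e\<in>Poly_Mapping.keys f.
        Poly_Mapping.lookup f e *
        (\<Prod>i\<in>Poly_Mapping.keys e. (v $ i) ^ Poly_Mapping.lookup e i))"


section \<open>Projective space and its Zariski topology\<close>

text \<open>
  A point of projective space is the set of nonzero multiples of a nonzero vector.  The index
  \<open>n\<close> is the dimension of the vector space, so that \<open>proj n\<close> is the projective space of
  dimension \<open>n - 1\<close> (and is empty for \<open>n = 0\<close>).
\<close>

definition pt :: "'k::field vec \<Rightarrow> 'k vec set" where
  "pt v = {c \<cdot>\<^sub>v v | c. c \<noteq> 0}"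

definition proj :: "nat \<Rightarrow> 'k::field vec set set" where
  "proj n = {pt v | v. v \<in> carrier_vec n \<and> v \<noteq> 0\<^sub>v n}"

definition basic_open :: "nat \<Rightarrow> 'k::field mpoly \<Rightarrow> 'k vec set set" where
  "basic_open n f = {pt v | v. v \<in> carrier_vec n \<and> v \<noteq> 0\<^sub>v n \<and> eval_mpoly f v \<noteq> 0}"

definition zariski :: "nat \<Rightarrow> 'k::field vec set topology" where
  "zariski n = topology_generated_by {basic_open n f | f d. homogeneous n d f}"

definition dense_open :: "'a topology \<Rightarrow> 'a set \<Rightarrow> bool" where
  "dense_open T U \<longleftrightarrow> openin T U \<and> T closure_of U = topspace T"


section \<open>Regular and birational maps\<close>

text \<open>
  In the following, \<open>A\<close> is a locally closed subset of \<open>proj n\<close>.  A map from \<open>A\<close> to \<open>proj m\<close> is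
  regular if locally it is given by homogeneous polynomials of one and the same degree without
  common zeros.
\<close>

definition regular_map ::
    "nat \<Rightarrow> nat \<Rightarrow> 'k::field vec set set \<Rightarrow> ('k vec set \<Rightarrow> 'k vec set) \<Rightarrow> bool" where
  "regular_map n m A \<phi> \<longleftrightarrow>
     (\<forall>p\<in>A. \<exists>N d F.
        openin (subtopology (zariski n) A) N \<and> p \<in> N \<and>
        (\<forall>j<m. homogeneous n d (F j)) \<and>
        (\<forall>v\<in>carrier_vec n. pt v \<in> N \<longrightarrow>
           vec m (\<lambda>j. eval_mpoly (F j) v) \<noteq> 0\<^sub>v m \<and>
           \<phi> (pt v) = pt (vec m (\<lambda>j. eval_mpoly (F j) v))))"

text \<open>
  A birational map between \<open>X\<close> in \<open>proj n\<close> and \<open>Y\<close> in \<open>proj m\<close>, represented by an isomorphism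
  \<open>\<phi>\<close> of a dense open subset \<open>U\<close> of \<open>X\<close> with a dense open subset \<open>V\<close> of \<open>Y\<close>.
\<close>

definition birational_via ::
    "nat \<Rightarrow> 'k::field vec set set \<Rightarrow> nat \<Rightarrow> 'k vec set set \<Rightarrow>
     'k vec set set \<Rightarrow> 'k vec set set \<Rightarrow> ('k vec set \<Rightarrow> 'k vec set) \<Rightarrow> bool" where
  "birational_via n X m Y U V \<phi> \<longleftrightarrow>
     dense_open (subtopology (zariski n) X) U \<and>
     dense_open (subtopology (zariski m) Y) V \<and>
     bij_betw \<phi> U V \<and>
     regular_map n m U \<phi> \<and>
     regular_map m n V (inv_into U \<phi>)"


section \<open>Linearizable actions\<close>

definition GL :: "nat \<Rightarrow> 'k::field mat monoid" where
  "GL n = units_of (ring_mat TYPE('k) n ())"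

definition proj_action :: "'k::field mat \<Rightarrow> 'k vec set \<Rightarrow> 'k vec set" where
  "proj_action g p = (\<lambda>v. g *\<^sub>v v) ` p"

text \<open>
  The action \<open>act\<close> of \<open>G\<close> on the subvariety \<open>X\<close> of \<open>proj m\<close> is linearizable if there are a linear
  representation \<open>\<rho>\<close> of \<open>G\<close> and an equivariant birational map from the projectivization of its
  representation space to \<open>X\<close>.  Equivariance of a rational map defined on \<open>U\<close> is an identity of
  rational maps; \<open>U\<close> itself need not be stable, so for each \<open>g\<close> the identity is required on
  the dense open set of those \<open>p \<in> U\<close> that \<open>g\<close> sends to \<open>U\<close>.

  The notion is meant for finite \<open>G\<close> and smooth \<open>X\<close> with a generically free regular action; these
  are conditions on the data to which the notion is applied and not part of the predicate.
\<close>

definition linearizable ::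
    "'g monoid \<Rightarrow> ('g \<Rightarrow> 'k::field vec set \<Rightarrow> 'k vec set) \<Rightarrow> nat \<Rightarrow> 'k vec set set \<Rightarrow> bool" where
  "linearizable G act m X \<longleftrightarrow>
     (\<exists>n \<rho> U V \<phi>.
        \<rho> \<in> hom G (GL n) \<and>
        birational_via n (proj n) m X U V \<phi> \<and>
        (\<forall>g\<in>carrier G. \<forall>p\<in>U. proj_action (\<rho> g) p \<in> U \<longrightarrow>
           \<phi> (proj_action (\<rho> g) p) = act g (\<phi> p)))"


section \<open>The Weyl group of type D and the quadric\<close>

text \<open>The linear map sending the \<open>j\<close>-th unit vector to \<open>\<epsilon> (\<sigma> j)\<close> times the \<open>\<sigma> j\<close>-th one.\<close>

definition signed_perm_mat :: "nat \<Rightarrow> (nat \<Rightarrow> nat) \<Rightarrow> (nat \<Rightarrow> 'k::field) \<Rightarrow> 'k mat" where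
  "signed_perm_mat n \<sigma> \<epsilon> = mat n n (\<lambda>(i, j). if i = \<sigma> j then \<epsilon> i else 0)"

definition weyl_D :: "nat \<Rightarrow> 'k::field_char_0 mat monoid" where
  "weyl_D n = (GL n)\<lparr>carrier :=
     {signed_perm_mat n \<sigma> \<epsilon> | \<sigma> \<epsilon>.
        \<sigma> permutes {..<n} \<and> (\<forall>i<n. \<epsilon> i = 1 \<or> \<epsilon> i = -1) \<and> even (card {i. i < n \<and> \<epsilon> i = -1})}\<rparr>"

definition quadric :: "'k::field vec set set" where
  "quadric = {pt v | v. v \<in> carrier_vec 5 \<and> v \<noteq> 0\<^sub>v 5 \<and> (\<Sum>i<5. (v $ i)\<^sup>2) = 0}"


section \<open>The abstract groups\<close>

definition semidirect ::
    "'a monoid \<Rightarrow> 'b monoid \<Rightarrow> ('b \<Rightarrow> 'a \<Rightarrow> 'a) \<Rightarrow> ('a \<times> 'b) monoid" where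
  "semidirect N H \<alpha> =
     \<lparr>carrier = carrier N \<times> carrier H,
      monoid.mult = (\<lambda>(a, h) (b, k). (a \<otimes>\<^bsub>N\<^esub> \<alpha> h b, h \<otimes>\<^bsub>H\<^esub> k)),
      one = (\<one>\<^bsub>N\<^esub>, \<one>\<^bsub>H\<^esub>)\<rparr>"

definition C4_wr_C2 :: "((int \<times> int) \<times> int) monoid" where
  "C4_wr_C2 = semidirect (integer_mod_group 4 \<times>\<times> integer_mod_group 4) (integer_mod_group 2)
     (\<lambda>h (a, b). if h = 0 then (a, b) else (b, a))"

text \<open>
  The dihedral and the semidihedral group of order 16: the generator of \<open>C\<^sub>2\<close> acts on \<open>C\<^sub>8\<close> by
  \<open>a \<mapsto> -a\<close> and \<open>a \<mapsto> 3 a\<close>, respectively.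
\<close>

definition dihedral_16 :: "(int \<times> int) monoid" where
  "dihedral_16 = semidirect (integer_mod_group 8) (integer_mod_group 2)
     (\<lambda>h a. if h = 0 then a else (- a) mod 8)"

definition semidihedral_16 :: "(int \<times> int) monoid" where
  "semidihedral_16 = semidirect (integer_mod_group 8) (integer_mod_group 2)
     (\<lambda>h a. if h = 0 then a else (3 * a) mod 8)"


section \<open>Subgroups of a given isomorphism type\<close>

definition subgroup_of_type :: "'a set \<Rightarrow> 'a monoid \<Rightarrow> 'b monoid \<Rightarrow> bool" where
  "subgroup_of_type H W M \<longleftrightarrow> subgroup H W \<and> W\<lparr>carrier := H\<rparr> \<cong> M"

definition unique_up_to_conj :: "'a monoid \<Rightarrow> 'b monoid \<Rightarrow> bool" where
  "unique_up_to_conj W M \<longleftrightarrow>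
     (\<exists>H. subgroup_of_type H W M) \<and>
     (\<forall>H K. subgroup_of_type H W M \<longrightarrow> subgroup_of_type K W M \<longrightarrow>
        (\<exists>w\<in>carrier W. K = (\<lambda>h. w \<otimes>\<^bsub>W\<^esub> h \<otimes>\<^bsub>W\<^esub> inv\<^bsub>W\<^esub> w) ` H))"

end

theory Submission
  imports Defs "Jordan_Normal_Form.Determinant"
begin

text \<open>
  The proof has two independent parts: an explicit equivariant parametrization of the quadric for
  each of the three groups, and the uniqueness of these groups up to conjugation.

  \<^bold>\<open>Coordinates.\<close>  Up to conjugation, the only element of order eight of the Weyl group is the
  negacycle $e_1 \to e_2 \to e_3 \to e_4 \to -e_1$, $e_5 \to -e_5$.  Its eigenvalues on the first
  four coordinates are the primitive eighth roots of unity $z, z^{-1}, z^3, z^{-3}$, and in suitable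
  eigencoordinates the quadric becomes $y_0 y_1 + y_2 y_3 + y_4^2 = 0$ (\<open>split_eighth_coords\<close>).
  For the wreath product, the two commuting elements of order four are diagonalized instead
  (\<open>split_quarter_coords\<close>).

  \<^bold>\<open>The wreath product and the semidihedral group.\<close>  Both permute the lines spanned by $y_0$ and
  $y_2$ and, dually, those spanned by $y_1$ and $y_3$; that is, they respect a decomposition of the
  four-dimensional space into two isotropic planes.  In the chart $y_4 = 1$ the quadric is
  $y_0 y_1 + y_2 y_3 = -1$, and its projection to the $(y_0, y_2)$-plane has affine lines as fibres.
  The function $y_0 y_1 - y_2 y_3$ is a coordinate on the fibres, and the group multiplies it by a
  sign.  So $(y_0, y_2, y_0 y_1 - y_2 y_3)$ identifies the quadric birationally with a linear
  representation (\<open>plane_parametrization\<close>).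

  \<^bold>\<open>The dihedral group.\<close>  Here the reflection exchanges $y_0$ with $y_1$ and $y_2$ with $y_3$, and
  the isotropic planes above are not invariant.  Now set $Y = y_0/y_2$, $Y' = y_1/y_3$,
  $S = y_4/y_2$, $S' = y_4/y_3$.  These satisfy $Y Y' + S S' + 1 = 0$, which is again an affine
  quadric: the two are open subsets of one flag variety, the hypersurface
  $y_0 y_1 + y_2 y_3 + y_4 y_5 = 0$ in the product of the planes with homogeneous coordinates
  $y_0, y_2, y_4$ and $y_1, y_3, y_5$.  But now the rotation has order four on $Y$ and $Y'$.  For a
  fixed ratio $r = S'/S$ this is a quadric surface with coordinates $Y, Y', S$, and it contains the point
  $Y = \iota r$, $Y' = \iota / r$, $S = 0$, where $\iota^2 = -1$; this point depends equivariantly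
  on $r$.  Projecting from it gives the birational coordinates $r$, $A = (Y - \iota r)/S$,
  $B = (Y' - \iota/r)/S'$.  The rotation multiplies them by characters and the reflection sends
  them to $1/r$, $-B$, $-A$.  The substitution $r = b/a$, $A = a/n$, $B = b/m$ turns this
  action into a linear action on $(a, b, m, n)$ (\<open>flag_parametrization\<close>).

  \<^bold>\<open>From formulas to birational maps.\<close>  Both parametrizations and their inverses are given by
  forms, mutually inverse where certain other forms do not vanish.  That these loci are dense
  follows from joining points by polynomial curves (\<open>dense_open_nonvanishing\<close>,
  \<open>split_quadric_curve\<close>), because a nonzero polynomial in one variable has finitely many zeros.
  The result is \<open>linearizable_split_quadric\<close>.

  \<^bold>\<open>Uniqueness.\<close>  Each of the three abstract groups contains an element $e$ of order eight, and all
  its elements satisfy a relation with $e$: they commute with $e^2$ (wreath product), or they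
  centralize $e$ or conjugate it to $e^3$ (semidihedral) or to $e^{-1}$ (dihedral).  After a
  conjugation $e$ is the negacycle, and the elements of the Weyl group that satisfy the relation with
  the negacycle all lie in one explicit copy of the group.  By cardinality, the subgroup is this copy
  (\<open>conjugate_by_relation\<close>, \<open>conjugate_subgroups\<close>).  The facts about single elements of the Weyl
  group are verified by running through its 1920 elements, written as words in signed letters.
\<close>

section \<open>Forms as functions\<close>

text \<open>
  A function on the affine cone rather than a formal polynomial: the explicit maps below can then
  be written as ordinary terms, and two polynomials with the same values need not be distinguished.
\<close>

definition form :: "nat \<Rightarrow> nat \<Rightarrow> ('k::comm_semiring_1 vec \<Rightarrow> 'k) \<Rightarrow> bool" where
  "form n d g \<longleftrightarrow> (\<exists>f. homogeneous n d f \<and> (\<forall>v\<in>carrier_vec n. eval_mpoly f v = g v))"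

abbreviation monom_at :: "'k::comm_semiring_1 vec \<Rightarrow> (nat \<Rightarrow>\<^sub>0 nat) \<Rightarrow> 'k" where
  "monom_at v e \<equiv> (\<Prod>i\<in>Poly_Mapping.keys e. (v $ i) ^ Poly_Mapping.lookup e i)"

lemma monom_at_superset:
  assumes "finite S" "Poly_Mapping.keys e \<subseteq> S"
  shows "monom_at v e = (\<Prod>i\<in>S. (v $ i) ^ Poly_Mapping.lookup e i)"
  by (rule prod.mono_neutral_left) (use assms in \<open>auto simp: in_keys_iff\<close>)

lemma degree_superset:
  assumes "finite S" "Poly_Mapping.keys (e :: nat \<Rightarrow>\<^sub>0 nat) \<subseteq> S"
  shows "(\<Sum>i\<in>Poly_Mapping.keys e. Poly_Mapping.lookup e i) = (\<Sum>i\<in>S. Poly_Mapping.lookup e i)"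
  by (rule sum.mono_neutral_left) (use assms in \<open>auto simp: in_keys_iff\<close>)

lemma keys_add_nat: "Poly_Mapping.keys (a + b :: nat \<Rightarrow>\<^sub>0 nat) = Poly_Mapping.keys a \<union> Poly_Mapping.keys b"
  by (auto simp: in_keys_iff lookup_add)

lemma monom_at_add: "monom_at v (a + b) = monom_at v a * monom_at v b"
proof -
  let ?S = "Poly_Mapping.keys a \<union> Poly_Mapping.keys b"
  have "monom_at v (a + b) = (\<Prod>i\<in>?S. (v $ i) ^ Poly_Mapping.lookup (a + b) i)"
    by (simp add: keys_add_nat)
  also have "\<dots> = (\<Prod>i\<in>?S. (v $ i) ^ Poly_Mapping.lookup a i) * (\<Prod>i\<in>?S. (v $ i) ^ Poly_Mapping.lookup b i)"
    by (simp add: lookup_add power_add prod.distrib)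
  finally show ?thesis
    by (simp add: monom_at_superset[of ?S])
qed

lemma eval_mpoly_superset:
  assumes "finite S" "Poly_Mapping.keys f \<subseteq> S"
  shows "eval_mpoly f v = (\<Sum>e\<in>S. Poly_Mapping.lookup f e * monom_at v e)"
  unfolding eval_mpoly_def
  by (rule sum.mono_neutral_left) (use assms in \<open>auto simp: in_keys_iff\<close>)

lemma eval_mpoly_0 [simp]: "eval_mpoly 0 v = 0"
  by (simp add: eval_mpoly_def)

lemma eval_mpoly_add: "eval_mpoly (f + g) v = eval_mpoly f v + eval_mpoly g v"
proof -
  let ?S = "Poly_Mapping.keys f \<union> Poly_Mapping.keys g"
  have "Poly_Mapping.keys (f + g) \<subseteq> ?S" by (rule Poly_Mapping.keys_add)
  then show ?thesis
    by (simp add: eval_mpoly_superset[of ?S] lookup_add distrib_right sum.distrib)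
qed

lemma eval_mpoly_single: "eval_mpoly (Poly_Mapping.single e c) v = c * monom_at v e"
  by (cases "c = 0") (simp_all add: eval_mpoly_def)

lemma eval_mpoly_sum: "eval_mpoly (\<Sum>i\<in>A. f i) v = (\<Sum>i\<in>A. eval_mpoly (f i) v)"
  by (induction A rule: infinite_finite_induct) (simp_all add: eval_mpoly_add)

lemma mpoly_eq_sum_single: "f = (\<Sum>e\<in>Poly_Mapping.keys f. Poly_Mapping.single e (Poly_Mapping.lookup f e))"
  by (simp add: poly_mapping_eq_iff fun_eq_iff lookup_sum lookup_single when_def in_keys_iff sum.delta')

lemma eval_mpoly_mult: "eval_mpoly (f * g) v = eval_mpoly f v * eval_mpoly g v"
proof -
  let ?s = "\<lambda>f e. Poly_Mapping.single e (Poly_Mapping.lookup f e)"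
  have "f * g = (\<Sum>a\<in>Poly_Mapping.keys f. \<Sum>b\<in>Poly_Mapping.keys g. ?s f a * ?s g b)"
    by (subst (1) mpoly_eq_sum_single[of f], subst (1) mpoly_eq_sum_single[of g]) (rule sum_product)
  then have "eval_mpoly (f * g) v = (\<Sum>a\<in>Poly_Mapping.keys f. \<Sum>b\<in>Poly_Mapping.keys g.
      (Poly_Mapping.lookup f a * monom_at v a) * (Poly_Mapping.lookup g b * monom_at v b))"
    by (simp add: eval_mpoly_sum mult_single eval_mpoly_single monom_at_add mult_ac)
  then show ?thesis by (simp add: eval_mpoly_def sum_product)
qed

lemma homogeneous_add:
  assumes "homogeneous n d f" "homogeneous n d g" shows "homogeneous n d (f + g)"
  using assms Poly_Mapping.keys_add[of f g] unfolding homogeneous_def by blast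

lemma homogeneous_mult:
  fixes f g :: "'k::comm_semiring_1 mpoly"
  assumes "homogeneous n d f" "homogeneous n d' g" shows "homogeneous n (d + d') (f * g)"
  unfolding homogeneous_def
proof
  fix e assume "e \<in> Poly_Mapping.keys (f * g)"
  then obtain a b where ab: "a \<in> Poly_Mapping.keys f" "b \<in> Poly_Mapping.keys g" "e = a + b"
    using Poly_Mapping.keys_mult[of f g] by blast
  let ?S = "Poly_Mapping.keys a \<union> Poly_Mapping.keys b"
  have "(\<Sum>i\<in>?S. Poly_Mapping.lookup a i) = d" "(\<Sum>i\<in>?S. Poly_Mapping.lookup b i) = d'"
    using assms ab by (auto simp: homogeneous_def degree_superset[of ?S, symmetric])
  then show "Poly_Mapping.keys e \<subseteq> {..<n} \<and> (\<Sum>i\<in>Poly_Mapping.keys e. Poly_Mapping.lookup e i) = d + d'"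
    using assms ab by (auto simp: homogeneous_def keys_add_nat lookup_add sum.distrib)
qed

lemma form_mult: "form n d f \<Longrightarrow> form n d' g \<Longrightarrow> form n (d + d') (\<lambda>v. f v * g v)"
  unfolding form_def by (metis homogeneous_mult eval_mpoly_mult)

lemma form_add: "form n d f \<Longrightarrow> form n d g \<Longrightarrow> form n d (\<lambda>v. f v + g v)"
  unfolding form_def by (metis homogeneous_add eval_mpoly_add)

lemma form_const: "form n 0 (\<lambda>v. c)"
  unfolding form_def
  by (rule exI[of _ "Poly_Mapping.single 0 c"]) (auto simp: homogeneous_def eval_mpoly_single)

lemma form_coord: "i < n \<Longrightarrow> form n 1 (\<lambda>v. v $ i)"
  unfolding form_def
  by (rule exI[of _ "Poly_Mapping.single (Poly_Mapping.single i 1) 1"])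
     (auto simp: homogeneous_def eval_mpoly_single)

lemma form_zero: "form n d (\<lambda>v. 0)"
  unfolding form_def by (rule exI[of _ 0]) (auto simp: homogeneous_def)

lemma form_cmult: "form n d f \<Longrightarrow> form n d (\<lambda>v. c * f v)"
  using form_mult[OF form_const[of n c]] by auto

lemma form_sum: "(\<And>i. i \<in> A \<Longrightarrow> form n d (f i)) \<Longrightarrow> form n d (\<lambda>v. \<Sum>i\<in>A. f i v)"
  by (induction A rule: infinite_finite_induct) (auto intro: form_zero form_add)

lemma form_power: "form n d f \<Longrightarrow> form n (k * d) (\<lambda>v. f v ^ k)"
  by (induction k) (auto intro: form_const form_mult simp: add.commute)

lemma form_cong: "form n d f \<Longrightarrow> (\<And>v. v \<in> carrier_vec n \<Longrightarrow> f v = g v) \<Longrightarrow> form n d g"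
  unfolding form_def by metis

text \<open>
  Substituting forms of degree \<open>d\<close> into a monomial of degree \<open>e\<close> gives a product of \<open>e\<close> of
  them.
\<close>

lemma form_comp:
  fixes h :: "'k::comm_semiring_1 vec \<Rightarrow> 'k"
  assumes "form m e h" "\<And>j. j < m \<Longrightarrow> form n d (\<lambda>v. F v $ j)" "\<And>v. v \<in> carrier_vec n \<Longrightarrow> F v \<in> carrier_vec m"
  shows "form n (e * d) (\<lambda>v. h (F v))"
proof -
  obtain f where f: "homogeneous m e f" "\<And>v. v \<in> carrier_vec m \<Longrightarrow> eval_mpoly f v = h v"
    using assms(1) unfolding form_def by blast
  have prd: "form n ((\<Sum>i\<in>A. k i) * d) (\<lambda>v. \<Prod>i\<in>A. (F v $ i) ^ k i)" if "finite A" "A \<subseteq> {..<m}" for A k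
    using that
  proof (induction A)
    case (insert i A)
    have "form n (k i * d + (\<Sum>i\<in>A. k i) * d) (\<lambda>v. (F v $ i) ^ k i * (\<Prod>i\<in>A. (F v $ i) ^ k i))"
      using insert assms(2)[of i] by (intro form_mult form_power) auto
    then show ?case using insert by (simp add: distrib_right)
  qed (use form_const[of n 1] in simp)
  have "form n (e * d) (\<lambda>v. \<Sum>a\<in>Poly_Mapping.keys f. Poly_Mapping.lookup f a * monom_at (F v) a)"
  proof (intro form_sum form_cmult)
    fix a assume "a \<in> Poly_Mapping.keys f"
    then have "Poly_Mapping.keys a \<subseteq> {..<m}" "(\<Sum>i\<in>Poly_Mapping.keys a. Poly_Mapping.lookup a i) = e"
      using f(1) by (auto simp: homogeneous_def)
    then show "form n (e * d) (\<lambda>v. monom_at (F v) a)"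
      using prd[of "Poly_Mapping.keys a" "Poly_Mapping.lookup a"] by auto
  qed
  then show ?thesis
    by (rule form_cong) (use f(2) assms(3) in \<open>simp add: eval_mpoly_def[symmetric]\<close>)
qed

lemma form_scale:
  fixes f :: "'k::comm_semiring_1 vec \<Rightarrow> 'k"
  assumes "form n d f" "v \<in> carrier_vec n"
  shows "f (c \<cdot>\<^sub>v v) = c ^ d * f v"
proof -
  obtain p where p: "homogeneous n d p" "\<And>v. v \<in> carrier_vec n \<Longrightarrow> eval_mpoly p v = f v"
    using assms(1) unfolding form_def by blast
  have "eval_mpoly p (c \<cdot>\<^sub>v v) = (\<Sum>e\<in>Poly_Mapping.keys p. Poly_Mapping.lookup p e * (c ^ d * monom_at v e))"
    unfolding eval_mpoly_def
  proof (intro sum.cong refl arg_cong2[where f = "(*)"])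
    fix e assume "e \<in> Poly_Mapping.keys p"
    then have e: "Poly_Mapping.keys e \<subseteq> {..<n}" "(\<Sum>i\<in>Poly_Mapping.keys e. Poly_Mapping.lookup e i) = d"
      using p(1) by (auto simp: homogeneous_def)
    have "monom_at (c \<cdot>\<^sub>v v) e = (\<Prod>i\<in>Poly_Mapping.keys e. c ^ Poly_Mapping.lookup e i * (v $ i) ^ Poly_Mapping.lookup e i)"
      using e(1) assms(2) by (intro prod.cong refl) (auto simp: power_mult_distrib)
    then show "monom_at (c \<cdot>\<^sub>v v) e = c ^ d * monom_at v e"
      by (simp add: prod.distrib e(2)[symmetric] power_sum)
  qed
  also have "\<dots> = c ^ d * eval_mpoly p v"
    by (simp add: eval_mpoly_def sum_distrib_left mult_ac)
  finally show ?thesis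
    using p(2)[of v] p(2)[of "c \<cdot>\<^sub>v v"] assms(2) by simp
qed

section \<open>Polynomial curves\<close>

definition polyfun :: "('k::comm_ring_1 \<Rightarrow> 'k) \<Rightarrow> bool" where
  "polyfun g \<longleftrightarrow> (\<exists>p. g = poly p)"

lemma polyfun_const: "polyfun (\<lambda>s. c)"
  unfolding polyfun_def by (rule exI[of _ "[:c:]"]) (simp add: fun_eq_iff)

lemma polyfun_id: "polyfun (\<lambda>s. s)"
  unfolding polyfun_def by (rule exI[of _ "[:0, 1:]"]) (simp add: fun_eq_iff)

lemma polyfun_add: "polyfun f \<Longrightarrow> polyfun g \<Longrightarrow> polyfun (\<lambda>s. f s + g s)"
  unfolding polyfun_def by (elim exE, rule_tac x = "p + pa" in exI) (simp add: fun_eq_iff)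

lemma polyfun_diff: "polyfun f \<Longrightarrow> polyfun g \<Longrightarrow> polyfun (\<lambda>s. f s - g s)"
  unfolding polyfun_def by (elim exE, rule_tac x = "p - pa" in exI) (simp add: fun_eq_iff)

lemma polyfun_mult: "polyfun f \<Longrightarrow> polyfun g \<Longrightarrow> polyfun (\<lambda>s. f s * g s)"
  unfolding polyfun_def by (elim exE, rule_tac x = "p * pa" in exI) (simp add: fun_eq_iff)

lemma polyfun_power: "polyfun f \<Longrightarrow> polyfun (\<lambda>s. f s ^ k)"
  unfolding polyfun_def by (elim exE, rule_tac x = "p ^ k" in exI) (simp add: fun_eq_iff)

lemma polyfun_sum: "(\<And>i. i \<in> A \<Longrightarrow> polyfun (f i)) \<Longrightarrow> polyfun (\<lambda>s. \<Sum>i\<in>A. f i s)"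
  by (induction A rule: infinite_finite_induct) (auto intro: polyfun_const polyfun_add)

lemma polyfun_prod: "(\<And>i. i \<in> A \<Longrightarrow> polyfun (f i)) \<Longrightarrow> polyfun (\<lambda>s. \<Prod>i\<in>A. f i s)"
  by (induction A rule: infinite_finite_induct) (auto intro: polyfun_const polyfun_mult)

lemmas polyfun_intros = polyfun_const polyfun_id polyfun_add polyfun_diff polyfun_mult polyfun_power

text \<open>
  This reduces questions about forms on projective varieties to polynomials in one variable.
\<close>

lemma polyfun_form:
  fixes f :: "'k::comm_ring_1 vec \<Rightarrow> 'k"
  assumes "form n d f" "\<And>i. i < n \<Longrightarrow> polyfun (\<lambda>s. \<gamma> s $ i)" "\<And>s. \<gamma> s \<in> carrier_vec n"
  shows "polyfun (\<lambda>s. f (\<gamma> s))"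
proof -
  obtain p where p: "homogeneous n d p" "\<And>v. v \<in> carrier_vec n \<Longrightarrow> eval_mpoly p v = f v"
    using assms(1) unfolding form_def by blast
  have "polyfun (\<lambda>s. eval_mpoly p (\<gamma> s))"
    unfolding eval_mpoly_def using p(1)
    by (intro polyfun_sum polyfun_mult polyfun_const polyfun_prod polyfun_power assms(2))
       (auto simp: homogeneous_def)
  then show ?thesis using p(2)[OF assms(3)] by simp
qed

text \<open>
  The product of three nonzero polynomials is nonzero, and the field is infinite.
\<close>

lemma polyfun_common_nonzero:
  fixes f g h :: "'k::field_char_0 \<Rightarrow> 'k"
  assumes "polyfun f" "polyfun g" "polyfun h" "f a \<noteq> 0" "g b \<noteq> 0" "h c \<noteq> 0"
  shows "\<exists>s. f s \<noteq> 0 \<and> g s \<noteq> 0 \<and> h s \<noteq> 0"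
proof -
  obtain p q r where eq: "f = poly p" "g = poly q" "h = poly r"
    using assms(1-3) unfolding polyfun_def by blast
  then have "p * q * r \<noteq> 0" using assms(4-6) by auto
  then have "finite {s. poly (p * q * r) s = 0}" by (rule poly_roots_finite)
  then obtain s where "poly (p * q * r) s \<noteq> 0"
    using infinite_UNIV_char_0[where 'a = 'k] by (metis (mono_tags, lifting) UNIV_eq_I mem_Collect_eq)
  then show ?thesis using eq by auto
qed

section \<open>The Zariski topology\<close>

lemma pt_eq_iff: 
  fixes v w :: "'k::field vec"
  shows "pt v = pt w \<longleftrightarrow> (\<exists>c. c \<noteq> 0 \<and> w = c \<cdot>\<^sub>v v)"
proof
  assume "pt v = pt w"
  moreover have "w \<in> pt w" unfolding pt_def by (auto intro!: exI[of _ 1])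
  ultimately show "\<exists>c. c \<noteq> 0 \<and> w = c \<cdot>\<^sub>v v" unfolding pt_def by auto
next
  assume "\<exists>c. c \<noteq> 0 \<and> w = c \<cdot>\<^sub>v v"
  then obtain c where c: "c \<noteq> 0" "w = c \<cdot>\<^sub>v v" by blast
  have "a \<cdot>\<^sub>v v = (a / c) \<cdot>\<^sub>v w" for a using c by (simp add: smult_smult_assoc)
  moreover have "a \<cdot>\<^sub>v w = (a * c) \<cdot>\<^sub>v v" for a using c by (simp add: smult_smult_assoc)
  ultimately show "pt v = pt w" unfolding pt_def using c(1)
    by (smt (verit, ccfv_SIG) Collect_cong divide_eq_0_iff mult_eq_0_iff)
qed

lemma pt_smult: "c \<noteq> 0 \<Longrightarrow> pt (c \<cdot>\<^sub>v v) = pt (v :: 'k::field vec)"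
  by (metis pt_eq_iff)

lemma smult_nonzero:
  fixes v :: "'k::field vec"
  assumes "v \<in> carrier_vec n" "v \<noteq> 0\<^sub>v n" "c \<noteq> 0"
  shows "c \<cdot>\<^sub>v v \<noteq> 0\<^sub>v n"
proof
  assume "c \<cdot>\<^sub>v v = 0\<^sub>v n"
  then have "inverse c \<cdot>\<^sub>v (c \<cdot>\<^sub>v v) = inverse c \<cdot>\<^sub>v 0\<^sub>v n" by simp
  also have "\<dots> = 0\<^sub>v n" by (intro eq_vecI) auto
  finally show False using assms by (simp add: smult_smult_assoc)
qed

lemma pt_in_proj_iff:
  fixes v :: "'k::field vec"
  assumes "v \<in> carrier_vec n" shows "pt v \<in> proj n \<longleftrightarrow> v \<noteq> 0\<^sub>v n"
proof
  assume "pt v \<in> proj n"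
  then obtain w where w: "w \<in> carrier_vec n" "w \<noteq> 0\<^sub>v n" "pt w = pt v" unfolding proj_def by auto
  then show "v \<noteq> 0\<^sub>v n" using smult_nonzero by (metis pt_eq_iff)
qed (use assms in \<open>auto simp: proj_def\<close>)

text \<open>
  The basic open sets in terms of functions instead of formal polynomials.
\<close>

definition nonvanishing :: "nat \<Rightarrow> ('k::field vec \<Rightarrow> 'k) \<Rightarrow> 'k vec set set" where
  "nonvanishing n f = {pt v | v. v \<in> carrier_vec n \<and> v \<noteq> 0\<^sub>v n \<and> f v \<noteq> 0}"

lemma nonvanishing_cong:
  "(\<And>v. v \<in> carrier_vec n \<Longrightarrow> f v = g v) \<Longrightarrow> nonvanishing n f = nonvanishing n g"
  unfolding nonvanishing_def by auto

lemma pt_in_nonvanishing_iff: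
  fixes v :: "'k::field vec"
  assumes "form n d f" "v \<in> carrier_vec n"
  shows "pt v \<in> nonvanishing n f \<longleftrightarrow> v \<noteq> 0\<^sub>v n \<and> f v \<noteq> 0"
proof
  assume "pt v \<in> nonvanishing n f"
  then obtain w where w: "w \<in> carrier_vec n" "w \<noteq> 0\<^sub>v n" "f w \<noteq> 0" "pt w = pt v"
    unfolding nonvanishing_def by auto
  then obtain c where c: "c \<noteq> 0" "v = c \<cdot>\<^sub>v w" unfolding pt_eq_iff by blast
  show "v \<noteq> 0\<^sub>v n \<and> f v \<noteq> 0"
    using smult_nonzero[OF w(1,2) c(1)] form_scale[OF assms(1) w(1), of c] c w(3) by simp
qed (use assms in \<open>auto simp: nonvanishing_def\<close>)

lemma basic_opens_eq:
  "{basic_open n f | f d. homogeneous n d f} = {nonvanishing n g | g d. form n d (g :: 'k::field vec \<Rightarrow> 'k)}"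
proof -
  have "basic_open n f = nonvanishing n (eval_mpoly f)" for f :: "'k mpoly"
    by (simp add: basic_open_def nonvanishing_def)
  moreover have "form n d (eval_mpoly f)" if "homogeneous n d f" for f :: "'k mpoly" and d
    using that by (auto simp: form_def)
  moreover have "\<exists>f. homogeneous n d f \<and> nonvanishing n (eval_mpoly f) = nonvanishing n g"
    if "form n d g" for g :: "'k vec \<Rightarrow> 'k" and d
    using that unfolding form_def by (metis nonvanishing_cong)
  ultimately show ?thesis by (auto 0 3) metis+
qed

lemma nonvanishing_1: "nonvanishing n (\<lambda>v. 1) = (proj n :: 'k::field vec set set)"
  by (auto simp: nonvanishing_def proj_def)

lemma nonvanishing_subset_proj: "nonvanishing n f \<subseteq> proj n"
  by (auto simp: nonvanishing_def proj_def)

lemma topspace_zariski: "topspace (zariski n) = (proj n :: 'k::field vec set set)"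
proof -
  have "proj n \<in> {nonvanishing n g | g d. form n d (g :: 'k vec \<Rightarrow> 'k)}"
    using form_const[of n 1] nonvanishing_1 by (metis (mono_tags, lifting) mem_Collect_eq)
  then show ?thesis
    unfolding zariski_def basic_opens_eq topology_generated_by_topspace
    using nonvanishing_subset_proj by blast
qed

lemma openin_nonvanishing: "form n d f \<Longrightarrow> openin (zariski n) (nonvanishing n f)"
  unfolding zariski_def basic_opens_eq
  by (rule topology_generated_by_Basis) blast

lemma nonvanishing_inter:
  fixes f g :: "'k::field vec \<Rightarrow> 'k"
  assumes "form n d f" "form n e g"
  shows "nonvanishing n f \<inter> nonvanishing n g = nonvanishing n (\<lambda>v. f v * g v)"
proof
  show "nonvanishing n f \<inter> nonvanishing n g \<subseteq> nonvanishing n (\<lambda>v. f v * g v)"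
  proof
    fix p assume p: "p \<in> nonvanishing n f \<inter> nonvanishing n g"
    then obtain v where v: "v \<in> carrier_vec n" "p = pt v" unfolding nonvanishing_def by blast
    show "p \<in> nonvanishing n (\<lambda>v. f v * g v)"
      using p v pt_in_nonvanishing_iff[OF assms(1)] pt_in_nonvanishing_iff[OF assms(2)]
        pt_in_nonvanishing_iff[OF form_mult[OF assms]] by auto
  qed
qed (auto simp: nonvanishing_def)

text \<open>
  The sets of nonvanishing of forms are closed under finite intersections, as one sees by
  multiplying the forms; hence they are a basis and not merely a subbasis.
\<close>

lemma openin_zariski_nonvanishing:
  fixes W :: "'k::field vec set set"
  assumes "openin (zariski n) W" "p \<in> W"
  shows "\<exists>f d. form n d f \<and> p \<in> nonvanishing n f \<and> nonvanishing n f \<subseteq> W"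
proof -
  have "generate_topology_on {nonvanishing n g | g d. form n d (g :: 'k vec \<Rightarrow> 'k)} W"
    using assms(1) unfolding zariski_def basic_opens_eq by (rule openin_topology_generated_by)
  then show ?thesis using assms(2)
  proof (induction arbitrary: p rule: generate_topology_on.induct)
    case (Int a b)
    obtain f d where f: "form n d f" "p \<in> nonvanishing n f" "nonvanishing n f \<subseteq> a"
      using Int.IH(1)[of p] Int.prems by blast
    obtain g e where g: "form n e g" "p \<in> nonvanishing n g" "nonvanishing n g \<subseteq> b"
      using Int.IH(2)[of p] Int.prems by blast
    show ?case
      using form_mult[OF f(1) g(1)] nonvanishing_inter[OF f(1) g(1)] f(2,3) g(2,3) by blast
  next
    case (UN K)
    then obtain K' where "K' \<in> K" "p \<in> K'" by blast
    then show ?case using UN.IH[of K' p] by blast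
  qed auto
qed

text \<open>
  A substitute for irreducibility.  Given a nonempty open set of \<open>X\<close>, take a curve in \<open>X\<close> from a
  point of this set to a point where \<open>f\<close> does not vanish: the form that defines the open set and
  \<open>f\<close> both restrict to nonzero polynomials on the curve, so they have a common nonzero.  A coordinate
  of the curve is included as a third polynomial, to stay away from the origin of the cone.
\<close>

lemma dense_open_nonvanishing:
  fixes X :: "'k::field_char_0 vec set set"
  assumes X: "X \<subseteq> proj n" and f: "form n d f"
    and curves: "\<And>v. v \<in> carrier_vec n \<Longrightarrow> pt v \<in> X \<Longrightarrow> \<exists>\<gamma> a b c.
      (\<forall>s. \<gamma> s \<in> carrier_vec n \<and> (\<gamma> s \<noteq> 0\<^sub>v n \<longrightarrow> pt (\<gamma> s) \<in> X)) \<and> (\<forall>i<n. polyfun (\<lambda>s. \<gamma> s $ i)) \<and>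
      c \<noteq> 0 \<and> \<gamma> a = c \<cdot>\<^sub>v v \<and> f (\<gamma> b) \<noteq> 0"
  shows "dense_open (subtopology (zariski n) X) (X \<inter> nonvanishing n f)"
proof -
  let ?T = "subtopology (zariski n) X"
  have top: "topspace ?T = X" using X by (auto simp: topspace_zariski)
  have "openin ?T (X \<inter> nonvanishing n f)"
    using openin_nonvanishing[OF f] by (auto simp: openin_subtopology)
  moreover have "Abstract_Topology.closure_of ?T (X \<inter> nonvanishing n f) = X"
  proof (rule antisym)
    show "Abstract_Topology.closure_of ?T (X \<inter> nonvanishing n f) \<subseteq> X" using top by (metis closure_of_subset_topspace)
    show "X \<subseteq> Abstract_Topology.closure_of ?T (X \<inter> nonvanishing n f)"
    proof
      fix p assume p: "p \<in> X"
      have "\<exists>y. y \<in> X \<inter> nonvanishing n f \<and> y \<in> N" if N: "p \<in> N" "openin ?T N" for N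
      proof -
        obtain W where W: "openin (zariski n) W" "N = W \<inter> X" using N(2) by (auto simp: openin_subtopology)
        obtain g e where g: "form n e g" "p \<in> nonvanishing n g" "nonvanishing n g \<subseteq> W"
          using openin_zariski_nonvanishing[OF W(1)] N(1) W(2) by blast
        obtain v where v: "v \<in> carrier_vec n" "v \<noteq> 0\<^sub>v n" "g v \<noteq> 0" "p = pt v"
          using g(2) by (auto simp: nonvanishing_def)
        obtain \<gamma> a b c where \<gamma>: "\<And>s. \<gamma> s \<in> carrier_vec n" "\<And>s. \<gamma> s \<noteq> 0\<^sub>v n \<Longrightarrow> pt (\<gamma> s) \<in> X"
          "\<And>i. i < n \<Longrightarrow> polyfun (\<lambda>s. \<gamma> s $ i)" "c \<noteq> 0" "\<gamma> a = c \<cdot>\<^sub>v v" "f (\<gamma> b) \<noteq> 0"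
          using curves[OF v(1)] p v(4) by blast
        obtain i where i: "i < n" "v $ i \<noteq> 0" using v(1,2) by (metis eq_vecI index_zero_vec carrier_vecD)
        have ga: "g (\<gamma> a) \<noteq> 0" using form_scale[OF g(1) v(1)] \<gamma>(4,5) v(3) by simp
        have ia: "\<gamma> a $ i \<noteq> 0" using \<gamma>(4,5) i v(1) by simp
        obtain s where s: "g (\<gamma> s) \<noteq> 0" "f (\<gamma> s) \<noteq> 0" "\<gamma> s $ i \<noteq> 0"
          using polyfun_common_nonzero[OF polyfun_form[OF g(1) \<gamma>(3,1)] polyfun_form[OF f \<gamma>(3,1)] \<gamma>(3)[OF i(1)] ga \<gamma>(6) ia]
          by blast
        have "\<gamma> s \<noteq> 0\<^sub>v n" using s(3) i(1) by auto
        then have "pt (\<gamma> s) \<in> X \<inter> nonvanishing n f \<inter> N"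
          using \<gamma>(1,2)[of s] s g(3) W(2) by (auto simp: nonvanishing_def)
        then show ?thesis by blast
      qed
      then show "p \<in> Abstract_Topology.closure_of ?T (X \<inter> nonvanishing n f)" using p top by (auto simp: in_closure_of)
    qed
  qed
  ultimately show ?thesis unfolding dense_open_def top by blast
qed

section \<open>Birational maps given by forms\<close>

definition form_map :: "nat \<Rightarrow> nat \<Rightarrow> nat \<Rightarrow> ('k::comm_semiring_1 vec \<Rightarrow> 'k vec) \<Rightarrow> bool" where
  "form_map n m d F \<longleftrightarrow> (\<forall>v\<in>carrier_vec n. F v \<in> carrier_vec m) \<and> (\<forall>j<m. form n d (\<lambda>v. F v $ j))"

lemma form_map_mat:
  assumes "form_map n m d F" "C \<in> carrier_mat k m"
  shows "form_map n k d (\<lambda>v. C *\<^sub>v F v)"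
  unfolding form_map_def
proof (intro conjI ballI allI impI)
  show "C *\<^sub>v F v \<in> carrier_vec k" if "v \<in> carrier_vec n" for v
    using assms that by (auto simp: form_map_def)
  fix j assume j: "j < k"
  have "form n d (\<lambda>v. \<Sum>i = 0..<m. C $$ (j, i) * F v $ i)"
    using assms(1) by (intro form_sum form_cmult) (auto simp: form_map_def)
  then show "form n d (\<lambda>v. (C *\<^sub>v F v) $ j)"
    by (rule form_cong) (use assms j in \<open>auto simp: form_map_def scalar_prod_def\<close>)
qed

lemma form_mat:
  assumes "form n d f" "C \<in> carrier_mat n k"
  shows "form k d (\<lambda>v. f (C *\<^sub>v v))"
proof -
  have "form_map k k 1 (\<lambda>v :: 'a vec. v)" unfolding form_map_def using form_coord by blast
  then have "form_map k n 1 (\<lambda>v. C *\<^sub>v v)" using form_map_mat assms(2) by blast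
  then show ?thesis using form_comp[OF assms(1), of k 1 "\<lambda>v. C *\<^sub>v v"] by (auto simp: form_map_def)
qed

lemma form_map_scale:
  assumes "form_map n m d F" "v \<in> carrier_vec n"
  shows "F (c \<cdot>\<^sub>v v) = c ^ d \<cdot>\<^sub>v F v"
proof (rule eq_vecI)
  have dims: "F v \<in> carrier_vec m" "F (c \<cdot>\<^sub>v v) \<in> carrier_vec m"
    using assms by (auto simp: form_map_def)
  then show "dim_vec (F (c \<cdot>\<^sub>v v)) = dim_vec (c ^ d \<cdot>\<^sub>v F v)" by auto
  fix j assume "j < dim_vec (c ^ d \<cdot>\<^sub>v F v)"
  then show "F (c \<cdot>\<^sub>v v) $ j = (c ^ d \<cdot>\<^sub>v F v) $ j"
    using dims assms form_scale[of n d "\<lambda>v. F v $ j" v c] by (auto simp: form_map_def)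
qed

text \<open>
  The representative is arbitrary: for forms of one degree, another choice only rescales the
  value.
\<close>

definition proj_map :: "nat \<Rightarrow> ('k::field vec \<Rightarrow> 'k vec) \<Rightarrow> 'k vec set \<Rightarrow> 'k vec set" where
  "proj_map n F p = pt (F (SOME v. v \<in> carrier_vec n \<and> p = pt v))"

lemma proj_map_pt:
  fixes v :: "'k::field vec"
  assumes "form_map n m d F" "v \<in> carrier_vec n"
  shows "proj_map n F (pt v) = pt (F v)"
proof -
  let ?w = "SOME w. w \<in> carrier_vec n \<and> pt v = pt w"
  have w: "?w \<in> carrier_vec n \<and> pt v = pt ?w" by (rule someI) (use assms(2) in auto)
  then obtain c where "c \<noteq> 0" "?w = c \<cdot>\<^sub>v v" unfolding pt_eq_iff by blast
  then have "F ?w = c ^ d \<cdot>\<^sub>v F v" "c ^ d \<noteq> 0" using form_map_scale[OF assms] by auto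
  then show ?thesis unfolding proj_map_def by (simp add: pt_smult)
qed

lemma regular_map_form_map:
  fixes A :: "'k::field vec set set"
  assumes "form_map n m d F" "A \<subseteq> proj n"
    and "\<And>v. v \<in> carrier_vec n \<Longrightarrow> pt v \<in> A \<Longrightarrow> F v \<noteq> 0\<^sub>v m \<and> \<phi> (pt v) = pt (F v)"
  shows "regular_map n m A \<phi>"
proof -
  have "\<forall>j. \<exists>f. j < m \<longrightarrow> homogeneous n d f \<and> (\<forall>v\<in>carrier_vec n. eval_mpoly f v = F v $ j)"
    using assms(1) unfolding form_map_def form_def by blast
  then obtain f where f: "\<And>j. j < m \<Longrightarrow> homogeneous n d (f j)"
    "\<And>j v. j < m \<Longrightarrow> v \<in> carrier_vec n \<Longrightarrow> eval_mpoly (f j) v = F v $ j" by metis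
  have eq: "vec m (\<lambda>j. eval_mpoly (f j) v) = F v" if "v \<in> carrier_vec n" for v
    using f(2) that assms(1) by (intro eq_vecI) (auto simp: form_map_def)
  have "topspace (subtopology (zariski n) A) = A"
    using assms(2) by (auto simp: topspace_zariski)
  then have open_A: "openin (subtopology (zariski n) A) A"
    using openin_topspace[of "subtopology (zariski n) A"] by argo
  show ?thesis
    unfolding regular_map_def
    by (intro ballI exI[of _ A] exI[of _ d] exI[of _ f] conjI)
       (use open_A f(1) eq assms(3) in auto)
qed

text \<open>
  The forms \<open>D\<close> and \<open>E\<close> cut out the open sets between which \<open>F\<close> and \<open>H\<close> are inverse to each other.
  In projective space, density comes from the straight lines through \<open>v0\<close>; in \<open>Y\<close> it is an
  assumption on curves.
\<close>

lemma birational_via_form_maps: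
  fixes F H :: "'k::field_char_0 vec \<Rightarrow> 'k vec"
  assumes F: "form_map n m d F" and H: "form_map m n e H"
    and D: "form n a D" and E: "form m b E" and Y: "Y \<subseteq> proj m"
    and FD: "\<And>v. v \<in> carrier_vec n \<Longrightarrow> v \<noteq> 0\<^sub>v n \<Longrightarrow> D v \<noteq> 0 \<Longrightarrow>
      pt (F v) \<in> Y \<and> E (F v) \<noteq> 0 \<and> (\<exists>c. c \<noteq> 0 \<and> H (F v) = c \<cdot>\<^sub>v v)"
    and HE: "\<And>y. y \<in> carrier_vec m \<Longrightarrow> pt y \<in> Y \<Longrightarrow> E y \<noteq> 0 \<Longrightarrow>
      H y \<noteq> 0\<^sub>v n \<and> D (H y) \<noteq> 0 \<and> (\<exists>c. c \<noteq> 0 \<and> F (H y) = c \<cdot>\<^sub>v y)"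
    and v0: "v0 \<in> carrier_vec n" "D v0 \<noteq> 0"
    and curves: "\<And>y. y \<in> carrier_vec m \<Longrightarrow> pt y \<in> Y \<Longrightarrow> \<exists>\<gamma> a b c.
      (\<forall>s. \<gamma> s \<in> carrier_vec m \<and> (\<gamma> s \<noteq> 0\<^sub>v m \<longrightarrow> pt (\<gamma> s) \<in> Y)) \<and> (\<forall>i<m. polyfun (\<lambda>s. \<gamma> s $ i)) \<and>
      c \<noteq> 0 \<and> \<gamma> a = c \<cdot>\<^sub>v y \<and> E (\<gamma> b) \<noteq> 0"
  shows "birational_via n (proj n) m Y (nonvanishing n D) (Y \<inter> nonvanishing m E) (proj_map n F)"
proof -
  let ?U = "nonvanishing n D" and ?V = "Y \<inter> nonvanishing m E"
  let ?f = "proj_map n F" and ?g = "proj_map m H"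
  have dF: "F v \<in> carrier_vec m" if "v \<in> carrier_vec n" for v using F that by (auto simp: form_map_def)
  have dH: "H v \<in> carrier_vec n" if "v \<in> carrier_vec m" for v using H that by (auto simp: form_map_def)
  have F_nz: "F v \<noteq> 0\<^sub>v m" if "v \<in> carrier_vec n" "v \<noteq> 0\<^sub>v n" "D v \<noteq> 0" for v
    using FD[OF that] Y pt_in_proj_iff[OF dF[OF that(1)]] by blast
  have U: "\<exists>v. v \<in> carrier_vec n \<and> v \<noteq> 0\<^sub>v n \<and> D v \<noteq> 0 \<and> p = pt v" if "p \<in> ?U" for p
    using that by (auto simp: nonvanishing_def)
  have V: "\<exists>y. y \<in> carrier_vec m \<and> E y \<noteq> 0 \<and> pt y \<in> Y \<and> p = pt y" if "p \<in> ?V" for p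
    using that by (auto simp: nonvanishing_def)
  have fU: "?f p \<in> ?V \<and> ?g (?f p) = p" if p: "p \<in> ?U" for p
  proof -
    obtain v where v: "v \<in> carrier_vec n" "v \<noteq> 0\<^sub>v n" "D v \<noteq> 0" "p = pt v" using U[OF p] by blast
    obtain c where c: "c \<noteq> 0" "H (F v) = c \<cdot>\<^sub>v v" using FD[OF v(1-3)] by blast
    have "?f p = pt (F v)" using proj_map_pt[OF F v(1)] v(4) by simp
    moreover have "pt (F v) \<in> ?V"
      using FD[OF v(1-3)] pt_in_nonvanishing_iff[OF E dF[OF v(1)]] F_nz[OF v(1-3)] by blast
    moreover have "?g (pt (F v)) = pt v"
      using proj_map_pt[OF H dF[OF v(1)]] c by (simp add: pt_smult)
    ultimately show ?thesis using v(4) by simp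
  qed
  have gV: "?g p \<in> ?U \<and> ?f (?g p) = p" if p: "p \<in> ?V" for p
  proof -
    obtain y where y: "y \<in> carrier_vec m" "E y \<noteq> 0" "pt y \<in> Y" "p = pt y" using V[OF p] by blast
    obtain c where c: "c \<noteq> 0" "F (H y) = c \<cdot>\<^sub>v y" using HE[OF y(1,3,2)] by blast
    have "?g p = pt (H y)" using proj_map_pt[OF H y(1)] y(4) by simp
    moreover have "pt (H y) \<in> ?U"
      using HE[OF y(1,3,2)] pt_in_nonvanishing_iff[OF D dH[OF y(1)]] by blast
    moreover have "?f (pt (H y)) = pt y"
      using proj_map_pt[OF F dH[OF y(1)]] c by (simp add: pt_smult)
    ultimately show ?thesis using y(4) by simp
  qed
  have bij: "bij_betw ?f ?U ?V"
    by (rule bij_betw_byWitness[where f' = ?g]) (use fU gV in blast)+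
  have inv: "inv_into ?U ?f p = ?g p" if "p \<in> ?V" for p
    using gV[OF that] bij by (metis bij_betw_def inv_into_f_eq)
  have "dense_open (subtopology (zariski n) (proj n)) (proj n \<inter> ?U)"
  proof (rule dense_open_nonvanishing[OF subset_refl D])
    fix v :: "'k vec" assume v: "v \<in> carrier_vec n"
    let ?l = "\<lambda>s. v + s \<cdot>\<^sub>v (v0 - v)"
    have "polyfun (\<lambda>s. ?l s $ i)" if "i < n" for i
      using v v0(1) that by (auto intro!: polyfun_intros)
    moreover have "pt (?l s) \<in> proj n" if "?l s \<noteq> 0\<^sub>v n" for s
      using v v0(1) that by (subst pt_in_proj_iff) auto
    moreover have "?l 0 = 1 \<cdot>\<^sub>v v" "?l 1 = v0" using v v0(1) by (auto intro!: eq_vecI)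
    ultimately show "\<exists>\<gamma> a b c.
      (\<forall>s. \<gamma> s \<in> carrier_vec n \<and> (\<gamma> s \<noteq> 0\<^sub>v n \<longrightarrow> pt (\<gamma> s) \<in> proj n)) \<and> (\<forall>i<n. polyfun (\<lambda>s. \<gamma> s $ i)) \<and>
      c \<noteq> 0 \<and> \<gamma> a = c \<cdot>\<^sub>v v \<and> D (\<gamma> b) \<noteq> 0"
      using v v0 by (intro exI[of _ ?l] exI[of _ 0] exI[of _ 1]) auto
  qed
  then have "dense_open (subtopology (zariski n) (proj n)) ?U"
    using nonvanishing_subset_proj[of n D] by (simp add: inf.absorb2)
  moreover have "dense_open (subtopology (zariski m) Y) ?V"
    by (rule dense_open_nonvanishing[OF Y E curves])
  moreover have "regular_map n m ?U ?f"
    using pt_in_nonvanishing_iff[OF D] F_nz proj_map_pt[OF F]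
    by (intro regular_map_form_map[OF F nonvanishing_subset_proj]) blast
  moreover have "regular_map m n ?V (inv_into ?U ?f)"
  proof (rule regular_map_form_map[OF H])
    show "?V \<subseteq> proj m" using Y by blast
    fix y :: "'k vec" assume y: "y \<in> carrier_vec m" "pt y \<in> ?V"
    then have "E y \<noteq> 0" using pt_in_nonvanishing_iff[OF E y(1)] by blast
    then show "H y \<noteq> 0\<^sub>v n \<and> inv_into ?U ?f (pt y) = pt (H y)"
      using HE[OF y(1)] y inv[OF y(2)] proj_map_pt[OF H y(1)] by auto
  qed
  ultimately show ?thesis unfolding birational_via_def using bij by blast
qed

section \<open>The split quadric\<close>

definition split_form :: "'k::comm_ring_1 vec \<Rightarrow> 'k" where
  "split_form y = y $ 0 * y $ 1 + y $ 2 * y $ 3 + (y $ 4)\<^sup>2"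

lemma all_less_5: "(\<forall>j<5. P j) \<longleftrightarrow> P 0 \<and> P 1 \<and> P 2 \<and> P 3 \<and> P (4 :: nat)"
  by (simp add: eval_nat_numeral All_less_Suc) blast

lemma all_less_4: "(\<forall>j<4. P j) \<longleftrightarrow> P 0 \<and> P 1 \<and> P 2 \<and> P (3 :: nat)"
  by (simp add: eval_nat_numeral All_less_Suc) blast

text \<open>
  Projection from a point \<open>e\<close> of the quadric with equation \<open>q = 0\<close> and polar form \<open>B\<close> has the
  inverse \<open>d \<mapsto> q d \<cdot> e - B e d \<cdot> d\<close>.  The image of the line that joins \<open>y\<close> and \<open>z\<close> is a curve on the
  quadric, which passes through multiples of \<open>y\<close> and \<open>z\<close> that are nonzero as long as neither point is
  orthogonal to \<open>e\<close>.  A basis vector \<open>e\<close> with this property exists since a point of the quadric has a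
  nonzero coordinate among the first four, and \<open>z\<close> has no zero there.
\<close>

lemma split_quadric_curve:
  fixes y z :: "'k::field vec"
  assumes y: "y \<in> carrier_vec 5" "y \<noteq> 0\<^sub>v 5" "split_form y = 0"
    and z: "z \<in> carrier_vec 5" "split_form z = 0" "\<forall>i<4. z $ i \<noteq> 0"
  shows "\<exists>\<gamma> c c'. (\<forall>s. \<gamma> s \<in> carrier_vec 5 \<and> split_form (\<gamma> s) = 0) \<and> (\<forall>i<5. polyfun (\<lambda>s. \<gamma> s $ i)) \<and>
    c \<noteq> 0 \<and> \<gamma> 0 = c \<cdot>\<^sub>v y \<and> c' \<noteq> 0 \<and> \<gamma> 1 = c' \<cdot>\<^sub>v z"
proof -
  have "\<exists>i<4. y $ i \<noteq> 0"
  proof (rule ccontr)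
    assume "\<not> ?thesis"
    then have z: "\<forall>i<4. y $ i = 0" by blast
    then have "y $ 4 = 0" using y(3) by (simp add: split_form_def all_less_4)
    then have "y = 0\<^sub>v 5" using y(1) z by (intro eq_vecI) (auto simp: less_Suc_eq numeral_eq_Suc)
    then show False using y(2) by simp
  qed
  then obtain i where i: "i < 4" "y $ i \<noteq> 0" by blast
  define j :: nat where "j = (if even i then i + 1 else i - 1)"
  define d where "d s k = y $ k + s * (z $ k - y $ k)" for s k
  define q where "q s = d s 0 * d s 1 + d s 2 * d s 3 + (d s 4)\<^sup>2" for s
  define \<gamma> where "\<gamma> s = vec 5 (\<lambda>k. q s * (if k = j then 1 else 0) - d s i * d s k)" for s
  have "polyfun (\<lambda>s. d s k)" for k unfolding d_def by (intro polyfun_intros)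
  then have "polyfun (\<lambda>s. q s * (if k = j then 1 else 0) - d s i * d s k)" for k
    unfolding q_def by (intro polyfun_intros)
  then have "\<forall>k<5. polyfun (\<lambda>s. \<gamma> s $ k)"
    unfolding \<gamma>_def by simp
  moreover have "split_form (\<gamma> s) = 0" for s
  proof -
    have \<gamma>_eq: "\<gamma> s $ k = q s * (if k = j then 1 else 0) - d s i * d s k" if "k < 5" for k
      using that by (simp add: \<gamma>_def)
    have "i = 0 \<or> i = 1 \<or> i = 2 \<or> i = 3" using i(1) by auto
    then show ?thesis
    proof (elim disjE)
      assume "i = 0"
      then show ?thesis
        by (simp add: split_form_def \<gamma>_eq j_def) (simp add: q_def algebra_simps power2_eq_square)
    next
      assume "i = 1"
      then show ?thesis
        by (simp add: split_form_def \<gamma>_eq j_def) (simp add: q_def algebra_simps power2_eq_square)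
    next
      assume "i = 2"
      then show ?thesis
        by (simp add: split_form_def \<gamma>_eq j_def) (simp add: q_def algebra_simps power2_eq_square)
    next
      assume "i = 3"
      then show ?thesis
        by (simp add: split_form_def \<gamma>_eq j_def) (simp add: q_def algebra_simps power2_eq_square)
    qed
  qed
  moreover have "\<gamma> 0 = (- y $ i) \<cdot>\<^sub>v y"
    using y by (intro eq_vecI) (auto simp: \<gamma>_def q_def d_def split_form_def)
  moreover have "\<gamma> 1 = (- z $ i) \<cdot>\<^sub>v z"
    using z by (intro eq_vecI) (auto simp: \<gamma>_def q_def d_def split_form_def)
  moreover have "\<gamma> s \<in> carrier_vec 5" for s by (simp add: \<gamma>_def)
  ultimately show ?thesis using i z(3)
    by (intro exI[of _ \<gamma>] exI[of _ "- y $ i"] exI[of _ "- z $ i"]) auto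
qed

lemma proj_action_pt:
  fixes v :: "'k::field vec"
  assumes "g \<in> carrier_mat m n" "v \<in> carrier_vec n"
  shows "proj_action g (pt v) = pt (g *\<^sub>v v)"
proof -
  have eq: "g *\<^sub>v (c \<cdot>\<^sub>v v) = c \<cdot>\<^sub>v (g *\<^sub>v v)" for c using assms by (rule mult_mat_vec)
  show ?thesis unfolding proj_action_def pt_def
    by (auto simp: eq image_iff) (metis eq)
qed

lemma GL_carrier: "A \<in> carrier (GL n) \<Longrightarrow> A \<in> carrier_mat n n"
  by (auto simp: GL_def units_of_def Units_def ring_mat_def)

definition split_coords :: "'k::comm_ring_1 mat \<Rightarrow> 'k mat \<Rightarrow> bool" where
  "split_coords C C' \<longleftrightarrow> C \<in> carrier_mat 5 5 \<and> C' \<in> carrier_mat 5 5 \<and> C * C' = 1\<^sub>m 5 \<and> C' * C = 1\<^sub>m 5 \<and>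
     (\<forall>v\<in>carrier_vec 5. split_form (C *\<^sub>v v) = (\<Sum>i<5. (v $ i)\<^sup>2))"

text \<open>
  The data of a birational parametrization of the split quadric by three-dimensional projective space.
  The point required in the last line makes the curves of \<open>split_quadric_curve\<close> available.
\<close>

definition split_parametrization ::
    "('k::field vec \<Rightarrow> 'k vec) \<Rightarrow> ('k vec \<Rightarrow> 'k vec) \<Rightarrow> ('k vec \<Rightarrow> 'k) \<Rightarrow> ('k vec \<Rightarrow> 'k) \<Rightarrow> bool" where
  "split_parametrization F H D E \<longleftrightarrow>
     (\<exists>d e a b. form_map 4 5 d F \<and> form_map 5 4 e H \<and> form 4 a D \<and> form 5 b E) \<and>
     D (0\<^sub>v 4) = 0 \<and> E (0\<^sub>v 5) = 0 \<and>
     (\<forall>v\<in>carrier_vec 4. D v \<noteq> 0 \<longrightarrow>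
        split_form (F v) = 0 \<and> E (F v) \<noteq> 0 \<and> (\<exists>c. c \<noteq> 0 \<and> H (F v) = c \<cdot>\<^sub>v v)) \<and>
     (\<forall>y\<in>carrier_vec 5. split_form y = 0 \<longrightarrow> E y \<noteq> 0 \<longrightarrow>
        D (H y) \<noteq> 0 \<and> (\<exists>c. c \<noteq> 0 \<and> F (H y) = c \<cdot>\<^sub>v y)) \<and>
     (\<exists>v\<in>carrier_vec 4. D v \<noteq> 0 \<and> (\<forall>i<4. F v $ i \<noteq> 0))"

text \<open>
  Equivariance is an identity of vectors up to a scalar that may depend on the group element: this is
  weaker than intertwining the linear maps and suffices for projective maps.
\<close>

lemma linearizable_split_quadric:
  fixes C C' :: "'k::field_char_0 mat" and \<rho> \<theta> :: "'g \<Rightarrow> 'k mat"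
  assumes coords: "split_coords C C'" and param: "split_parametrization F H D E"
    and \<rho>: "\<rho> \<in> hom M (GL 4)" and \<theta>: "\<And>g. g \<in> carrier M \<Longrightarrow> \<theta> g \<in> carrier_mat 5 5"
    and equiv: "\<And>g. g \<in> carrier M \<Longrightarrow> \<exists>c. c \<noteq> 0 \<and>
      (\<forall>v\<in>carrier_vec 4. F (\<rho> g *\<^sub>v v) = c \<cdot>\<^sub>v ((C * \<theta> g * C') *\<^sub>v F v))"
  shows "linearizable M (\<lambda>g. proj_action (\<theta> g)) 5 (quadric :: 'k vec set set)"
proof -
  have C: "C \<in> carrier_mat 5 5" "C' \<in> carrier_mat 5 5" "C * C' = 1\<^sub>m 5" "C' * C = 1\<^sub>m 5"
    and CQ: "\<And>v. v \<in> carrier_vec 5 \<Longrightarrow> split_form (C *\<^sub>v v) = (\<Sum>i<5. (v $ i)\<^sup>2)"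
    using coords unfolding split_coords_def by blast+
  obtain d e a b where F: "form_map 4 5 d F" and H: "form_map 5 4 e H" and D: "form 4 a D" and E: "form 5 b E"
    using param unfolding split_parametrization_def by blast
  have D0: "D (0\<^sub>v 4) = 0" and E0: "E (0\<^sub>v 5) = 0"
    and FD: "\<And>v. v \<in> carrier_vec 4 \<Longrightarrow> D v \<noteq> 0 \<Longrightarrow>
      split_form (F v) = 0 \<and> E (F v) \<noteq> 0 \<and> (\<exists>c. c \<noteq> 0 \<and> H (F v) = c \<cdot>\<^sub>v v)"
    and HE: "\<And>y. y \<in> carrier_vec 5 \<Longrightarrow> split_form y = 0 \<Longrightarrow> E y \<noteq> 0 \<Longrightarrow>
      D (H y) \<noteq> 0 \<and> (\<exists>c. c \<noteq> 0 \<and> F (H y) = c \<cdot>\<^sub>v y)"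
    using param unfolding split_parametrization_def by blast+
  obtain v0 where v0: "v0 \<in> carrier_vec 4" "D v0 \<noteq> 0" "\<forall>i<4. F v0 $ i \<noteq> 0"
    using param unfolding split_parametrization_def by blast
  let ?F = "\<lambda>v. C' *\<^sub>v F v" and ?H = "\<lambda>x. H (C *\<^sub>v x)" and ?E = "\<lambda>x. E (C *\<^sub>v x)"
  have dF: "F v \<in> carrier_vec 5" if "v \<in> carrier_vec 4" for v using F that by (auto simp: form_map_def)
  have CC': "C *\<^sub>v (C' *\<^sub>v v) = v" "C' *\<^sub>v (C *\<^sub>v v) = v" if "v \<in> carrier_vec 5" for v
    using C that by (simp_all flip: assoc_mult_mat_vec)
  have CdV: "C *\<^sub>v v \<in> carrier_vec 5" "C' *\<^sub>v v \<in> carrier_vec 5" if "v \<in> carrier_vec 5" for v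
    using C that by auto
  have C0: "C *\<^sub>v 0\<^sub>v 5 = 0\<^sub>v 5" "C' *\<^sub>v 0\<^sub>v 5 = 0\<^sub>v 5" using C by auto
  have quadric: "pt x \<in> quadric \<longleftrightarrow> x \<noteq> 0\<^sub>v 5 \<and> split_form (C *\<^sub>v x) = 0" if x: "x \<in> carrier_vec 5" for x
  proof
    assume "pt x \<in> quadric"
    then obtain w where w: "w \<in> carrier_vec 5" "w \<noteq> 0\<^sub>v 5" "(\<Sum>i<5. (w $ i)\<^sup>2) = 0" "pt w = pt x"
      unfolding quadric_def by auto
    then obtain c where c: "c \<noteq> 0" "x = c \<cdot>\<^sub>v w" unfolding pt_eq_iff by blast
    have "(\<Sum>i<5. (x $ i)\<^sup>2) = c\<^sup>2 * (\<Sum>i<5. (w $ i)\<^sup>2)"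
      using c w(1) by (simp add: sum_distrib_left power_mult_distrib)
    then show "x \<noteq> 0\<^sub>v 5 \<and> split_form (C *\<^sub>v x) = 0"
      using CQ[OF x] w(3) smult_nonzero[OF w(1,2) c(1)] c(2) by simp
  qed (use x CQ[OF x] in \<open>auto simp: quadric_def\<close>)
  have "form_map 4 5 d ?F" by (rule form_map_mat[OF F C(2)])
  moreover have "form_map 5 4 e ?H"
    using H form_mat[OF _ C(1)] CdV unfolding form_map_def by fast
  moreover have "form 5 b ?E" by (rule form_mat[OF E C(1)])
  moreover have "quadric \<subseteq> (proj 5 :: 'k vec set set)" by (auto simp: quadric_def proj_def)
  moreover have "pt (?F v) \<in> quadric \<and> ?E (?F v) \<noteq> 0 \<and> (\<exists>c. c \<noteq> 0 \<and> ?H (?F v) = c \<cdot>\<^sub>v v)"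
    if v: "v \<in> carrier_vec 4" "D v \<noteq> 0" for v
  proof -
    have "?F v \<noteq> 0\<^sub>v 5" using FD[OF v] E0 CC'(1)[OF dF[OF v(1)]] C0 by metis
    then show ?thesis using FD[OF v] quadric[OF CdV(2)[OF dF[OF v(1)]]] CC'(1)[OF dF[OF v(1)]] by simp
  qed
  moreover have "?H x \<noteq> 0\<^sub>v 4 \<and> D (?H x) \<noteq> 0 \<and> (\<exists>c. c \<noteq> 0 \<and> ?F (?H x) = c \<cdot>\<^sub>v x)"
    if x: "x \<in> carrier_vec 5" "pt x \<in> quadric" "?E x \<noteq> 0" for x
  proof -
    obtain c where c: "c \<noteq> 0" "F (?H x) = c \<cdot>\<^sub>v (C *\<^sub>v x)" and D1: "D (?H x) \<noteq> 0"
      using HE[OF CdV(1)[OF x(1)]] quadric[OF x(1)] x by blast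
    have "?F (?H x) = c \<cdot>\<^sub>v x" using c CC'(2)[OF x(1)] mult_mat_vec[OF C(2) CdV(1)[OF x(1)]] by simp
    then show ?thesis using c D1 D0 by metis
  qed
  moreover have "\<exists>\<gamma> a b c. (\<forall>s. \<gamma> s \<in> carrier_vec 5 \<and> (\<gamma> s \<noteq> 0\<^sub>v 5 \<longrightarrow> pt (\<gamma> s) \<in> quadric)) \<and>
      (\<forall>i<5. polyfun (\<lambda>s. \<gamma> s $ i)) \<and> c \<noteq> 0 \<and> \<gamma> a = c \<cdot>\<^sub>v x \<and> ?E (\<gamma> b) \<noteq> 0"
    if x: "x \<in> carrier_vec 5" "pt x \<in> quadric" for x
  proof -
    have "C *\<^sub>v x \<noteq> 0\<^sub>v 5" using quadric[OF x(1)] x(2) CC'(2)[OF x(1)] C0 by metis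
    then obtain \<gamma> c c' where \<gamma>: "\<And>s. \<gamma> s \<in> carrier_vec 5" "\<And>s. split_form (\<gamma> s) = 0"
      "\<And>i. i < 5 \<Longrightarrow> polyfun (\<lambda>s. \<gamma> s $ i)" "c \<noteq> 0" "\<gamma> 0 = c \<cdot>\<^sub>v (C *\<^sub>v x)" "c' \<noteq> 0" "\<gamma> 1 = c' \<cdot>\<^sub>v F v0"
      using split_quadric_curve[of "C *\<^sub>v x" "F v0"] CdV(1)[OF x(1)] dF[OF v0(1)] quadric[OF x(1)] x(2) FD[OF v0(1,2)] v0(3)
      by blast
    let ?\<gamma> = "\<lambda>s. C' *\<^sub>v \<gamma> s"
    have "polyfun (\<lambda>s. ?\<gamma> s $ i)" if "i < 5" for i
    proof -
      have "?\<gamma> s $ i = (\<Sum>j = 0..<5. C' $$ (i, j) * \<gamma> s $ j)" for s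
        using that C(2) \<gamma>(1)[of s] by (auto simp: scalar_prod_def)
      then show ?thesis using \<gamma>(3) by (auto intro!: polyfun_sum polyfun_intros)
    qed
    moreover have "pt (?\<gamma> s) \<in> quadric" if "?\<gamma> s \<noteq> 0\<^sub>v 5" for s
      using quadric[OF CdV(2)[OF \<gamma>(1)[of s]]] that CC'(1)[OF \<gamma>(1)[of s]] \<gamma>(2) by simp
    moreover have "?\<gamma> 0 = c \<cdot>\<^sub>v x" using \<gamma>(5) CC'(2)[OF x(1)] mult_mat_vec[OF C(2) CdV(1)[OF x(1)]] by simp
    moreover have "?E (?\<gamma> 1) \<noteq> 0"
      using CC'(1)[OF \<gamma>(1)[of 1]] \<gamma>(6,7) form_scale[OF E dF[OF v0(1)]] FD[OF v0(1,2)] by simp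
    ultimately show ?thesis using CdV(2)[OF \<gamma>(1)] \<gamma>(4)
      by (intro exI[of _ ?\<gamma>] exI[of _ 0] exI[of _ 1] exI[of _ c]) blast
  qed
  ultimately have bir: "birational_via 4 (proj 4) 5 quadric (nonvanishing 4 D) (quadric \<inter> nonvanishing 5 ?E) (proj_map 4 ?F)"
    using D v0 by (intro birational_via_form_maps) auto
  moreover have "proj_map 4 ?F (proj_action (\<rho> g) p) = proj_action (\<theta> g) (proj_map 4 ?F p)"
    if g: "g \<in> carrier M" and p: "p \<in> nonvanishing 4 D" for g p
  proof -
    obtain v where v: "v \<in> carrier_vec 4" "p = pt v" using p by (auto simp: nonvanishing_def)
    have \<rho>g: "\<rho> g \<in> carrier_mat 4 4" using \<rho> g GL_carrier by (auto simp: hom_def)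
    then have \<rho>v: "\<rho> g *\<^sub>v v \<in> carrier_vec 4" using v(1) by simp
    obtain c where c: "c \<noteq> 0" "F (\<rho> g *\<^sub>v v) = c \<cdot>\<^sub>v ((C * \<theta> g * C') *\<^sub>v F v)"
      using equiv[OF g] v(1) by blast
    have "(C * \<theta> g * C') *\<^sub>v F v = C *\<^sub>v (\<theta> g *\<^sub>v ?F v)"
      using C \<theta>[OF g] dF[OF v(1)] CdV by (simp add: assoc_mult_mat_vec[of _ 5 5 _ 5])
    then have "?F (\<rho> g *\<^sub>v v) = c \<cdot>\<^sub>v (\<theta> g *\<^sub>v ?F v)"
      using c C \<theta>[OF g] CdV(2)[OF dF[OF v(1)]] CC'(2)
      by (metis CdV(1) mult_mat_vec mult_mat_vec_carrier)
    then show ?thesis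
      using v(2) c(1) proj_map_pt[OF \<open>form_map 4 5 d ?F\<close> \<rho>v] proj_map_pt[OF \<open>form_map 4 5 d ?F\<close> v(1)]
        proj_action_pt[OF \<rho>g v(1)] proj_action_pt[OF \<theta>[OF g] CdV(2)[OF dF[OF v(1)]]]
      by (simp add: pt_smult)
  qed
  ultimately show ?thesis unfolding linearizable_def using \<rho> by blast
qed

section \<open>Signed permutations as words\<close>

datatype ix = I0 | I1 | I2 | I3 | I4
datatype letter = Pos ix | Neg ix
text \<open>
  A signed permutation of the five basis vectors, given by the images of the basis vectors in order;
  \<open>Neg i\<close> stands for the negative of the basis vector with index \<open>i\<close>.  Compared with matrices over
  the field, words allow finite computations.
\<close>

datatype word = Word letter letter letter letter letter

fun index :: "letter \<Rightarrow> ix" where "index (Pos i) = i" | "index (Neg i) = i"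
fun positive :: "letter \<Rightarrow> bool" where "positive (Pos i) = True" | "positive (Neg i) = False"
fun neg :: "letter \<Rightarrow> letter" where "neg (Pos i) = Neg i" | "neg (Neg i) = Pos i"

fun letter_at :: "word \<Rightarrow> ix \<Rightarrow> letter" where
  "letter_at (Word a b c d e) I0 = a"
| "letter_at (Word a b c d e) I1 = b"
| "letter_at (Word a b c d e) I2 = c"
| "letter_at (Word a b c d e) I3 = d"
| "letter_at (Word a b c d e) I4 = e"

fun act :: "word \<Rightarrow> letter \<Rightarrow> letter" where
  "act w (Pos i) = letter_at w i"
| "act w (Neg i) = neg (letter_at w i)"

fun wmult :: "word \<Rightarrow> word \<Rightarrow> word" where
  "wmult w (Word a b c d e) = Word (act w a) (act w b) (act w c) (act w d) (act w e)"

definition one_word :: word where "one_word = Word (Pos I0) (Pos I1) (Pos I2) (Pos I3) (Pos I4)"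

lemma letter_at_wmult: "letter_at (wmult g h) i = act g (letter_at h i)"
  by (cases h; cases i) auto

lemma act_neg: "act g (neg l) = neg (act g l)" and neg_neg [simp]: "neg (neg l) = l"
  by (cases l; cases "letter_at g (index l)"; simp)+

lemma act_wmult: "act (wmult g h) l = act g (act h l)"
  by (cases l) (simp_all add: letter_at_wmult act_neg)

lemma word_eqI: "(\<And>i. letter_at g i = letter_at h i) \<Longrightarrow> g = h"
  by (cases g; cases h) (metis letter_at.simps)

lemma wmult_assoc: "wmult (wmult f g) h = wmult f (wmult g h)"
  by (rule word_eqI) (simp add: letter_at_wmult act_wmult)

lemma wmult_1 [simp]: "wmult one_word g = g" "wmult g one_word = g"
proof -
  have "act one_word l = l" for l by (cases l; cases "index l") (auto simp: one_word_def)
  then show "wmult one_word g = g" by (cases g) simp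
  show "wmult g one_word = g" by (rule word_eqI) (rename_tac i, case_tac i; simp add: letter_at_wmult, simp_all add: one_word_def)
qed

fun nat_of_ix :: "ix \<Rightarrow> nat" where
  "nat_of_ix I0 = 0" | "nat_of_ix I1 = 1" | "nat_of_ix I2 = 2" | "nat_of_ix I3 = 3" | "nat_of_ix I4 = 4"

definition ix_of_nat :: "nat \<Rightarrow> ix" where
  "ix_of_nat n = (if n = 0 then I0 else if n = 1 then I1 else if n = 2 then I2 else if n = 3 then I3 else I4)"

lemma nat_of_ix_less [simp]: "nat_of_ix i < 5"
  by (cases i) auto

lemma ix_of_nat_of_ix [simp]: "ix_of_nat (nat_of_ix i) = i"
  by (cases i) (auto simp: ix_of_nat_def)

lemma nat_of_ix_eq_iff [simp]: "nat_of_ix i = nat_of_ix j \<longleftrightarrow> i = j"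
  by (metis ix_of_nat_of_ix)

lemma nat_of_ix_of_nat [simp]: "n < 5 \<Longrightarrow> nat_of_ix (ix_of_nat n) = n"
  by (auto simp: ix_of_nat_def)

fun entry :: "letter \<Rightarrow> nat \<Rightarrow> 'k::comm_ring_1" where
  "entry (Pos k) i = (if i = nat_of_ix k then 1 else 0)"
| "entry (Neg k) i = (if i = nat_of_ix k then - 1 else 0)"

definition word_mat :: "word \<Rightarrow> 'k::comm_ring_1 mat" where
  "word_mat w = mat 5 5 (\<lambda>(i, j). entry (letter_at w (ix_of_nat j)) i)"

lemma word_mat_carrier [simp]: "word_mat w \<in> carrier_mat 5 5"
  by (simp add: word_mat_def)

lemma entry_neg: "entry (neg l) i = - entry l i"
  by (cases l) auto

lemma entry_act: "entry (act g l) i = (\<Sum>k = 0..<5. entry (letter_at g (ix_of_nat k)) i * (entry l k :: 'k::comm_ring_1))"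
proof -
  have "(\<Sum>k = 0..<5. f k * (if k = nat_of_ix m then c else 0)) = f (nat_of_ix m) * (c :: 'k)" for f m c
    using sum.delta[of "{0..<5}" "nat_of_ix m" "\<lambda>k. f k * c"] by (simp add: if_distrib cong: if_cong)
  then show ?thesis by (cases l) (simp_all add: entry_neg)
qed

lemma word_mat_wmult: "word_mat (wmult g h) = word_mat g * word_mat h"
  by (rule eq_matI) (auto simp: word_mat_def letter_at_wmult entry_act scalar_prod_def)

lemma word_mat_1: "word_mat one_word = 1\<^sub>m 5"
proof (rule eq_matI)
  fix i j assume "i < dim_row (1\<^sub>m 5 :: 'a mat)" "j < dim_col (1\<^sub>m 5 :: 'a mat)"
  moreover have "letter_at one_word k = Pos k" for k by (cases k) (auto simp: one_word_def)
  ultimately show "word_mat one_word $$ (i, j) = (1\<^sub>m 5 :: 'a mat) $$ (i, j)" by (auto simp: word_mat_def)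
qed (auto simp: word_mat_def)

lemma word_mat_inj:
  assumes "word_mat g = (word_mat h :: 'k::field_char_0 mat)" shows "g = h"
proof (rule word_eqI)
  fix i
  have "entry (letter_at g i) k = (entry (letter_at h i) k :: 'k)" if "k < 5" for k
  proof -
    have "word_mat g $$ (k, nat_of_ix i) = (word_mat h $$ (k, nat_of_ix i) :: 'k)" using assms by simp
    then show ?thesis using that by (simp add: word_mat_def)
  qed
  moreover have "\<exists>k<5. entry l k \<noteq> (entry m k :: 'k)" if "l \<noteq> m" for l m
    using that by (intro exI[of _ "nat_of_ix (index l)"]) (cases l; cases m; auto)
  ultimately show "letter_at g i = letter_at h i" by metis
qed

section \<open>Split coordinates\<close>

abbreviation vec4 :: "'k \<Rightarrow> 'k \<Rightarrow> 'k \<Rightarrow> 'k \<Rightarrow> 'k vec" where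
  "vec4 a b c d \<equiv> vec 4 (\<lambda>i. [a, b, c, d] ! i)"

abbreviation vec5 :: "'k \<Rightarrow> 'k \<Rightarrow> 'k \<Rightarrow> 'k \<Rightarrow> 'k \<Rightarrow> 'k vec" where
  "vec5 a b c d e \<equiv> vec 5 (\<lambda>i. [a, b, c, d, e] ! i)"

lemma vec4_eqI:
  assumes "v \<in> carrier_vec 4" "w \<in> carrier_vec 4"
    "v $ 0 = w $ 0" "v $ 1 = w $ 1" "v $ 2 = w $ 2" "v $ 3 = w $ 3"
  shows "v = w"
  using assms all_less_4[of "\<lambda>i. v $ i = w $ i"] by (intro eq_vecI) auto

lemma vec5_eqI:
  assumes "v \<in> carrier_vec 5" "w \<in> carrier_vec 5"
    "v $ 0 = w $ 0" "v $ 1 = w $ 1" "v $ 2 = w $ 2" "v $ 3 = w $ 3" "v $ 4 = w $ 4"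
  shows "v = w"
  using assms all_less_5[of "\<lambda>i. v $ i = w $ i"] by (intro eq_vecI) auto

lemma sum_5: "(\<Sum>i = 0..<5. f i) = f 0 + f 1 + f 2 + f 3 + f (4::nat)"
  by (simp add: eval_nat_numeral)

lemma sum_4: "(\<Sum>i = 0..<4. f i) = f 0 + f 1 + f 2 + f (3::nat)"
  by (simp add: eval_nat_numeral)

lemma mult_vec5:
  assumes "A \<in> carrier_mat n 5" "v \<in> carrier_vec 5" "i < n"
  shows "(A *\<^sub>v v) $ i = A $$ (i, 0) * v $ 0 + A $$ (i, 1) * v $ 1 + A $$ (i, 2) * v $ 2 + A $$ (i, 3) * v $ 3 + A $$ (i, 4) * v $ 4"
  using assms by (simp add: scalar_prod_def sum_5)

lemma mult_vec4:
  assumes "A \<in> carrier_mat n 4" "v \<in> carrier_vec 4" "i < n"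
  shows "(A *\<^sub>v v) $ i = A $$ (i, 0) * v $ 0 + A $$ (i, 1) * v $ 1 + A $$ (i, 2) * v $ 2 + A $$ (i, 3) * v $ 3"
  using assms by (simp add: scalar_prod_def sum_4)

definition mat5 :: "'k list list \<Rightarrow> 'k mat" where
  "mat5 rs = mat 5 5 (\<lambda>(i, j). rs ! i ! j)"

definition mat4 :: "'k list list \<Rightarrow> 'k mat" where
  "mat4 rs = mat 4 4 (\<lambda>(i, j). rs ! i ! j)"

lemma mat5_carrier [simp]: "mat5 rs \<in> carrier_mat 5 5" by (simp add: mat5_def)
lemma mat4_carrier [simp]: "mat4 rs \<in> carrier_mat 4 4" by (simp add: mat4_def)

text \<open>
  Applied to matrices of numerals and parameters, it is easier to compose the two linear maps on a
  vector than to multiply the matrices.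
\<close>

lemma mat_inverse_from_action:
  fixes A B :: "'k::field mat"
  assumes "A \<in> carrier_mat n n" "B \<in> carrier_mat n n" "\<And>v. v \<in> carrier_vec n \<Longrightarrow> A *\<^sub>v (B *\<^sub>v v) = v"
  shows "A * B = 1\<^sub>m n" "B * A = 1\<^sub>m n"
proof -
  show AB: "A * B = 1\<^sub>m n"
  proof (rule eq_matI)
    fix i j assume ij: "i < dim_row (1\<^sub>m n :: 'k mat)" "j < dim_col (1\<^sub>m n :: 'k mat)"
    have "D $$ (i, j) = (D *\<^sub>v unit_vec n j) $ i" if "D \<in> carrier_mat n n" for D :: "'k mat"
      using that ij by (simp add: scalar_prod_right_unit)
    then have "(A * B) $$ (i, j) = ((A * B) *\<^sub>v unit_vec n j) $ i"
      using assms(1,2) by (metis mult_carrier_mat)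
    also have "(A * B) *\<^sub>v unit_vec n j = unit_vec n j"
      using assms by (subst assoc_mult_mat_vec[of _ n n _ n]) auto
    finally show "(A * B) $$ (i, j) = 1\<^sub>m n $$ (i, j)" using ij by (auto simp: unit_vec_def)
  qed (use assms in auto)
  show "B * A = 1\<^sub>m n" by (rule mat_mult_left_right_inverse[OF assms(1,2) AB])
qed

text \<open>
  The coordinates are $x_1 \pm \iota x_3$, $x_2 \pm \iota x_4$ and $x_5$.
\<close>

definition quarter_coords :: "'k::field \<Rightarrow> 'k mat" where
  "quarter_coords \<iota> = mat5 [[1, 0, \<iota>, 0, 0], [1, 0, - \<iota>, 0, 0], [0, 1, 0, \<iota>, 0], [0, 1, 0, - \<iota>, 0], [0, 0, 0, 0, 1]]"

definition quarter_coords_inv :: "'k::field \<Rightarrow> 'k mat" where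
  "quarter_coords_inv \<iota> = mat5 [[1/2, 1/2, 0, 0, 0], [0, 0, 1/2, 1/2, 0], [- \<iota>/2, \<iota>/2, 0, 0, 0], [0, 0, - \<iota>/2, \<iota>/2, 0], [0, 0, 0, 0, 1]]"

lemma mat5_mult_vec:
  assumes "v \<in> carrier_vec 5"
  shows "mat5 rs *\<^sub>v v = vec 5 (\<lambda>i. rs!i!0 * v$0 + rs!i!1 * v$1 + rs!i!2 * v$2 + rs!i!3 * v$3 + rs!i!4 * v$4)"
  by (rule eq_vecI) (use assms in \<open>auto simp: mult_vec5[of _ 5] mat5_def simp del: index_mult_mat_vec\<close>)

lemma mat4_mult_vec:
  assumes "v \<in> carrier_vec 4"
  shows "mat4 rs *\<^sub>v v = vec 4 (\<lambda>i. rs!i!0 * v$0 + rs!i!1 * v$1 + rs!i!2 * v$2 + rs!i!3 * v$3)"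
  by (rule eq_vecI) (use assms in \<open>auto simp: mult_vec4[of _ 4] mat4_def simp del: index_mult_mat_vec\<close>)

lemma sum_lessThan_5: "(\<Sum>i<5. f i) = f 0 + f 1 + f 2 + f 3 + f (4::nat)"
  by (simp add: eval_nat_numeral)

lemma split_coordsI:
  fixes C C' :: "'k::field mat"
  assumes "C \<in> carrier_mat 5 5" "C' \<in> carrier_mat 5 5" "\<And>v. v \<in> carrier_vec 5 \<Longrightarrow> C *\<^sub>v (C' *\<^sub>v v) = v"
    "\<And>v. v \<in> carrier_vec 5 \<Longrightarrow> split_form (C *\<^sub>v v) = (\<Sum>i<5. (v $ i)\<^sup>2)"
  shows "split_coords C C'"
  unfolding split_coords_def using mat_inverse_from_action[OF assms(1-3)] assms by blast

lemma split_quarter_coords: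
  fixes \<iota> :: "'k::field_char_0"
  assumes "\<iota> ^ 2 = -1"
  shows "split_coords (quarter_coords \<iota>) (quarter_coords_inv \<iota>)"
proof (rule split_coordsI)
  have ii: "\<iota> * (\<iota> * x) = - x" for x using assms by (simp add: power2_eq_square flip: mult.assoc)
  show "quarter_coords \<iota> *\<^sub>v (quarter_coords_inv \<iota> *\<^sub>v v) = v" if "v \<in> carrier_vec 5" for v
    by (rule vec5_eqI) (use that in \<open>simp_all add: quarter_coords_def quarter_coords_inv_def mat5_mult_vec field_simps ii\<close>)
  show "split_form (quarter_coords \<iota> *\<^sub>v v) = (\<Sum>i<5. (v $ i)\<^sup>2)" if "v \<in> carrier_vec 5" for v
    using that assms
    by (simp add: quarter_coords_def mat5_mult_vec split_form_def sum_lessThan_5 algebra_simps power2_eq_square ii)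
qed (simp_all add: quarter_coords_def quarter_coords_inv_def)

text \<open>
  Up to the factor \<open>h\<close>, the first four rows are $(1, c, c^2, c^3)$ for $c = z, z^{-1}, z^3, z^{-3}$,
  written with exponents below four by means of $z^4 = -1$.  The factor satisfies $2 h^2 = 1$; it makes
  $y_0 y_1 + y_2 y_3$ equal to the sum of four squares.
\<close>

definition eighth_coords :: "'k::field \<Rightarrow> 'k mat" where
  "eighth_coords z = (let h = (z - z ^ 3) / 2 in mat5
     [[h, h * z, h * z^2, h * z^3, 0],
      [h, - (h * z^3), - (h * z^2), - (h * z), 0],
      [h, h * z^3, - (h * z^2), h * z, 0],
      [h, - (h * z), h * z^2, - (h * z^3), 0],
      [0, 0, 0, 0, 1]])"

definition eighth_coords_inv :: "'k::field \<Rightarrow> 'k mat" where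
  "eighth_coords_inv z = (let g = (z - z ^ 3) / 4 in mat5
     [[g, g, g, g, 0],
      [- (g * z^3), g * z, - (g * z), g * z^3, 0],
      [- (g * z^2), g * z^2, g * z^2, - (g * z^2), 0],
      [- (g * z), g * z^3, - (g * z^3), g * z, 0],
      [0, 0, 0, 0, 1]])"

lemma split_eighth_coords:
  fixes z :: "'k::field_char_0"
  assumes z: "z ^ 4 = -1"
  shows "split_coords (eighth_coords z) (eighth_coords_inv z)"
proof (rule split_coordsI)
  define h g where "h = (z - z ^ 3) / 2" and "g = (z - z ^ 3) / 4"
  have gh: "4 * g * h = 1" and hh: "2 * h ^ 2 = 1"
  proof -
    have "4 * g * h = (z - z^3)^2 / 2" by (simp add: g_def h_def power2_eq_square)
    also have "(z - z^3)^2 = z^2 - 2 * z^4 + z^2 * z^4" by Groebner_Basis.algebra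
    also have "\<dots> = 2" using z by simp
    finally show "4 * g * h = 1" by simp
    moreover have "4 * g * h = 2 * h ^ 2" by (simp add: g_def h_def power2_eq_square)
    ultimately show "2 * h ^ 2 = 1" by simp
  qed
  show "eighth_coords z *\<^sub>v (eighth_coords_inv z *\<^sub>v v) = v" if "v \<in> carrier_vec 5" for v
    unfolding eighth_coords_def eighth_coords_inv_def h_def[symmetric] g_def[symmetric] Let_def
  proof (rule vec5_eqI, goal_cases)
    case 3 then show ?case using that by (simp add: mat5_mult_vec) (use gh z in Groebner_Basis.algebra)
  next
    case 4 then show ?case using that by (simp add: mat5_mult_vec) (use gh z in Groebner_Basis.algebra)
  next
    case 5 then show ?case using that by (simp add: mat5_mult_vec) (use gh z in Groebner_Basis.algebra)
  next
    case 6 then show ?case using that by (simp add: mat5_mult_vec) (use gh z in Groebner_Basis.algebra)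
  qed (use that in \<open>simp_all add: mat5_mult_vec\<close>)
  show "split_form (eighth_coords z *\<^sub>v v) = (\<Sum>i<5. (v $ i)\<^sup>2)" if "v \<in> carrier_vec 5" for v
    unfolding eighth_coords_def h_def[symmetric] Let_def split_form_def sum_lessThan_5
    using that by (simp add: mat5_mult_vec) (use hh z in Groebner_Basis.algebra)
qed (simp_all add: eighth_coords_def eighth_coords_inv_def Let_def)

section \<open>Two parametrizations of the quadric\<close>

text \<open>
  Together with \<open>form_intros\<close>: the degree of a term is first inferred and then compared.
\<close>

lemma form_deg: "form n d' f \<Longrightarrow> d' = d \<Longrightarrow> form n d f" by simp

lemma form_add': "form n d f \<Longrightarrow> form n d' g \<Longrightarrow> d' = d \<Longrightarrow> form n d (\<lambda>v. f v + g v)"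
  using form_add by blast

lemma form_uminus: "form n d f \<Longrightarrow> form n d (\<lambda>v. - f v :: 'k::comm_ring_1)"
  using form_cmult[of n d f "-1"] by simp

lemma form_diff: "form n d f \<Longrightarrow> form n d' g \<Longrightarrow> d' = d \<Longrightarrow> form n d (\<lambda>v. f v - g v :: 'k::comm_ring_1)"
  using form_add[of n d f "\<lambda>v. - g v"] form_uminus[of n d' g] by simp

lemmas form_intros = form_const form_coord form_add' form_diff form_uminus form_mult form_power

lemma form_map_vec5:
  assumes "form n d f0" "form n d f1" "form n d f2" "form n d f3" "form n d f4"
  shows "form_map n 5 d (\<lambda>v. vec5 (f0 v) (f1 v) (f2 v) (f3 v) (f4 v))"
  unfolding form_map_def all_less_5 using assms by simp

lemma form_map_vec4:
  assumes "form n d f0" "form n d f1" "form n d f2" "form n d f3"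
  shows "form_map n 4 d (\<lambda>v. vec4 (f0 v) (f1 v) (f2 v) (f3 v))"
  unfolding form_map_def all_less_4 using assms by simp

text \<open>
  With $P, Q, S, T$ for the four coordinates, this is $y_0 = P/T$, $y_2 = Q/T$, $y_4 = 1$ and
  $y_0 y_1 - y_2 y_3 = S/T$, multiplied by the common denominator $2 T P Q$.
\<close>

definition plane_map :: "'k::field vec \<Rightarrow> 'k vec" where
  "plane_map v = vec5 (2 * (v$0)^2 * v$1) (v$3 * (v$2 - v$3) * v$1) (2 * v$0 * (v$1)^2)
     (- (v$3 * (v$2 + v$3) * v$0)) (2 * v$3 * v$0 * v$1)"

definition plane_inverse :: "'k::field vec \<Rightarrow> 'k vec" where
  "plane_inverse y = vec4 (y$0 * y$4) (y$2 * y$4) (y$1 * y$0 - y$3 * y$2) ((y$4)^2)"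

lemma plane_parametrization:
  "split_parametrization (plane_map :: 'k::field_char_0 vec \<Rightarrow> 'k vec) plane_inverse
     (\<lambda>v. v$0 * v$1 * v$3) (\<lambda>y. y$0 * y$2 * y$4)"
  unfolding split_parametrization_def
proof (intro conjI)
  have "form_map 4 5 3 (plane_map :: 'k vec \<Rightarrow> 'k vec)"
    unfolding plane_map_def by (rule form_map_vec5; (rule form_deg, (rule form_intros | simp)+))
  moreover have "form_map 5 4 2 (plane_inverse :: 'k vec \<Rightarrow> 'k vec)"
    unfolding plane_inverse_def by (rule form_map_vec4; (rule form_deg, (rule form_intros | simp)+))
  moreover have "form 4 3 (\<lambda>v :: 'k vec. v$0 * v$1 * v$3)"
    by (rule form_deg, (rule form_intros | simp)+)
  moreover have "form 5 3 (\<lambda>y :: 'k vec. y$0 * y$2 * y$4)"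
    by (rule form_deg, (rule form_intros | simp)+)
  ultimately show "\<exists>d e a b. form_map 4 5 d (plane_map :: 'k vec \<Rightarrow> 'k vec) \<and> form_map 5 4 e (plane_inverse :: 'k vec \<Rightarrow> 'k vec) \<and>
      form 4 a (\<lambda>v :: 'k vec. v$0 * v$1 * v$3) \<and> form 5 b (\<lambda>y :: 'k vec. y$0 * y$2 * y$4)" by blast
  show "\<forall>v\<in>carrier_vec 4. v$0 * v$1 * v$3 \<noteq> 0 \<longrightarrow> split_form (plane_map v) = 0 \<and>
      plane_map v $ 0 * plane_map v $ 2 * plane_map v $ 4 \<noteq> 0 \<and> (\<exists>c. c \<noteq> 0 \<and> plane_inverse (plane_map v) = c \<cdot>\<^sub>v (v :: 'k vec))"
  proof (intro ballI impI conjI)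
    fix v :: "'k vec" assume v: "v \<in> carrier_vec 4" "v$0 * v$1 * v$3 \<noteq> 0"
    show "split_form (plane_map v) = 0"
      by (simp add: split_form_def plane_map_def algebra_simps power2_eq_square)
    show "plane_map v $ 0 * plane_map v $ 2 * plane_map v $ 4 \<noteq> 0" using v by (simp add: plane_map_def)
    have "plane_inverse (plane_map v) = (4 * (v$0)^2 * (v$1)^2 * v$3) \<cdot>\<^sub>v v"
      by (rule vec4_eqI) (use v in \<open>simp_all add: plane_map_def plane_inverse_def algebra_simps power2_eq_square\<close>)
    moreover have "4 * (v$0)^2 * (v$1)^2 * v$3 \<noteq> 0" using v(2) by simp
    ultimately show "\<exists>c. c \<noteq> 0 \<and> plane_inverse (plane_map v) = c \<cdot>\<^sub>v v" by blast
  qed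
  show "\<forall>y\<in>carrier_vec 5. split_form y = 0 \<longrightarrow> y$0 * y$2 * y$4 \<noteq> 0 \<longrightarrow>
      plane_inverse y $ 0 * plane_inverse y $ 1 * plane_inverse y $ 3 \<noteq> 0 \<and> (\<exists>c. c \<noteq> 0 \<and> plane_map (plane_inverse y) = c \<cdot>\<^sub>v (y :: 'k vec))"
  proof (intro ballI impI conjI)
    fix y :: "'k vec" assume y: "y \<in> carrier_vec 5" "split_form y = 0" "y$0 * y$2 * y$4 \<noteq> 0"
    show "plane_inverse y $ 0 * plane_inverse y $ 1 * plane_inverse y $ 3 \<noteq> 0" using y by (simp add: plane_inverse_def)
    have x: "(y$4)^2 = - (y$0 * y$Suc 0 + y$2 * y$3)" using y(2) by (simp add: split_form_def add_eq_0_iff2 algebra_simps)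
    have "plane_map (plane_inverse y) = (2 * y$0 * y$2 * (y$4)^3) \<cdot>\<^sub>v y"
    proof (rule vec5_eqI, goal_cases)
      case 4 then show ?case using y(1,3) by (simp add: plane_map_def plane_inverse_def) (use x in Groebner_Basis.algebra)
    next
      case 6 then show ?case using y(1,3) by (simp add: plane_map_def plane_inverse_def) (use x in Groebner_Basis.algebra)
    qed (use y(1) in \<open>simp_all add: plane_map_def plane_inverse_def algebra_simps power2_eq_square power3_eq_cube\<close>)
    moreover have "2 * y$0 * y$2 * (y$4)^3 \<noteq> 0" using y(3) by simp
    ultimately show "\<exists>c. c \<noteq> 0 \<and> plane_map (plane_inverse y) = c \<cdot>\<^sub>v y" by blast
  qed
  show "\<exists>v\<in>carrier_vec 4. v$0 * v$1 * v$3 \<noteq> (0::'k) \<and> (\<forall>i<4. plane_map v $ i \<noteq> 0)"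
    (* The image has the first four coordinates 2, 2, 2, - 4. *)
    by (rule bexI[of _ "vec4 1 1 3 1"]) (simp_all add: plane_map_def all_less_4)
qed simp_all

text \<open>
  This solves $r = b/a$, $A = a/n$, $B = b/m$ for a point of the quadric.  On the quadric surface the
  line through the point $S = 0$ with direction given by $A$ and $B$ has one further intersection,
  $S' = -\iota (r^2 B + A/r)/(AB + 1)$; the remaining quantities follow and the denominators are
  cleared.
\<close>

definition flag_map :: "'k::field \<Rightarrow> 'k vec \<Rightarrow> 'k vec" where
  "flag_map \<iota> v = (let a = v$0; b = v$1; m = v$2; n = v$3 in
     vec5 (m^2 * (a^5 - n^2 * b^3)) (n^2 * (b^5 - m^2 * a^3))
       (\<iota> * m * n * a * b^2 * (a * b + m * n)) (\<iota> * m * n * a^2 * b * (a * b + m * n))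
       (m * n * (b^4 * n + a^4 * m)))"

text \<open>
  The projection is $r = y_2/y_3$, $A = L/(y_3 y_4)$, $B = M/(y_2 y_4)$.  Take $a = y_3$, $b = y_2$,
  $n = a/A$, $m = b/B$ and multiply by $L M$.
\<close>

definition flag_inverse :: "'k::field \<Rightarrow> 'k vec \<Rightarrow> 'k vec" where
  "flag_inverse \<iota> y = (let L = y$0 * y$3 - \<iota> * (y$2)^2; M = y$1 * y$2 - \<iota> * (y$3)^2 in
     vec4 (y$3 * L * M) (y$2 * L * M) ((y$2)^2 * y$4 * L) ((y$3)^2 * y$4 * M))"

text \<open>
  The product of all denominators that occur in the parametrization.
\<close>

definition flag_domain :: "'k::field vec \<Rightarrow> 'k" where
  "flag_domain v = v$0 * v$1 * v$2 * v$3 * (v$0 * v$1 + v$2 * v$3) * ((v$1)^4 * v$3 + (v$0)^4 * v$2)"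

definition flag_codomain :: "'k::field \<Rightarrow> 'k vec \<Rightarrow> 'k" where
  "flag_codomain \<iota> y = (let L = y$0 * y$3 - \<iota> * (y$2)^2; M = y$1 * y$2 - \<iota> * (y$3)^2 in
     y$2 * y$3 * y$4 * L * M * ((y$3)^2 * L + (y$2)^2 * M))"

text \<open>
  The identities have degree up to 35.  They become tractable by naming the factors: on the quadric
  one has $LM + y_2 y_3 y_4^2 = -\iota K$ with $K = y_3^2 L + y_2^2 M$, and all coordinates of the
  composite are one monomial in $L, M, K, y_2, y_3, y_4$ times the coordinates of the given point.
\<close>

lemma flag_parametrization:
  fixes \<iota> :: "'k::field_char_0"
  assumes \<iota>: "\<iota> ^ 2 = - 1"
  shows "split_parametrization (flag_map \<iota>) (flag_inverse \<iota>) flag_domain (flag_codomain \<iota>)"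
  unfolding split_parametrization_def
proof (intro conjI)
  have \<iota>0: "\<iota> \<noteq> 0" using \<iota> by auto
  have "form_map 4 5 7 (flag_map \<iota>)"
    unfolding flag_map_def Let_def by (rule form_map_vec5; (rule form_deg, (rule form_intros | simp)+))
  moreover have "form_map 5 4 5 (flag_inverse \<iota>)"
    unfolding flag_inverse_def Let_def by (rule form_map_vec4; (rule form_deg, (rule form_intros | simp)+))
  moreover have "form 4 11 (flag_domain :: 'k vec \<Rightarrow> 'k)"
    unfolding flag_domain_def by (rule form_deg, (rule form_intros | simp)+)
  moreover have "form 5 11 (flag_codomain \<iota>)"
    unfolding flag_codomain_def Let_def by (rule form_deg, (rule form_intros | simp)+)
  ultimately show "\<exists>d e a b. form_map 4 5 d (flag_map \<iota>) \<and> form_map 5 4 e (flag_inverse \<iota>) \<and>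
      form 4 a (flag_domain :: 'k vec \<Rightarrow> 'k) \<and> form 5 b (flag_codomain \<iota>)" by blast
  show "\<forall>v\<in>carrier_vec 4. flag_domain v \<noteq> 0 \<longrightarrow> split_form (flag_map \<iota> v) = 0 \<and>
      flag_codomain \<iota> (flag_map \<iota> v) \<noteq> 0 \<and> (\<exists>c. c \<noteq> 0 \<and> flag_inverse \<iota> (flag_map \<iota> v) = c \<cdot>\<^sub>v v)"
  proof (intro ballI impI)
    fix v :: "'k vec" assume v: "v \<in> carrier_vec 4" "flag_domain v \<noteq> 0"
    define a b m n where "a = v$0" and "b = v$1" and "m = v$2" and "n = v$3"
    define d k where "d = a * b + m * n" and "k = b^4 * n + a^4 * m"
    have nz: "a \<noteq> 0" "b \<noteq> 0" "m \<noteq> 0" "n \<noteq> 0" "d \<noteq> 0" "k \<noteq> 0"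
      using v(2) by (auto simp: flag_domain_def a_def b_def m_def n_def d_def k_def)
    define y where "y = flag_map \<iota> v"
    have y: "y$0 = m^2 * (a^5 - n^2 * b^3)" "y$1 = n^2 * (b^5 - m^2 * a^3)"
      "y$2 = \<iota> * m * n * a * b^2 * d" "y$3 = \<iota> * m * n * a^2 * b * d" "y$4 = m * n * k"
      by (simp_all add: y_def flag_map_def Let_def a_def b_def m_def n_def d_def k_def)
    have L: "y$0 * y$3 - \<iota> * (y$2)^2 = \<iota> * m^2 * n * a^3 * b * d * k"
      unfolding y d_def k_def using \<iota> by Groebner_Basis.algebra
    have M: "y$1 * y$2 - \<iota> * (y$3)^2 = \<iota> * m * n^2 * a * b^3 * d * k"
      unfolding y d_def k_def using \<iota> by Groebner_Basis.algebra
    have N: "(y$3)^2 * (\<iota> * m^2 * n * a^3 * b * d * k) + (y$2)^2 * (\<iota> * m * n^2 * a * b^3 * d * k)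
        = - (\<iota> * m^3 * n^3 * a^3 * b^3 * d^3 * k^2)"
      unfolding y k_def using \<iota> by Groebner_Basis.algebra
    have "split_form y = 0"
      unfolding split_form_def y d_def k_def using \<iota> by Groebner_Basis.algebra
    moreover have "flag_codomain \<iota> y \<noteq> 0"
      unfolding flag_codomain_def Let_def unfolding L M unfolding N unfolding y using nz \<iota>0 by simp
    moreover have "flag_inverse \<iota> y = (- (\<iota> * m^4 * n^4 * a^5 * b^5 * d^3 * k^2)) \<cdot>\<^sub>v v"
    proof (rule vec4_eqI, goal_cases)
      case 3
      have "flag_inverse \<iota> y $ 0 = - (\<iota> * m^4 * n^4 * a^5 * b^5 * d^3 * k^2) * a"
        unfolding flag_inverse_def Let_def L M using \<iota> by (simp add: y) Groebner_Basis.algebra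
      then show ?case using v(1) by (simp add: a_def)
    next
      case 4
      have "flag_inverse \<iota> y $ 1 = - (\<iota> * m^4 * n^4 * a^5 * b^5 * d^3 * k^2) * b"
        unfolding flag_inverse_def Let_def L M using \<iota> by (simp add: y) Groebner_Basis.algebra
      then show ?case using v(1) by (simp add: b_def)
    next
      case 5
      have "flag_inverse \<iota> y $ 2 = - (\<iota> * m^4 * n^4 * a^5 * b^5 * d^3 * k^2) * m"
        unfolding flag_inverse_def Let_def L M using \<iota> by (simp add: y) Groebner_Basis.algebra
      then show ?case using v(1) by (simp add: m_def)
    next
      case 6
      have "flag_inverse \<iota> y $ 3 = - (\<iota> * m^4 * n^4 * a^5 * b^5 * d^3 * k^2) * n"
        unfolding flag_inverse_def Let_def L M using \<iota> by (simp add: y) Groebner_Basis.algebra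
      then show ?case using v(1) by (simp add: n_def)
    qed (use v(1) in \<open>simp_all add: flag_inverse_def Let_def\<close>)
    moreover have "- (\<iota> * m^4 * n^4 * a^5 * b^5 * d^3 * k^2) \<noteq> 0" using nz \<iota>0 by simp
    ultimately show "split_form (flag_map \<iota> v) = 0 \<and>
      flag_codomain \<iota> (flag_map \<iota> v) \<noteq> 0 \<and> (\<exists>c. c \<noteq> 0 \<and> flag_inverse \<iota> (flag_map \<iota> v) = c \<cdot>\<^sub>v v)"
      unfolding y_def by blast
  qed
  show "\<forall>y\<in>carrier_vec 5. split_form y = 0 \<longrightarrow> flag_codomain \<iota> y \<noteq> 0 \<longrightarrow>
      flag_domain (flag_inverse \<iota> y) \<noteq> 0 \<and> (\<exists>c. c \<noteq> 0 \<and> flag_map \<iota> (flag_inverse \<iota> y) = c \<cdot>\<^sub>v y)"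
  proof (intro ballI impI)
    fix y :: "'k vec" assume y: "y \<in> carrier_vec 5" "split_form y = 0" "flag_codomain \<iota> y \<noteq> 0"
    define p q r s x where "p = y$0" and "q = y$1" and "r = y$2" and "s = y$3" and "x = y$4"
    define L M where "L = p * s - \<iota> * r^2" and "M = q * r - \<iota> * s^2"
    define K where "K = s^2 * L + r^2 * M"
    have nz: "r \<noteq> 0" "s \<noteq> 0" "x \<noteq> 0" "L \<noteq> 0" "M \<noteq> 0" "K \<noteq> 0"
      using y(3) by (auto simp: flag_codomain_def Let_def p_def q_def r_def s_def x_def L_def M_def K_def)
    have quad: "x^2 = - (p * q + r * s)"
      using y(2) by (simp add: split_form_def p_def q_def r_def s_def x_def add_eq_0_iff2 algebra_simps)
    define v where "v = flag_inverse \<iota> y"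
    define a b m n where "a = v$0" and "b = v$1" and "m = v$2" and "n = v$3"
    have v: "a = s * L * M" "b = r * L * M" "m = r^2 * x * L" "n = s^2 * x * M"
      by (simp_all add: a_def b_def m_def n_def v_def flag_inverse_def Let_def L_def M_def p_def q_def r_def s_def x_def)
    have "L * M + r * s * x^2 = - \<iota> * K"
      unfolding quad K_def L_def M_def using \<iota> by Groebner_Basis.algebra
    then have d: "a * b + m * n = - \<iota> * r * s * L * M * K"
      unfolding v by Groebner_Basis.algebra
    have k: "b^4 * n + a^4 * m = L^4 * M^4 * r^2 * s^2 * x * K"
      unfolding v K_def by Groebner_Basis.algebra
    have D: "flag_domain v \<noteq> 0"
      unfolding flag_domain_def a_def[symmetric] b_def[symmetric] m_def[symmetric] n_def[symmetric] d k
      unfolding v using nz \<iota>0 by simp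
    let ?c = "x^2 * r^4 * s^4 * L^5 * M^5 * K"
    have p_eq: "s * L^2 - x^2 * r^3 = K * p"
      unfolding quad K_def L_def M_def using \<iota> by Groebner_Basis.algebra
    have q_eq: "r * M^2 - x^2 * s^3 = K * q"
      unfolding quad K_def L_def M_def using \<iota> by Groebner_Basis.algebra
    have F: "flag_map \<iota> v = vec5 (m^2 * (a^5 - n^2 * b^3)) (n^2 * (b^5 - m^2 * a^3))
       (\<iota> * m * n * a * b^2 * (a * b + m * n)) (\<iota> * m * n * a^2 * b * (a * b + m * n))
       (m * n * (b^4 * n + a^4 * m))"
      by (simp add: flag_map_def Let_def a_def b_def m_def n_def)
    have c0: "m^2 * (a^5 - n^2 * b^3) = ?c * p"
      unfolding v using p_eq by Groebner_Basis.algebra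
    have c1: "n^2 * (b^5 - m^2 * a^3) = ?c * q"
      unfolding v using q_eq by Groebner_Basis.algebra
    have c2: "\<iota> * m * n * a * b^2 * (a * b + m * n) = ?c * r"
      unfolding d unfolding v using \<iota> by Groebner_Basis.algebra
    have c3: "\<iota> * m * n * a^2 * b * (a * b + m * n) = ?c * s"
      unfolding d unfolding v using \<iota> by Groebner_Basis.algebra
    have c4: "m * n * (b^4 * n + a^4 * m) = ?c * x"
      unfolding k unfolding v by Groebner_Basis.algebra
    have "flag_map \<iota> v = ?c \<cdot>\<^sub>v y"
      unfolding F c0 c1 c2 c3 c4
      by (rule vec5_eqI) (use y(1) in \<open>simp_all add: p_def q_def r_def s_def x_def\<close>)
    moreover have "?c \<noteq> 0" using nz by simp
    ultimately show "flag_domain (flag_inverse \<iota> y) \<noteq> 0 \<and> (\<exists>c. c \<noteq> 0 \<and> flag_map \<iota> (flag_inverse \<iota> y) = c \<cdot>\<^sub>v y)"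
      using D unfolding v_def by blast
  qed
  show "\<exists>v\<in>carrier_vec 4. flag_domain v \<noteq> 0 \<and> (\<forall>i<4. flag_map \<iota> v $ i \<noteq> 0)"
    (* Not all coordinates may be 1 here, since the first two of the image would vanish. *)
    by (rule bexI[of _ "vec4 1 2 1 1"]) (use \<iota>0 in \<open>simp_all add: flag_domain_def flag_map_def Let_def all_less_4\<close>)
qed (simp_all add: flag_domain_def flag_codomain_def Let_def)

section \<open>Semidirect products with a group of order two\<close>

lemma carrier_integer_mod_group_2: "carrier (integer_mod_group 2) = {0, 1}"
  by (auto simp: carrier_integer_mod_group)

lemma semidirect_simps:
  "carrier (semidirect N H \<beta>) = carrier N \<times> carrier H"
  "(n, h) \<otimes>\<^bsub>semidirect N H \<beta>\<^esub> (m, k) = (n \<otimes>\<^bsub>N\<^esub> \<beta> h m, h \<otimes>\<^bsub>H\<^esub> k)"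
  "\<one>\<^bsub>semidirect N H \<beta>\<^esub> = (\<one>\<^bsub>N\<^esub>, \<one>\<^bsub>H\<^esub>)"
  by (simp_all add: semidirect_def)

text \<open>
  An involutive automorphism \<open>\<beta> 1\<close> is an action of the group of order two.
\<close>

lemma group_semidirect_C2:
  assumes N: "group N" and \<beta>0: "\<And>n. n \<in> carrier N \<Longrightarrow> \<beta> 0 n = n"
    and \<beta>1: "\<beta> 1 \<in> hom N N" "\<And>n. n \<in> carrier N \<Longrightarrow> \<beta> 1 (\<beta> 1 n) = n"
  shows "group (semidirect N (integer_mod_group 2) \<beta>)" (is "group ?M")
proof (rule groupI)
  interpret N: group N by fact
  have closed: "\<beta> 1 n \<in> carrier N" if "n \<in> carrier N" for n using \<beta>1(1) that by (auto simp: hom_def)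
  have mult: "\<beta> 1 (n \<otimes>\<^bsub>N\<^esub> m) = \<beta> 1 n \<otimes>\<^bsub>N\<^esub> \<beta> 1 m" if "n \<in> carrier N" "m \<in> carrier N" for n m
    using \<beta>1(1) that by (auto simp: hom_def)
  note simps = semidirect_simps carrier_integer_mod_group_2 \<beta>0 \<beta>1(2) closed mult
  show "x \<otimes>\<^bsub>?M\<^esub> y \<in> carrier ?M" if "x \<in> carrier ?M" "y \<in> carrier ?M" for x y
    using that by (cases x; cases y) (auto simp: simps)
  show "\<one>\<^bsub>?M\<^esub> \<in> carrier ?M" by (simp add: simps)
  show "x \<otimes>\<^bsub>?M\<^esub> y \<otimes>\<^bsub>?M\<^esub> z = x \<otimes>\<^bsub>?M\<^esub> (y \<otimes>\<^bsub>?M\<^esub> z)"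
    if "x \<in> carrier ?M" "y \<in> carrier ?M" "z \<in> carrier ?M" for x y z
    using that by (cases x; cases y; cases z) (auto simp: simps N.m_assoc)
  show "\<one>\<^bsub>?M\<^esub> \<otimes>\<^bsub>?M\<^esub> x = x" if "x \<in> carrier ?M" for x
    using that by (cases x) (auto simp: simps)
  show "\<exists>y\<in>carrier ?M. y \<otimes>\<^bsub>?M\<^esub> x = \<one>\<^bsub>?M\<^esub>" if x: "x \<in> carrier ?M" for x
  proof -
    obtain n h where nh: "x = (n, h)" "n \<in> carrier N" "h = 0 \<or> h = 1" using x by (cases x) (auto simp: simps)
    define y where "y = (\<beta> h (inv\<^bsub>N\<^esub> n), h)"
    have "\<beta> 1 (inv\<^bsub>N\<^esub> n) \<otimes>\<^bsub>N\<^esub> \<beta> 1 n = \<beta> 1 \<one>\<^bsub>N\<^esub>" using nh(2) by (simp flip: mult)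
    moreover have "\<beta> 1 \<one>\<^bsub>N\<^esub> = \<one>\<^bsub>N\<^esub>" by (rule hom_one[OF \<beta>1(1) N N])
    ultimately have "y \<in> carrier ?M \<and> y \<otimes>\<^bsub>?M\<^esub> x = \<one>\<^bsub>?M\<^esub>"
      using nh by (auto simp: y_def simps)
    then show ?thesis by blast
  qed
qed

text \<open>
  The universal property of the semidirect product, for a target that need not be a group.
\<close>

lemma semidirect_C2_hom:
  assumes K: "monoid K" and N: "group N" and r: "r \<in> hom N K" and s: "s \<in> carrier K" "s \<otimes>\<^bsub>K\<^esub> s = \<one>\<^bsub>K\<^esub>"
    and \<beta>0: "\<And>n. n \<in> carrier N \<Longrightarrow> \<beta> 0 n = n" and \<beta>1: "\<And>n. n \<in> carrier N \<Longrightarrow> \<beta> 1 n \<in> carrier N"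
    and twist: "\<And>n. n \<in> carrier N \<Longrightarrow> s \<otimes>\<^bsub>K\<^esub> r n = r (\<beta> 1 n) \<otimes>\<^bsub>K\<^esub> s"
  shows "(\<lambda>(n, h). r n \<otimes>\<^bsub>K\<^esub> (if h = 0 then \<one>\<^bsub>K\<^esub> else s)) \<in> hom (semidirect N (integer_mod_group 2) \<beta>) K"
    (is "?f \<in> hom ?M K")
proof -
  interpret K: monoid K by fact
  interpret N: group N by fact
  have rc: "r n \<in> carrier K" if "n \<in> carrier N" for n using r that by (auto simp: hom_def)
  have rm: "r (n \<otimes>\<^bsub>N\<^esub> m) = r n \<otimes>\<^bsub>K\<^esub> r m" if "n \<in> carrier N" "m \<in> carrier N" for n m
    using r that by (auto simp: hom_def)
  have "?f x \<in> carrier K" if "x \<in> carrier ?M" for x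
    using that s(1) rc by (cases x) (auto simp: semidirect_simps)
  moreover have "?f (x \<otimes>\<^bsub>?M\<^esub> y) = ?f x \<otimes>\<^bsub>K\<^esub> ?f y" if "x \<in> carrier ?M" "y \<in> carrier ?M" for x y
  proof -
    obtain n h m k where eq: "x = (n, h)" "y = (m, k)" by (cases x; cases y)
    then have nm: "n \<in> carrier N" "m \<in> carrier N" "h = 0 \<or> h = 1" "k = 0 \<or> k = 1"
      using that by (auto simp: semidirect_simps carrier_integer_mod_group_2)
    have "r n \<otimes>\<^bsub>K\<^esub> s \<otimes>\<^bsub>K\<^esub> (r m \<otimes>\<^bsub>K\<^esub> z) = r n \<otimes>\<^bsub>K\<^esub> r (\<beta> 1 m) \<otimes>\<^bsub>K\<^esub> (s \<otimes>\<^bsub>K\<^esub> z)" if "z \<in> carrier K" for z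
    proof -
      have "r n \<otimes>\<^bsub>K\<^esub> s \<otimes>\<^bsub>K\<^esub> (r m \<otimes>\<^bsub>K\<^esub> z) = r n \<otimes>\<^bsub>K\<^esub> (s \<otimes>\<^bsub>K\<^esub> r m) \<otimes>\<^bsub>K\<^esub> z"
        using that nm s(1) rc by (simp add: K.m_assoc)
      then show ?thesis using that nm s(1) rc twist[OF nm(2)] \<beta>1[OF nm(2)] by (simp add: K.m_assoc)
    qed
    from this[of s] this[of "\<one>\<^bsub>K\<^esub>"] show ?thesis
      using nm s rc \<beta>0 \<beta>1 by (auto simp: eq semidirect_simps rm K.m_assoc)
  qed
  ultimately show ?thesis by (auto simp: hom_def)
qed

lemma (in monoid) pow_cong:
  assumes "x \<in> carrier G" "x [^] (n::nat) = \<one>" "i mod n = j mod n"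
  shows "x [^] i = x [^] j"
proof -
  have "x [^] k = x [^] (k mod n)" for k
  proof -
    have "x [^] k = x [^] (n * (k div n) + k mod n)" by simp
    also have "\<dots> = (x [^] n) [^] (k div n) \<otimes> x [^] (k mod n)"
      using assms(1) by (simp only: nat_pow_mult nat_pow_pow)
    finally show ?thesis using assms(1,2) by simp
  qed
  then show ?thesis using assms(3) by metis
qed

lemma (in monoid) intertwine_pow:
  assumes "x \<in> carrier G" "y \<in> carrier G" "s \<in> carrier G" "s \<otimes> x = y \<otimes> s"
  shows "s \<otimes> x [^] (a::nat) = y [^] a \<otimes> s"
proof (induction a)
  case (Suc a)
  have "s \<otimes> x [^] Suc a = (s \<otimes> x [^] a) \<otimes> x" using assms by (simp add: m_assoc)
  also have "\<dots> = y [^] a \<otimes> (s \<otimes> x)" using Suc assms by (simp add: m_assoc)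
  also have "\<dots> = y [^] Suc a \<otimes> s" using assms by (simp add: m_assoc)
  finally show ?case .
qed (use assms in simp)

lemma cyclic_hom:
  assumes "monoid K" "x \<in> carrier K" "x [^]\<^bsub>K\<^esub> n = \<one>\<^bsub>K\<^esub>" "n > 0"
  shows "(\<lambda>a. x [^]\<^bsub>K\<^esub> nat a) \<in> hom (integer_mod_group n) K"
proof -
  interpret K: monoid K by fact
  have "x [^]\<^bsub>K\<^esub> nat ((a + b) mod int n) = x [^]\<^bsub>K\<^esub> nat a \<otimes>\<^bsub>K\<^esub> x [^]\<^bsub>K\<^esub> nat b" if "0 \<le> a" "0 \<le> b" for a b
  proof -
    have "nat ((a + b) mod int n) = (nat a + nat b) mod n" using that by (simp add: nat_mod_distrib nat_add_distrib)
    then have "x [^]\<^bsub>K\<^esub> nat ((a + b) mod int n) = x [^]\<^bsub>K\<^esub> (nat a + nat b)"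
      by (intro K.pow_cong[OF assms(2,3)]) simp
    then show ?thesis using assms(2) by (simp add: K.nat_pow_mult)
  qed
  then show ?thesis using assms(2,4) by (auto simp: hom_def carrier_integer_mod_group)
qed

section \<open>Conjugacy of subgroups of a given type\<close>

text \<open>
  If every embedding of \<open>M\<close> can be conjugated into the image of \<open>\<theta>\<close>, then by cardinality it can be
  conjugated onto that image, so all subgroups isomorphic to \<open>M\<close> are conjugate to it.
\<close>

lemma conjugate_subgroups:
  assumes W: "group W" and M: "group M" "finite (carrier M)"
    and \<theta>: "\<theta> \<in> hom M W" "inj_on \<theta> (carrier M)"
    and key: "\<And>h. h \<in> hom M W \<Longrightarrow> inj_on h (carrier M) \<Longrightarrow>
      \<exists>x\<in>carrier W. \<forall>m\<in>carrier M. \<exists>m'\<in>carrier M. h m \<otimes>\<^bsub>W\<^esub> x = x \<otimes>\<^bsub>W\<^esub> \<theta> m'"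
  shows "unique_up_to_conj W M"
    and "subgroup_of_type H W M \<Longrightarrow> \<exists>x\<in>carrier W. H = (\<lambda>m. x \<otimes>\<^bsub>W\<^esub> \<theta> m \<otimes>\<^bsub>W\<^esub> inv\<^bsub>W\<^esub> x) ` carrier M"
proof -
  interpret W: group W by fact
  interpret M: group M by fact
  have \<theta>c: "\<theta> m \<in> carrier W" if "m \<in> carrier M" for m using \<theta>(1) that by (auto simp: hom_def)
  have ex: "\<exists>x\<in>carrier W. H = (\<lambda>m. x \<otimes>\<^bsub>W\<^esub> \<theta> m \<otimes>\<^bsub>W\<^esub> inv\<^bsub>W\<^esub> x) ` carrier M"
    if type: "subgroup_of_type H W M" for H
  proof -
    have H: "subgroup H W" and "W\<lparr>carrier := H\<rparr> \<cong> M" using type by (auto simp: subgroup_of_type_def)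
    then obtain f where "f \<in> iso (W\<lparr>carrier := H\<rparr>) M" by (auto simp: is_iso_def)
    moreover have "group (W\<lparr>carrier := H\<rparr>)" by (rule subgroup.subgroup_is_group[OF H W])
    ultimately have "inv_into H f \<in> iso M (W\<lparr>carrier := H\<rparr>)" using group.iso_set_sym by fastforce
    then obtain h where h: "h \<in> hom M (W\<lparr>carrier := H\<rparr>)" "bij_betw h (carrier M) H"
      by (auto simp: iso_def)
    have "h \<in> hom M W" using h(1) subgroup.subset[OF H] by (auto simp: hom_def)
    then obtain x where x: "x \<in> carrier W"
      "\<And>m. m \<in> carrier M \<Longrightarrow> \<exists>m'\<in>carrier M. h m \<otimes>\<^bsub>W\<^esub> x = x \<otimes>\<^bsub>W\<^esub> \<theta> m'"
      using key[of h] h(2) by (auto simp: bij_betw_def)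
    let ?c = "\<lambda>m. x \<otimes>\<^bsub>W\<^esub> \<theta> m \<otimes>\<^bsub>W\<^esub> inv\<^bsub>W\<^esub> x"
    have "H \<subseteq> ?c ` carrier M"
    proof
      fix g assume g: "g \<in> H"
      then obtain m where "m \<in> carrier M" "g = h m" using h(2) by (auto simp: bij_betw_def)
      then obtain m' where m': "m' \<in> carrier M" "g \<otimes>\<^bsub>W\<^esub> x = x \<otimes>\<^bsub>W\<^esub> \<theta> m'" using x(2) by blast
      have "g \<in> carrier W" using g subgroup.subset[OF H] by blast
      then have "g = ?c m'" using m' x(1) \<theta>c W.inv_solve_right[of g "x \<otimes>\<^bsub>W\<^esub> \<theta> m'" x] by simp
      then show "g \<in> ?c ` carrier M" using m'(1) by blast
    qed
    moreover have "card (?c ` carrier M) \<le> card H"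
      using card_image_le[OF M(2), of ?c] bij_betw_same_card[OF h(2)] by simp
    ultimately have "H = ?c ` carrier M" using M(2) by (intro card_seteq) auto
    then show ?thesis using x(1) by blast
  qed
  then show "subgroup_of_type H W M \<Longrightarrow> \<exists>x\<in>carrier W. H = (\<lambda>m. x \<otimes>\<^bsub>W\<^esub> \<theta> m \<otimes>\<^bsub>W\<^esub> inv\<^bsub>W\<^esub> x) ` carrier M"
    by blast
  have "subgroup_of_type (\<theta> ` carrier M) W M"
  proof -
    interpret \<theta>: group_hom M W \<theta> by unfold_locales (use \<theta>(1) in simp)
    have "\<theta> \<in> iso M (W\<lparr>carrier := \<theta> ` carrier M\<rparr>)"
      using \<theta> by (auto simp: iso_def hom_def bij_betw_def)
    then have "W\<lparr>carrier := \<theta> ` carrier M\<rparr> \<cong> M" using M.iso_set_sym by (auto simp: is_iso_def)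
    then show ?thesis unfolding subgroup_of_type_def using \<theta>.img_is_subgroup by blast
  qed
  moreover have "\<exists>w\<in>carrier W. K = (\<lambda>h. w \<otimes>\<^bsub>W\<^esub> h \<otimes>\<^bsub>W\<^esub> inv\<^bsub>W\<^esub> w) ` H"
    if HK: "subgroup_of_type H W M" "subgroup_of_type K W M" for H K
  proof -
    obtain x y where x: "x \<in> carrier W" "H = (\<lambda>m. x \<otimes>\<^bsub>W\<^esub> \<theta> m \<otimes>\<^bsub>W\<^esub> inv\<^bsub>W\<^esub> x) ` carrier M"
      and y: "y \<in> carrier W" "K = (\<lambda>m. y \<otimes>\<^bsub>W\<^esub> \<theta> m \<otimes>\<^bsub>W\<^esub> inv\<^bsub>W\<^esub> y) ` carrier M"
      using ex[OF HK(1)] ex[OF HK(2)] by blast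
    let ?w = "y \<otimes>\<^bsub>W\<^esub> inv\<^bsub>W\<^esub> x"
    have "?w \<otimes>\<^bsub>W\<^esub> (x \<otimes>\<^bsub>W\<^esub> g \<otimes>\<^bsub>W\<^esub> inv\<^bsub>W\<^esub> x) \<otimes>\<^bsub>W\<^esub> inv\<^bsub>W\<^esub> ?w = y \<otimes>\<^bsub>W\<^esub> g \<otimes>\<^bsub>W\<^esub> inv\<^bsub>W\<^esub> y"
      if g: "g \<in> carrier W" for g
    proof -
      have can: "inv\<^bsub>W\<^esub> x \<otimes>\<^bsub>W\<^esub> (x \<otimes>\<^bsub>W\<^esub> z) = z" if "z \<in> carrier W" for z
        using that x(1) by (simp flip: W.m_assoc)
      show ?thesis using g x(1) y(1) by (simp add: W.inv_mult_group W.m_assoc can)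
    qed
    then have "K = (\<lambda>h. ?w \<otimes>\<^bsub>W\<^esub> h \<otimes>\<^bsub>W\<^esub> inv\<^bsub>W\<^esub> ?w) ` H"
      unfolding x(2) y(2) image_image using \<theta>c by (intro image_cong) auto
    then show ?thesis using x(1) y(1) by blast
  qed
  ultimately show "unique_up_to_conj W M" unfolding unique_up_to_conj_def by blast
qed

section \<open>The Weyl group as a group of words\<close>

fun distinct_word :: "word \<Rightarrow> bool" where
  "distinct_word (Word a b c d e) = distinct (map index [a, b, c, d, e])"

text \<open>
  Nested equivalences of truth values compute a parity.
\<close>

fun even_word :: "word \<Rightarrow> bool" where
  "even_word (Word a b c d e) = (positive a = (positive b = (positive c = (positive d = positive e))))"

definition weyl_word :: "word \<Rightarrow> bool" where
  "weyl_word w \<longleftrightarrow> distinct_word w \<and> even_word w"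

lemma UNIV_ix: "UNIV = {I0, I1, I2, I3, I4}"
  by (auto intro: ix.exhaust)

instance ix :: finite
  by standard (simp add: UNIV_ix)

lemma distinct_word_iff: "distinct_word w \<longleftrightarrow> inj (\<lambda>i. index (letter_at w i))"
  by (cases w) (auto simp: inj_on_def UNIV_ix)

definition letter_sign :: "letter \<Rightarrow> int" where
  "letter_sign l = (if positive l then 1 else - 1)"

lemma even_word_iff: "even_word w \<longleftrightarrow> (\<Prod>i\<in>UNIV. letter_sign (letter_at w i)) = 1"
  by (cases w) (auto simp: UNIV_ix letter_sign_def)

lemma index_act: "index (act g l) = index (letter_at g (index l))"
  by (cases l; cases "letter_at g (index l)") auto

lemma letter_sign_act: "letter_sign (act g l) = letter_sign l * letter_sign (letter_at g (index l))"
  by (cases l; cases "letter_at g (index l)") (auto simp: letter_sign_def)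

text \<open>
  The signs of \<open>wmult g h\<close> are those of \<open>h\<close> times those of \<open>g\<close>, the latter permuted by \<open>h\<close>.
\<close>

lemma word_sign_wmult:
  assumes "distinct_word h"
  shows "(\<Prod>i\<in>UNIV. letter_sign (letter_at (wmult g h) i)) = (\<Prod>i\<in>UNIV. letter_sign (letter_at g i)) * (\<Prod>i\<in>UNIV. letter_sign (letter_at h i))"
proof -
  have "bij (\<lambda>i. index (letter_at h i))"
    using assms unfolding distinct_word_iff by (simp add: bij_def finite_UNIV_inj_surj)
  then have "(\<Prod>i\<in>UNIV. letter_sign (letter_at g (index (letter_at h i)))) = (\<Prod>i\<in>UNIV. letter_sign (letter_at g i))"
    by (rule prod.reindex_bij_betw)
  then show ?thesis by (simp add: letter_at_wmult letter_sign_act prod.distrib mult.commute)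
qed

lemma distinct_word_wmult: "distinct_word g \<Longrightarrow> distinct_word h \<Longrightarrow> distinct_word (wmult g h)"
  unfolding distinct_word_iff letter_at_wmult index_act by (rule inj_compose[unfolded comp_def])

lemma weyl_word_wmult: "weyl_word g \<Longrightarrow> weyl_word h \<Longrightarrow> weyl_word (wmult g h)"
  unfolding weyl_word_def by (simp add: distinct_word_wmult even_word_iff word_sign_wmult)

lemma weyl_word_1: "weyl_word one_word"
  by (simp add: weyl_word_def one_word_def)

lemma weyl_word_right_inverse:
  assumes "weyl_word w" shows "\<exists>v. weyl_word v \<and> wmult w v = one_word"
proof -
  define p where "p i = index (letter_at w i)" for i
  have inj: "inj p" using assms unfolding weyl_word_def distinct_word_iff p_def by simp
  then have surj: "surj p" by (simp add: finite_UNIV_inj_surj)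
  define q where "q = inv_into UNIV p"
  have q: "p (q i) = i" "q (p i) = i" for i
    unfolding q_def using surj inj by (simp_all add: surj_f_inv_f)
  define l where "l i = (if positive (letter_at w (q i)) then Pos (q i) else Neg (q i))" for i
  define v where "v = Word (l I0) (l I1) (l I2) (l I3) (l I4)"
  have letter_at_v: "letter_at v i = l i" for i by (cases i) (auto simp: v_def)
  have "act w (l i) = Pos i" for i
  proof -
    have "index (letter_at w (q i)) = i" using q(1) by (simp add: p_def)
    then show ?thesis by (cases "letter_at w (q i)") (auto simp: l_def)
  qed
  then have wv: "wmult w v = one_word"
    by (intro word_eqI) (simp add: letter_at_wmult letter_at_v, metis wmult_1(1) act.simps(1) act_wmult wmult_1(2))
  have "index (l i) = q i" for i by (simp add: l_def)
  then have "distinct_word v"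
    unfolding distinct_word_iff letter_at_v using surj_imp_inj_inv[OF surj] q_def by simp
  moreover from this have "even_word v"
    using word_sign_wmult[of v w] assms weyl_word_1 unfolding weyl_word_def even_word_iff wv by simp
  ultimately show ?thesis using wv by (auto simp: weyl_word_def)
qed

definition weyl_words :: "word monoid" where
  "weyl_words = \<lparr>carrier = {w. weyl_word w}, monoid.mult = wmult, one = one_word\<rparr>"

lemma weyl_words_simps [simp]:
  "carrier weyl_words = {w. weyl_word w}" "monoid.mult weyl_words = wmult" "one weyl_words = one_word"
  by (simp_all add: weyl_words_def)

lemma group_weyl_words: "group weyl_words"
proof (rule groupI)
  show "\<exists>y\<in>carrier weyl_words. y \<otimes>\<^bsub>weyl_words\<^esub> x = \<one>\<^bsub>weyl_words\<^esub>" if x: "x \<in> carrier weyl_words" for x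
  proof -
    obtain y where y: "weyl_word y" "wmult x y = one_word" using weyl_word_right_inverse[of x] x by auto
    obtain z where z: "weyl_word z" "wmult y z = one_word" using weyl_word_right_inverse[of y] y by auto
    have "x = z" using y(2) z(2) by (metis wmult_assoc wmult_1)
    then show ?thesis using y z by auto
  qed
qed (auto simp: weyl_word_wmult weyl_word_1 wmult_assoc)

lemma even_card_5:
  "even (card {j. j < (5::nat) \<and> \<not> Q j}) \<longleftrightarrow> (Q 0 = (Q 1 = (Q 2 = (Q 3 = Q 4))))"
proof -
  have "card {j. j < (5::nat) \<and> \<not> Q j} = (\<Sum>j\<in>{j \<in> {..<5}. \<not> Q j}. 1)" by simp
  also have "\<dots> = (\<Sum>j<5. if \<not> Q j then 1 else 0)" by (rule sum.inter_filter) simp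
  finally have eq: "card {j. j < (5::nat) \<and> \<not> Q j} =
      (if \<not> Q 0 then 1 else 0) + (if \<not> Q 1 then 1 else 0) + (if \<not> Q 2 then 1 else 0)
      + (if \<not> Q 3 then 1 else 0) + (if \<not> Q 4 then 1 else 0)"
    unfolding sum_lessThan_5 .
  show ?thesis unfolding eq
    by (cases "Q 0"; cases "Q 1"; cases "Q 2"; cases "Q 3"; cases "Q 4") simp_all
qed

lemma signed_perm_mat_word:
  fixes \<epsilon> :: "nat \<Rightarrow> 'k::field_char_0"
  assumes \<sigma>: "\<sigma> permutes {..<5}" and \<epsilon>: "\<And>i. i < 5 \<Longrightarrow> \<epsilon> i = 1 \<or> \<epsilon> i = - 1"
    and w: "\<And>j. j < 5 \<Longrightarrow> letter_at w (ix_of_nat j) = (if \<epsilon> (\<sigma> j) = 1 then Pos else Neg) (ix_of_nat (\<sigma> j))"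
  shows "signed_perm_mat 5 \<sigma> \<epsilon> = word_mat w" "distinct_word w"
    "even_word w \<longleftrightarrow> even (card {i. i < 5 \<and> \<epsilon> i = - 1})"
proof -
  have \<sigma>5: "\<sigma> j < 5" if "j < 5" for j using permutes_in_image[OF \<sigma>] that by auto
  have inj: "inj \<sigma>" using \<sigma> by (rule permutes_inj)
  have w': "letter_at w i = (if \<epsilon> (\<sigma> (nat_of_ix i)) = 1 then Pos else Neg) (ix_of_nat (\<sigma> (nat_of_ix i)))" for i
    using w[of "nat_of_ix i"] by simp
  show "signed_perm_mat 5 \<sigma> \<epsilon> = word_mat w"
    by (rule eq_matI) (use w \<sigma>5 \<epsilon> in \<open>auto simp: signed_perm_mat_def word_mat_def\<close>)
  have index_w: "index (letter_at w i) = ix_of_nat (\<sigma> (nat_of_ix i))" for i by (simp add: w')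
  have "ix_of_nat (\<sigma> (nat_of_ix i)) = ix_of_nat (\<sigma> (nat_of_ix j)) \<Longrightarrow> i = j" for i j
    using \<sigma>5 inj by (metis nat_of_ix_less nat_of_ix_of_nat injD nat_of_ix_eq_iff)
  then show "distinct_word w" unfolding distinct_word_iff index_w by (rule injI)
  have "{i. i < 5 \<and> \<epsilon> i = - 1} = \<sigma> ` {j. j < 5 \<and> \<not> \<epsilon> (\<sigma> j) = 1}"
  proof -
    have "i \<in> \<sigma> ` {j. j < 5 \<and> \<not> \<epsilon> (\<sigma> j) = 1}" if "i < 5" "\<epsilon> i = - 1" for i
    proof -
      have "i \<in> \<sigma> ` {..<5}" using that(1) permutes_image[OF \<sigma>] by simp
      then obtain j where "j < 5" "\<sigma> j = i" by auto
      then show ?thesis using that(2) \<epsilon>[of i] by (intro image_eqI[of i \<sigma> j]) auto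
    qed
    then show ?thesis using \<epsilon> \<sigma>5 by auto
  qed
  then have "card {i. i < 5 \<and> \<epsilon> i = - 1} = card {j. j < 5 \<and> \<not> \<epsilon> (\<sigma> j) = 1}"
    using inj by (simp add: card_image inj_on_def inj_def)
  moreover have "w = Word (letter_at w (ix_of_nat 0)) (letter_at w (ix_of_nat 1)) (letter_at w (ix_of_nat 2)) (letter_at w (ix_of_nat 3)) (letter_at w (ix_of_nat 4))"
    by (cases w) (simp add: ix_of_nat_def)
  then have "even_word w \<longleftrightarrow> (\<epsilon> (\<sigma> 0) = 1) = ((\<epsilon> (\<sigma> 1) = 1) = ((\<epsilon> (\<sigma> 2) = 1) = ((\<epsilon> (\<sigma> 3) = 1) = (\<epsilon> (\<sigma> 4) = 1))))"
    using w[of 0] w[of 1] w[of 2] w[of 3] w[of 4] by (simp only: even_word.simps) auto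
  ultimately show "even_word w \<longleftrightarrow> even (card {i. i < 5 \<and> \<epsilon> i = - 1})" by (simp add: even_card_5)
qed

text \<open>
  The definition of the Weyl group attaches a sign to each row of the matrix, a word attaches it to
  each column; the permutation matches the two, and the number of negative signs is the same.
\<close>

lemma carrier_weyl_D: "carrier (weyl_D 5) = (word_mat :: word \<Rightarrow> 'k::field_char_0 mat) ` {w. weyl_word w}"
proof (intro equalityI subsetI)
  fix A :: "'k mat" assume "A \<in> carrier (weyl_D 5)"
  then obtain \<sigma> and \<epsilon> :: "nat \<Rightarrow> 'k" where A: "A = signed_perm_mat 5 \<sigma> \<epsilon>" "\<sigma> permutes {..<5}"
    "\<forall>i<5. \<epsilon> i = 1 \<or> \<epsilon> i = - 1" "even (card {i. i < 5 \<and> \<epsilon> i = - 1})"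
    by (auto simp: weyl_D_def)
  define l where "l j = (if \<epsilon> (\<sigma> j) = 1 then Pos else Neg) (ix_of_nat (\<sigma> j))" for j
  define w where "w = Word (l 0) (l 1) (l 2) (l 3) (l 4)"
  have "\<forall>j<5. letter_at w (ix_of_nat j) = l j" unfolding all_less_5 by (simp add: w_def ix_of_nat_def)
  then have "signed_perm_mat 5 \<sigma> \<epsilon> = word_mat w" "weyl_word w"
    using signed_perm_mat_word[of \<sigma> \<epsilon> w] A unfolding weyl_word_def l_def by auto
  then show "A \<in> word_mat ` {w. weyl_word w}" using A(1) by blast
next
  fix A :: "'k mat" assume "A \<in> word_mat ` {w. weyl_word w}"
  then obtain w where w: "A = word_mat w" "distinct_word w" "even_word w" by (auto simp: weyl_word_def)
  define \<sigma> where "\<sigma> j = (if j < 5 then nat_of_ix (index (letter_at w (ix_of_nat j))) else j)" for j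
  define \<epsilon> :: "nat \<Rightarrow> 'k" where "\<epsilon> i = (if positive (letter_at w (ix_of_nat (inv_into {..<5} \<sigma> i))) then 1 else - 1)" for i
  have inj: "inj_on \<sigma> {..<5}"
  proof (rule inj_onI)
    fix i j assume "i \<in> {..<5}" "j \<in> {..<5}" "\<sigma> i = \<sigma> j"
    then have "i < 5" "j < 5" "ix_of_nat i = ix_of_nat j"
      using w(2) by (auto simp: distinct_word_iff \<sigma>_def dest: injD)
    then show "i = j" by (metis nat_of_ix_of_nat)
  qed
  have "\<sigma> ` {..<5} \<subseteq> {..<5}" by (auto simp: \<sigma>_def)
  then have "\<sigma> ` {..<5} = {..<5}" using inj by (intro endo_inj_surj) auto
  then have \<sigma>: "\<sigma> permutes {..<5}" using inj by (intro bij_imp_permutes) (auto simp: bij_betw_def \<sigma>_def)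
  have "letter_at w (ix_of_nat j) = (if \<epsilon> (\<sigma> j) = 1 then Pos else Neg) (ix_of_nat (\<sigma> j))" if "j < 5" for j
  proof -
    have "inv_into {..<5} \<sigma> (\<sigma> j) = j" using inj that by simp
    then show ?thesis using that by (cases "letter_at w (ix_of_nat j)") (auto simp: \<epsilon>_def \<sigma>_def)
  qed
  then have "signed_perm_mat 5 \<sigma> \<epsilon> = word_mat w" "even_word w \<longleftrightarrow> even (card {i. i < 5 \<and> \<epsilon> i = - 1})"
    using signed_perm_mat_word[of \<sigma> \<epsilon> w] \<sigma> by (auto simp: \<epsilon>_def)
  then have "A = signed_perm_mat 5 \<sigma> \<epsilon>" "even (card {i. i < 5 \<and> \<epsilon> i = - 1})" using w by simp_all
  moreover have "\<forall>i<5. \<epsilon> i = 1 \<or> \<epsilon> i = - 1" by (simp add: \<epsilon>_def)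
  ultimately show "A \<in> carrier (weyl_D 5)" using \<sigma> by (simp add: weyl_D_def) blast
qed

lemma weyl_D_mult: "monoid.mult (weyl_D n) = (*)" and weyl_D_one: "one (weyl_D n) = 1\<^sub>m n"
  by (simp_all add: weyl_D_def GL_def units_of_def ring_mat_def)

lemma word_mat_iso: "word_mat \<in> iso weyl_words (weyl_D 5 :: 'k::field_char_0 mat monoid)"
  by (auto simp: iso_def hom_def carrier_weyl_D weyl_D_mult word_mat_wmult bij_betw_def inj_on_def dest: word_mat_inj)

lemma group_weyl_D: "group (weyl_D 5 :: 'k::field_char_0 mat monoid)"
proof -
  have "group ((weyl_D 5 :: 'k mat monoid)\<lparr>one := word_mat \<one>\<^bsub>weyl_words\<^esub>\<rparr>)"
    by (rule group.iso_imp_img_group[OF group_weyl_words word_mat_iso])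
  then show ?thesis by (simp add: word_mat_1 weyl_D_one[symmetric])
qed

section \<open>Elements of order eight and their normalizers\<close>

primrec wpow :: "word \<Rightarrow> nat \<Rightarrow> word" where
  "wpow w 0 = one_word"
| "wpow w (Suc n) = wmult (wpow w n) w"

definition letters :: "letter list" where
  "letters = [Pos I0, Pos I1, Pos I2, Pos I3, Pos I4, Neg I0, Neg I1, Neg I2, Neg I3, Neg I4]"

definition all_fresh :: "letter list \<Rightarrow> (letter \<Rightarrow> bool) \<Rightarrow> bool" where
  "all_fresh ls Q \<longleftrightarrow> list_all (\<lambda>l. if list_ex (\<lambda>m. index l = index m) ls then True else Q l) letters"

text \<open>
  A bounded quantification that extends a word letter by letter, so that evaluation discards
  repeated letters early and never builds the list of all words.
\<close>

definition all_weyl_words :: "(word \<Rightarrow> bool) \<Rightarrow> bool" where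
  "all_weyl_words Q \<longleftrightarrow>
     all_fresh [] (\<lambda>a. all_fresh [a] (\<lambda>b. all_fresh [a, b] (\<lambda>c. all_fresh [a, b, c] (\<lambda>d.
       all_fresh [a, b, c, d] (\<lambda>e. if even_word (Word a b c d e) then Q (Word a b c d e) else True)))))"

lemma all_freshD: "all_fresh ls Q \<Longrightarrow> \<forall>m\<in>set ls. index l \<noteq> index m \<Longrightarrow> Q l"
  by (cases l; cases "index l") (auto simp: all_fresh_def letters_def list_ex_iff split: if_splits)

lemma all_weyl_wordsD:
  assumes "all_weyl_words Q" "weyl_word w" shows "Q w"
proof (cases w)
  case (Word a b c d e)
  have dist: "distinct [index a, index b, index c, index d, index e]" and even: "even_word (Word a b c d e)"
    using assms(2) by (simp_all add: weyl_word_def Word)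
  from assms(1)[unfolded all_weyl_words_def, THEN all_freshD[of _ _ a], THEN all_freshD[of _ _ b],
      THEN all_freshD[of _ _ c], THEN all_freshD[of _ _ d], THEN all_freshD[of _ _ e]]
  show ?thesis using dist even by (auto simp: Word)
qed

definition negacycle :: word where "negacycle = Word (Pos I1) (Pos I2) (Pos I3) (Neg I0) (Neg I4)"

definition missing_index :: "letter list \<Rightarrow> ix" where
  "missing_index ls = hd (filter (\<lambda>i. list_all (\<lambda>m. index m \<noteq> i) ls) [I0, I1, I2, I3, I4])"

text \<open>
  For an element \<open>g\<close> of order eight and a letter \<open>a\<close> that \<open>g\<close> moves to a letter with another index, the
  letters \<open>a, g a, g\<^sup>2 a, g\<^sup>3 a\<close> run through the negacycle of \<open>g\<close>.  The sign of the last letter is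
  chosen such that the word has an even number of signs.
\<close>

definition octic_conjugator :: "word \<Rightarrow> word" where
  "octic_conjugator g =
     (let a = (if index (letter_at g I0) = I0 then Pos I1 else Pos I0);
          b = act g a; c = act g b; d = act g c; f = missing_index [a, b, c, d]
      in if even_word (Word a b c d (Pos f)) then Word a b c d (Pos f) else Word a b c d (Neg f))"

definition order_eight_check :: "word \<Rightarrow> bool" where
  "order_eight_check g \<longleftrightarrow> (let g2 = wmult g g; g4 = wmult g2 g2; x = octic_conjugator g in
     if g4 = one_word then True else if wmult g4 g4 = one_word
     then wmult g x = wmult x negacycle \<and> distinct_word x \<and> even_word x else True)"

lemma all_order_eight_check: "all_weyl_words order_eight_check"
  by code_simp

text \<open>
  An element of order eight must permute four of the coordinates cyclically, and its fourth power
  must change their signs.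
\<close>

lemma order_eight_conjugate:
  assumes "weyl_word g" "wmult (wmult g g) (wmult g g) \<noteq> one_word"
    "wmult (wmult (wmult g g) (wmult g g)) (wmult (wmult g g) (wmult g g)) = one_word"
  shows "\<exists>x. weyl_word x \<and> wmult g x = wmult x negacycle"
  using all_weyl_wordsD[OF all_order_eight_check assms(1)] assms(2,3)
  by (auto simp: order_eight_check_def Let_def weyl_word_def)

text \<open>
  The standard copy of a group of order sixteen: powers of the negacycle, times a power of the
  involution \<open>t\<close>.
\<close>

definition octic_word :: "word \<Rightarrow> int \<times> int \<Rightarrow> word" where
  "octic_word t = (\<lambda>(a, h). wmult (wpow negacycle (nat a)) (if h = 0 then one_word else t))"

definition octic_indices :: "(int \<times> int) list" where
  "octic_indices = [(0,0),(1,0),(2,0),(3,0),(4,0),(5,0),(6,0),(7,0),(0,1),(1,1),(2,1),(3,1),(4,1),(5,1),(6,1),(7,1)]"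

text \<open>
  If indices are read modulo four and going once around changes the sign, the negacycle is the shift,
  and these are $j \mapsto -j$ and $j \mapsto 3 j$.  The last sign makes the number of signs even.
\<close>

definition inverting_word :: word where "inverting_word = Word (Pos I0) (Neg I3) (Neg I2) (Neg I1) (Neg I4)"
definition cubing_word :: word where "cubing_word = Word (Pos I0) (Pos I3) (Neg I2) (Pos I1) (Neg I4)"

definition dihedral_check :: "word \<Rightarrow> bool" where
  "dihedral_check g \<longleftrightarrow>
     (if wmult g negacycle = wmult negacycle g \<or> wmult (wmult negacycle g) negacycle = g
      then g \<in> set (map (octic_word inverting_word) octic_indices) else True)"

text \<open>
  The centralizer of the negacycle in the Weyl group consists of its powers, so the elements that
  centralize or invert it form a group of order sixteen.
\<close>

lemma all_dihedral_check: "all_weyl_words dihedral_check"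
  by code_simp

definition semidihedral_check :: "word \<Rightarrow> bool" where
  "semidihedral_check g \<longleftrightarrow>
     (if wmult g negacycle = wmult negacycle g \<or> wmult g negacycle = wmult (wmult negacycle (wmult negacycle negacycle)) g
      then g \<in> set (map (octic_word cubing_word) octic_indices) else True)"

lemma all_semidihedral_check: "all_weyl_words semidihedral_check"
  by code_simp

definition first_quarter :: word where "first_quarter = Word (Pos I2) (Pos I1) (Neg I0) (Pos I3) (Neg I4)"
definition second_quarter :: word where "second_quarter = Word (Pos I0) (Pos I3) (Pos I2) (Neg I1) (Neg I4)"
definition quarter_swap :: word where "quarter_swap = Word (Pos I1) (Pos I0) (Pos I3) (Pos I2) (Pos I4)"

definition wreath_word :: "(int \<times> int) \<times> int \<Rightarrow> word" where
  "wreath_word = (\<lambda>((a, b), h). wmult (wmult (wpow first_quarter (nat a)) (wpow second_quarter (nat b)))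
     (if h = 0 then one_word else quarter_swap))"

definition wreath_indices :: "((int \<times> int) \<times> int) list" where
  "wreath_indices = [((a, b), h). a \<leftarrow> [0, 1, 2, 3], b \<leftarrow> [0, 1, 2, 3], h \<leftarrow> [0, 1]]"

definition wreath_check :: "word \<Rightarrow> bool" where
  "wreath_check g \<longleftrightarrow>
     (if wmult g (wmult negacycle negacycle) = wmult (wmult negacycle negacycle) g
      then g \<in> set (map wreath_word wreath_indices) else True)"

text \<open>
  The square of the negacycle is a complex structure on the first four coordinates; its centralizer
  consists of the monomial matrices of size two with fourth roots of unity as entries, and the sign of
  the last coordinate is then determined by parity.
\<close>

lemma all_wreath_check: "all_weyl_words wreath_check"
  by code_simp

lemma distinct_octic:
  "distinct (map (octic_word inverting_word) octic_indices)"
  "distinct (map (octic_word cubing_word) octic_indices)"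
  by code_simp+

lemma distinct_wreath: "distinct (map wreath_word wreath_indices)"
  by code_simp

section \<open>Linear maps under which a parametrization is equivariant\<close>

lemma monoid_GL_simps [simp]: "monoid.mult (GL n) = (*)" "one (GL n) = 1\<^sub>m n"
  by (simp_all add: GL_def units_of_def ring_mat_def)

lemma GL_memI:
  assumes "A \<in> carrier_mat n n" "B \<in> carrier_mat n n" "A * B = 1\<^sub>m n" "B * A = 1\<^sub>m n"
  shows "A \<in> carrier (GL n)"
  using assms by (auto simp: GL_def units_of_def Units_def ring_mat_def)

lemma group_GL: "group (GL n :: 'k::field mat monoid)"
proof -
  interpret ring "ring_mat TYPE('k) n ()" by (rule ring_mat)
  show ?thesis unfolding GL_def by (rule monoid.units_group[OF monoid_axioms])
qed

text \<open>
  Pairs of a signed permutation and a linear map of the parameter space under which \<open>F\<close> is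
  equivariant up to a scalar.  A homomorphism into this monoid provides the embedding into the Weyl
  group, the linear representation and the equivariance at once, and it only has to be given on
  generators.
\<close>

definition equivariant_pairs :: "'k::field mat \<Rightarrow> 'k mat \<Rightarrow> ('k vec \<Rightarrow> 'k vec) \<Rightarrow> (word \<times> 'k mat) monoid" where
  "equivariant_pairs C C' F = \<lparr>carrier = {(w, A). weyl_word w \<and> A \<in> carrier (GL 4) \<and>
       (\<exists>c. c \<noteq> 0 \<and> (\<forall>v\<in>carrier_vec 4. F (A *\<^sub>v v) = c \<cdot>\<^sub>v ((C * word_mat w * C') *\<^sub>v F v)))},
     monoid.mult = (\<lambda>(w, A) (v, B). (wmult w v, A * B)), one = (one_word, 1\<^sub>m 4)\<rparr>"

lemma equivariant_pairs_simps [simp]: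
  "x \<otimes>\<^bsub>equivariant_pairs C C' F\<^esub> y = (wmult (fst x) (fst y), snd x * snd y)"
  "\<one>\<^bsub>equivariant_pairs C C' F\<^esub> = (one_word, 1\<^sub>m 4)"
  by (simp_all add: equivariant_pairs_def case_prod_unfold)

lemma equivariant_pairs_carrier:
  assumes "x \<in> carrier (equivariant_pairs C C' F)"
  shows "weyl_word (fst x)" "snd x \<in> carrier (GL 4)" "snd x \<in> carrier_mat 4 4"
    "\<exists>c. c \<noteq> 0 \<and> (\<forall>v\<in>carrier_vec 4. F (snd x *\<^sub>v v) = c \<cdot>\<^sub>v ((C * word_mat (fst x) * C') *\<^sub>v F v))"
  using assms GL_carrier by (auto simp: equivariant_pairs_def)

lemma equivariant_pairsI:
  assumes "weyl_word w" "A \<in> carrier (GL 4)"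
    "\<exists>c. c \<noteq> 0 \<and> (\<forall>v\<in>carrier_vec 4. F (A *\<^sub>v v) = c \<cdot>\<^sub>v ((C * word_mat w * C') *\<^sub>v F v))"
  shows "(w, A) \<in> carrier (equivariant_pairs C C' F)"
  using assms by (simp add: equivariant_pairs_def)

lemma mult_carrier_mat_5 [simp]: "A \<in> carrier_mat 5 5 \<Longrightarrow> B \<in> carrier_mat 5 5 \<Longrightarrow> A * B \<in> carrier_mat 5 5"
  by (rule mult_carrier_mat)

lemma monoid_equivariant_pairs:
  fixes C C' :: "'k::field mat"
  assumes C: "split_coords C C'" and F: "\<And>v. v \<in> carrier_vec 4 \<Longrightarrow> F v \<in> carrier_vec 5"
  shows "monoid (equivariant_pairs C C' F)" (is "monoid ?K")
proof (rule monoidI)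
  interpret GL: group "GL 4 :: 'k mat monoid" by (rule group_GL)
  have C5: "C \<in> carrier_mat 5 5" "C' \<in> carrier_mat 5 5" and CC': "C * C' = 1\<^sub>m 5" "C' * C = 1\<^sub>m 5"
    using C by (auto simp: split_coords_def)
  have "(one_word, 1\<^sub>m 4) \<in> carrier ?K"
    using weyl_word_1 GL.one_closed F C5 CC' by (auto simp: equivariant_pairs_def word_mat_1 intro!: exI[of _ 1])
  then show "\<one>\<^bsub>?K\<^esub> \<in> carrier ?K" by simp
  show "x \<otimes>\<^bsub>?K\<^esub> y \<in> carrier ?K" if x: "x \<in> carrier ?K" and y: "y \<in> carrier ?K" for x y
  proof -
    obtain c where c: "c \<noteq> 0" "\<And>v. v \<in> carrier_vec 4 \<Longrightarrow> F (snd x *\<^sub>v v) = c \<cdot>\<^sub>v ((C * word_mat (fst x) * C') *\<^sub>v F v)"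
      using equivariant_pairs_carrier(4)[OF x] by blast
    obtain d where d: "d \<noteq> 0" "\<And>v. v \<in> carrier_vec 4 \<Longrightarrow> F (snd y *\<^sub>v v) = d \<cdot>\<^sub>v ((C * word_mat (fst y) * C') *\<^sub>v F v)"
      using equivariant_pairs_carrier(4)[OF y] by blast
    let ?X = "word_mat (fst x) :: 'k mat" and ?Y = "word_mat (fst y) :: 'k mat"
    have prod: "(C * ?X * C') * (C * ?Y * C') = C * word_mat (wmult (fst x) (fst y)) * C'"
    proof -
      have "(C * ?X * C') * (C * ?Y * C') = C * ?X * ((C' * C) * (?Y * C'))"
        using C5 by (simp add: assoc_mult_mat[of _ 5 5 _ 5 _ 5])
      also have "\<dots> = C * (?X * ?Y) * C'"
        using C5 unfolding CC' by (simp add: assoc_mult_mat[of _ 5 5 _ 5 _ 5] left_mult_one_mat[of _ 5 5])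
      finally show ?thesis by (simp add: word_mat_wmult)
    qed
    have "F ((snd x * snd y) *\<^sub>v v) = (c * d) \<cdot>\<^sub>v ((C * word_mat (wmult (fst x) (fst y)) * C') *\<^sub>v F v)"
      if v: "v \<in> carrier_vec 4" for v
    proof -
      have yv: "snd y *\<^sub>v v \<in> carrier_vec 4" using equivariant_pairs_carrier(3)[OF y] v by simp
      have "F ((snd x * snd y) *\<^sub>v v) = F (snd x *\<^sub>v (snd y *\<^sub>v v))"
        using equivariant_pairs_carrier(3)[OF x] equivariant_pairs_carrier(3)[OF y] v by simp
      also have "\<dots> = c \<cdot>\<^sub>v ((C * ?X * C') *\<^sub>v (d \<cdot>\<^sub>v ((C * ?Y * C') *\<^sub>v F v)))"
        using c(2)[OF yv] d(2)[OF v] by simp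
      also have "\<dots> = (c * d) \<cdot>\<^sub>v ((C * ?X * C') *\<^sub>v ((C * ?Y * C') *\<^sub>v F v))"
        using C5 F[OF v] by (subst mult_mat_vec[of _ 5 5]) (auto simp: smult_smult_assoc intro!: mult_mat_vec_carrier[of _ 5 5])
      also have "\<dots> = (c * d) \<cdot>\<^sub>v (((C * ?X * C') * (C * ?Y * C')) *\<^sub>v F v)"
        using C5 F[OF v] by (subst assoc_mult_mat_vec[of _ 5 5 _ 5]) auto
      finally show ?thesis unfolding prod .
    qed
    moreover have "snd x * snd y \<in> carrier (GL 4)"
      using GL.m_closed[OF equivariant_pairs_carrier(2)[OF x] equivariant_pairs_carrier(2)[OF y]] by simp
    moreover have "weyl_word (wmult (fst x) (fst y))"
      using equivariant_pairs_carrier(1)[OF x] equivariant_pairs_carrier(1)[OF y] by (rule weyl_word_wmult)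
    moreover have "c * d \<noteq> 0" using c(1) d(1) by simp
    ultimately have "(wmult (fst x) (fst y), snd x * snd y) \<in> carrier ?K"
      by (intro equivariant_pairsI) blast+
    then show ?thesis by simp
  qed
  show "x \<otimes>\<^bsub>?K\<^esub> y \<otimes>\<^bsub>?K\<^esub> z = x \<otimes>\<^bsub>?K\<^esub> (y \<otimes>\<^bsub>?K\<^esub> z)" if "x \<in> carrier ?K" "y \<in> carrier ?K" "z \<in> carrier ?K" for x y z
    using that[THEN equivariant_pairs_carrier(3)] by (simp add: wmult_assoc assoc_mult_mat[of _ 4 4 _ 4 _ 4])
  show "\<one>\<^bsub>?K\<^esub> \<otimes>\<^bsub>?K\<^esub> x = x" "x \<otimes>\<^bsub>?K\<^esub> \<one>\<^bsub>?K\<^esub> = x" if "x \<in> carrier ?K" for x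
    using equivariant_pairs_carrier(3)[OF that] by (auto simp: prod_eq_iff)
qed

lemma equivariant_pairs_pow:
  fixes A :: "'k::field mat"
  assumes "A \<in> carrier_mat 4 4"
  shows "(w, A) [^]\<^bsub>equivariant_pairs C C' F\<^esub> (n :: nat) = (wpow w n, A ^\<^sub>m n)"
  by (induction n) (use assms in \<open>auto simp: nat_pow_def\<close>)

text \<open>
  Here \<open>b\<close> is the action of the word in split coordinates, as an explicit map.
\<close>

lemma equivariant_pairs_generator:
  fixes C C' :: "'k::field mat"
  assumes C: "split_coords C C'" and F: "\<And>v. v \<in> carrier_vec 4 \<Longrightarrow> F v \<in> carrier_vec 5"
    and w: "weyl_word w" and A: "A \<in> carrier (GL 4)" and c: "c \<noteq> 0"
    and wC: "\<And>x. x \<in> carrier_vec 5 \<Longrightarrow> C *\<^sub>v (word_mat w *\<^sub>v x) = b (C *\<^sub>v x)"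
    and FA: "\<And>v. v \<in> carrier_vec 4 \<Longrightarrow> F (A *\<^sub>v v) = c \<cdot>\<^sub>v b (F v)"
  shows "(w, A) \<in> carrier (equivariant_pairs C C' F)"
proof -
  have C5: "C \<in> carrier_mat 5 5" "C' \<in> carrier_mat 5 5" and CC': "C * C' = 1\<^sub>m 5"
    using C by (auto simp: split_coords_def)
  have "(C * word_mat w * C') *\<^sub>v y = b y" if y: "y \<in> carrier_vec 5" for y
  proof -
    have "(C * word_mat w * C') *\<^sub>v y = C *\<^sub>v (word_mat w *\<^sub>v (C' *\<^sub>v y))"
      using C5 y by (simp add: assoc_mult_mat_vec[of _ 5 5 _ 5])
    also have "\<dots> = b (C *\<^sub>v (C' *\<^sub>v y))" using C5 y by (simp add: wC)
    also have "C *\<^sub>v (C' *\<^sub>v y) = y" using C5 y CC' by (simp flip: assoc_mult_mat_vec)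
    finally show ?thesis .
  qed
  then show ?thesis using w A c FA F unfolding equivariant_pairs_def by auto
qed

section \<open>Linearizability of all subgroups of a given type\<close>

lemma linearizable_iso:
  assumes M: "group M" and \<psi>: "\<psi> \<in> iso M G" and lin: "linearizable M (\<lambda>m. \<alpha> (\<psi> m)) k X"
  shows "linearizable G \<alpha> k X"
proof -
  obtain n \<rho> U V \<phi> where h: "\<rho> \<in> hom M (GL n)" "birational_via n (proj n) k X U V \<phi>"
    "\<And>m p. m \<in> carrier M \<Longrightarrow> p \<in> U \<Longrightarrow> proj_action (\<rho> m) p \<in> U \<Longrightarrow> \<phi> (proj_action (\<rho> m) p) = \<alpha> (\<psi> m) (\<phi> p)"
    using lin unfolding linearizable_def by blast
  let ?i = "inv_into (carrier M) \<psi>"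
  have i: "?i \<in> iso G M" by (rule group.iso_set_sym[OF M \<psi>])
  then have "\<rho> \<circ> ?i \<in> hom G (GL n)" using h(1) by (intro hom_compose) (auto simp: iso_def)
  moreover have i_closed: "?i g \<in> carrier M" "\<psi> (?i g) = g" if "g \<in> carrier G" for g
    using \<psi> that by (auto simp: iso_def bij_betw_def inv_into_into f_inv_into_f)
  moreover have "\<phi> (proj_action ((\<rho> \<circ> ?i) g) p) = \<alpha> g (\<phi> p)"
    if "g \<in> carrier G" "p \<in> U" "proj_action ((\<rho> \<circ> ?i) g) p \<in> U" for g p
    using h(3)[of "?i g" p] i_closed[OF that(1)] that by simp
  ultimately show ?thesis unfolding linearizable_def using h(2) by blast
qed

lemma word_mat_sum_squares:
  fixes v :: "'k::field vec"
  assumes "distinct_word w" "v \<in> carrier_vec 5"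
  shows "(\<Sum>i<5. ((word_mat w *\<^sub>v v) $ i)\<^sup>2) = (\<Sum>i<5. (v $ i)\<^sup>2)"
proof -
  have bij_nat: "bij_betw nat_of_ix UNIV {..<5}"
    by (rule bij_betw_byWitness[where f' = ix_of_nat]) auto
  define p where "p i = index (letter_at w i)" for i
  have inj: "inj p" using assms(1) unfolding distinct_word_iff p_def .
  then have bij: "bij p" by (simp add: bij_def finite_UNIV_inj_surj)
  have entry: "(word_mat w *\<^sub>v v) $ nat_of_ix (p i) = (if positive (letter_at w i) then 1 else - 1) * v $ nat_of_ix i" for i
  proof -
    have "entry l n = (if n = nat_of_ix (index l) then (if positive l then 1 else - 1) else (0 :: 'k))" for l n
      by (cases l) auto
    then have "entry (letter_at w j) (nat_of_ix (p i)) =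
        (if j = i then (if positive (letter_at w i) then 1 else - 1) else (0 :: 'k))" for j
      using inj_eq[OF inj, of i j] by (auto simp flip: p_def)
    then have "(word_mat w *\<^sub>v v) $ nat_of_ix (p i) =
        (\<Sum>j = 0..<5. (if ix_of_nat j = i then (if positive (letter_at w i) then 1 else - 1) else 0) * v $ j)"
      using assms(2) by (simp add: word_mat_def scalar_prod_def)
    also have "\<dots> = (\<Sum>j \<in> {0..<5}. if j = nat_of_ix i then (if positive (letter_at w i) then 1 else - 1) * v $ j else 0)"
      by (rule sum.cong) auto
    finally show ?thesis by simp
  qed
  have "(\<Sum>i<5. ((word_mat w *\<^sub>v v) $ i)\<^sup>2) = (\<Sum>i\<in>UNIV. ((word_mat w *\<^sub>v v) $ nat_of_ix i)\<^sup>2)"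
    by (rule sum.reindex_bij_betw[OF bij_nat, symmetric])
  also have "\<dots> = (\<Sum>i\<in>UNIV. ((word_mat w *\<^sub>v v) $ nat_of_ix (p i))\<^sup>2)"
    by (rule sum.reindex_bij_betw[OF bij, symmetric])
  also have "\<dots> = (\<Sum>i\<in>UNIV. (v $ nat_of_ix i)\<^sup>2)"
    by (rule sum.cong) (simp_all add: entry power_mult_distrib)
  also have "\<dots> = (\<Sum>i<5. (v $ i)\<^sup>2)"
    by (rule sum.reindex_bij_betw[OF bij_nat])
  finally show ?thesis .
qed

text \<open>
  A subgroup of the given type is the conjugate by some \<open>X\<close> of the standard copy.  Since \<open>X\<close>
  preserves the quadric, \<open>C * X\<^sup>-\<^sup>1\<close> is another system of split coordinates, and in it the
  conjugate acts by the same matrices as the standard copy does in \<open>C\<close>.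
\<close>

lemma subgroups_of_type_linearizable:
  fixes C C' :: "'k::field_char_0 mat"
  assumes M: "group M" "finite (carrier M)"
    and coords: "split_coords C C'" and param: "split_parametrization F H D E"
    and f: "f \<in> hom M (equivariant_pairs C C' F)" and inj: "inj_on (fst \<circ> f) (carrier M)"
    and key: "\<And>h. h \<in> hom M weyl_words \<Longrightarrow> inj_on h (carrier M) \<Longrightarrow>
      \<exists>x. weyl_word x \<and> (\<forall>m\<in>carrier M. \<exists>m'\<in>carrier M. wmult (h m) x = wmult x (fst (f m')))"
  shows "unique_up_to_conj (weyl_D 5 :: 'k mat monoid) M \<and>
    (\<forall>G. subgroup_of_type G (weyl_D 5 :: 'k mat monoid) M \<longrightarrow>
      linearizable ((weyl_D 5)\<lparr>carrier := G\<rparr>) proj_action 5 (quadric :: 'k vec set set))"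
proof -
  let ?W = "weyl_D 5 :: 'k mat monoid"
  let ?\<theta> = "\<lambda>m. word_mat (fst (f m)) :: 'k mat"
  interpret W: group ?W by (rule group_weyl_D)
  have f_closed: "f m \<in> carrier (equivariant_pairs C C' F)" if "m \<in> carrier M" for m
    using f that by (auto simp: hom_def)
  have f_mult: "f (a \<otimes>\<^bsub>M\<^esub> b) = f a \<otimes>\<^bsub>equivariant_pairs C C' F\<^esub> f b" if "a \<in> carrier M" "b \<in> carrier M" for a b
    using f that by (auto simp: hom_def)
  have \<theta>_hom: "?\<theta> \<in> hom M ?W"
  proof (rule homI)
    show "?\<theta> m \<in> carrier ?W" if "m \<in> carrier M" for m
      unfolding carrier_weyl_D using equivariant_pairs_carrier(1)[OF f_closed[OF that]] by simp
  qed (simp add: f_mult weyl_D_mult word_mat_wmult)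
  have \<theta>_inj: "inj_on ?\<theta> (carrier M)"
    using inj by (auto simp: inj_on_def dest: word_mat_inj)
  have \<rho>: "snd \<circ> f \<in> hom M (GL 4)"
  proof (rule homI)
    show "(snd \<circ> f) m \<in> carrier (GL 4)" if "m \<in> carrier M" for m
      using equivariant_pairs_carrier(2)[OF f_closed[OF that]] by simp
  qed (simp add: f_mult)
  have key': "\<exists>x\<in>carrier ?W. \<forall>m\<in>carrier M. \<exists>m'\<in>carrier M. h m \<otimes>\<^bsub>?W\<^esub> x = x \<otimes>\<^bsub>?W\<^esub> ?\<theta> m'"
    if h: "h \<in> hom M ?W" "inj_on h (carrier M)" for h
  proof -
    let ?i = "inv_into (carrier weyl_words) word_mat :: 'k mat \<Rightarrow> word"
    have i: "?i \<in> iso ?W weyl_words" by (rule group.iso_set_sym[OF group_weyl_words word_mat_iso])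
    have wi: "word_mat (?i A) = A" if "A \<in> carrier ?W" for A
      by (rule f_inv_into_f) (use that in \<open>auto simp: carrier_weyl_D\<close>)
    have hc: "h m \<in> carrier ?W" if "m \<in> carrier M" for m using h(1) that by (auto simp: hom_def)
    have "?i \<circ> h \<in> hom M weyl_words" using h(1) i by (intro hom_compose) (auto simp: iso_def)
    moreover have "inj_on (?i \<circ> h) (carrier M)"
      using h(2) hc wi unfolding inj_on_def comp_def by metis
    ultimately obtain x where x: "weyl_word x"
      "\<And>m. m \<in> carrier M \<Longrightarrow> \<exists>m'\<in>carrier M. wmult (?i (h m)) x = wmult x (fst (f m'))"
      using key[of "?i \<circ> h"] by auto
    have "\<exists>m'\<in>carrier M. h m * word_mat x = word_mat x * ?\<theta> m'" if m: "m \<in> carrier M" for m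
    proof -
      obtain m' where m': "m' \<in> carrier M" "wmult (?i (h m)) x = wmult x (fst (f m'))" using x(2)[OF m] by blast
      then have "word_mat (?i (h m)) * word_mat x = word_mat x * ?\<theta> m'" by (simp flip: word_mat_wmult)
      then show ?thesis using m'(1) wi[OF hc[OF m]] by auto
    qed
    then show ?thesis using x(1) by (auto simp: carrier_weyl_D weyl_D_mult)
  qed
  have "linearizable (?W\<lparr>carrier := G\<rparr>) proj_action 5 (quadric :: 'k vec set set)"
    if G: "subgroup_of_type G ?W M" for G
  proof -
    obtain X where X: "X \<in> carrier ?W" "G = (\<lambda>m. X \<otimes>\<^bsub>?W\<^esub> ?\<theta> m \<otimes>\<^bsub>?W\<^esub> inv\<^bsub>?W\<^esub> X) ` carrier M"
      using conjugate_subgroups(2)[OF group_weyl_D M \<theta>_hom \<theta>_inj key' G] by blast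
    obtain x where x: "X = word_mat x" "weyl_word x" using X(1) by (auto simp: carrier_weyl_D)
    obtain y where y: "inv\<^bsub>?W\<^esub> X = word_mat y" "weyl_word y"
      using W.inv_closed[OF X(1)] unfolding carrier_weyl_D by blast
    let ?X = "word_mat x :: 'k mat" and ?Y = "word_mat y :: 'k mat"
    have XY: "?X * ?Y = 1\<^sub>m 5" "?Y * ?X = 1\<^sub>m 5"
      using W.r_inv[OF X(1)] W.l_inv[OF X(1)] x(1) y(1) by (simp_all add: weyl_D_mult weyl_D_one)
    let ?\<psi> = "\<lambda>m. ?X * ?\<theta> m * ?Y"
    have G_eq: "G = ?\<psi> ` carrier M" using X(2) x(1) y(1) by (simp add: weyl_D_mult)
    have can: "?Y * (?X * B) = B" if "B \<in> carrier_mat 5 5" for B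
      using that XY by (simp flip: assoc_mult_mat[of _ 5 5 _ 5 _ 5])
    have "?\<psi> \<in> hom M (?W\<lparr>carrier := G\<rparr>)"
    proof (rule homI)
      fix a b assume ab: "a \<in> carrier M" "b \<in> carrier M"
      have "?\<psi> (a \<otimes>\<^bsub>M\<^esub> b) = ?\<psi> a * ?\<psi> b"
        using ab by (simp add: f_mult word_mat_wmult assoc_mult_mat[of _ 5 5 _ 5 _ 5] can)
      then show "?\<psi> (a \<otimes>\<^bsub>M\<^esub> b) = ?\<psi> a \<otimes>\<^bsub>?W\<lparr>carrier := G\<rparr>\<^esub> ?\<psi> b" by (simp add: weyl_D_mult)
    qed (use G_eq in simp)
    moreover have "inj_on ?\<psi> (carrier M)"
    proof (rule inj_onI)
      fix a b assume ab: "a \<in> carrier M" "b \<in> carrier M" "?\<psi> a = ?\<psi> b"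
      have "?Y * (?\<psi> m * ?X) = ?\<theta> m" for m
        by (simp add: assoc_mult_mat[of _ 5 5 _ 5 _ 5] can XY right_mult_one_mat[of _ 5 5])
      then have "?\<theta> a = ?\<theta> b" using ab(3) by metis
      then show "a = b" using \<theta>_inj ab(1,2) by (auto dest: inj_onD)
    qed
    ultimately have \<psi>: "?\<psi> \<in> iso M (?W\<lparr>carrier := G\<rparr>)"
      using G_eq by (auto simp: iso_def bij_betw_def)
    have C: "C \<in> carrier_mat 5 5" "C' \<in> carrier_mat 5 5" "C * C' = 1\<^sub>m 5" "C' * C = 1\<^sub>m 5"
      and CQ: "\<And>v. v \<in> carrier_vec 5 \<Longrightarrow> split_form (C *\<^sub>v v) = (\<Sum>i<5. (v $ i)\<^sup>2)"
      using coords unfolding split_coords_def by blast+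
    have "split_coords (C * ?Y) (?X * C')"
      unfolding split_coords_def
    proof (intro conjI ballI)
      have "(C * ?Y) * (?X * C') = C * (?Y * (?X * C'))" using C by (simp add: assoc_mult_mat[of _ 5 5 _ 5 _ 5])
      then show "(C * ?Y) * (?X * C') = 1\<^sub>m 5" using C can by simp
      have "(?X * C') * (C * ?Y) = ?X * ((C' * C) * ?Y)" using C(1,2) by (simp add: assoc_mult_mat[of _ 5 5 _ 5 _ 5])
      then show "(?X * C') * (C * ?Y) = 1\<^sub>m 5" using C XY by (simp add: left_mult_one_mat[of _ 5 5])
      fix v :: "'k vec" assume v: "v \<in> carrier_vec 5"
      have Yv: "?Y *\<^sub>v v \<in> carrier_vec 5" using mult_mat_vec_carrier[OF word_mat_carrier v] .
      have "(C * ?Y) *\<^sub>v v = C *\<^sub>v (?Y *\<^sub>v v)" using C(1) v by (simp add: assoc_mult_mat_vec[of _ 5 5 _ 5])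
      then show "split_form ((C * ?Y) *\<^sub>v v) = (\<Sum>i<5. (v $ i)\<^sup>2)"
        using CQ[OF Yv] word_mat_sum_squares[of y v] y(2) v by (simp add: weyl_word_def)
    qed (use C in auto)
    moreover have "\<exists>c. c \<noteq> 0 \<and> (\<forall>v\<in>carrier_vec 4.
        F ((snd \<circ> f) m *\<^sub>v v) = c \<cdot>\<^sub>v ((C * ?Y * ?\<psi> m * (?X * C')) *\<^sub>v F v))" if m: "m \<in> carrier M" for m
    proof -
      have "C * ?Y * ?\<psi> m * (?X * C') = C * ?\<theta> m * C'"
        using C(1,2) by (simp add: assoc_mult_mat[of _ 5 5 _ 5 _ 5] can)
      then show ?thesis using equivariant_pairs_carrier(4)[OF f_closed[OF m]] by simp
    qed
    moreover have "?\<psi> m \<in> carrier_mat 5 5" for m by (intro mult_carrier_mat[of _ 5 5]) auto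
    ultimately have "linearizable M (\<lambda>m. proj_action (?\<psi> m)) 5 (quadric :: 'k vec set set)"
      by (intro linearizable_split_quadric[OF _ param \<rho>]) auto
    then show ?thesis by (rule linearizable_iso[OF M(1) \<psi>])
  qed
  then show ?thesis using conjugate_subgroups(1)[OF group_weyl_D M \<theta>_hom \<theta>_inj key'] by blast
qed

text \<open>
  The image of \<open>e\<close> has order eight, hence is conjugate to the negacycle.  The conjugated embedding \<open>c\<close>
  takes every relation between \<open>e\<close> and \<open>m\<close> to a relation between the negacycle and \<open>c m\<close>, which
  locates \<open>c m\<close>.
\<close>

lemma conjugate_by_relation:
  assumes M: "group M" and e: "e \<in> carrier M"
    "(e \<otimes>\<^bsub>M\<^esub> e) \<otimes>\<^bsub>M\<^esub> (e \<otimes>\<^bsub>M\<^esub> e) \<noteq> \<one>\<^bsub>M\<^esub>"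
    "((e \<otimes>\<^bsub>M\<^esub> e) \<otimes>\<^bsub>M\<^esub> (e \<otimes>\<^bsub>M\<^esub> e)) \<otimes>\<^bsub>M\<^esub> ((e \<otimes>\<^bsub>M\<^esub> e) \<otimes>\<^bsub>M\<^esub> (e \<otimes>\<^bsub>M\<^esub> e)) = \<one>\<^bsub>M\<^esub>"
    and h: "h \<in> hom M weyl_words" "inj_on h (carrier M)"
    and rel: "\<And>c m. c \<in> hom M weyl_words \<Longrightarrow> c e = negacycle \<Longrightarrow> m \<in> carrier M \<Longrightarrow> c m \<in> \<theta> ` carrier M"
  shows "\<exists>x. weyl_word x \<and> (\<forall>m\<in>carrier M. \<exists>m'\<in>carrier M. wmult (h m) x = wmult x (\<theta> m'))"
proof -
  interpret M: group M by fact
  interpret W: group weyl_words by (rule group_weyl_words)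
  have hm: "h (a \<otimes>\<^bsub>M\<^esub> b) = wmult (h a) (h b)" if "a \<in> carrier M" "b \<in> carrier M" for a b
    using h(1) that by (auto simp: hom_def)
  have hw: "weyl_word (h m)" if "m \<in> carrier M" for m using h(1) that by (auto simp: hom_def)
  have h1: "h \<one>\<^bsub>M\<^esub> = one_word" using hom_one[OF h(1) M group_weyl_words] by simp
  have "\<exists>x. weyl_word x \<and> wmult (h e) x = wmult x negacycle"
  proof (rule order_eight_conjugate[OF hw[OF e(1)]])
    show "wmult (wmult (h e) (h e)) (wmult (h e) (h e)) \<noteq> one_word"
      using e(1,2) h1 inj_onD[OF h(2), of "(e \<otimes>\<^bsub>M\<^esub> e) \<otimes>\<^bsub>M\<^esub> (e \<otimes>\<^bsub>M\<^esub> e)" "\<one>\<^bsub>M\<^esub>"] by (auto simp: hm)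
    show "wmult (wmult (wmult (h e) (h e)) (wmult (h e) (h e))) (wmult (wmult (h e) (h e)) (wmult (h e) (h e))) = one_word"
      using arg_cong[OF e(3), of h] e(1) by (simp add: hm h1)
  qed
  then obtain x where x: "weyl_word x" "wmult (h e) x = wmult x negacycle" by blast
  define y where "y = inv\<^bsub>weyl_words\<^esub> x"
  have y: "weyl_word y" "wmult y x = one_word" "wmult x y = one_word"
    using W.inv_closed[of x] W.l_inv[of x] W.r_inv[of x] x(1) by (simp_all add: y_def)
  have can: "wmult y (wmult x g) = g" "wmult x (wmult y g) = g" for g
    by (simp_all flip: wmult_assoc add: y)
  define c where "c m = wmult y (wmult (h m) x)" for m
  have "c \<in> hom M weyl_words"
    by (rule homI) (simp_all add: c_def hm hw x(1) y(1) weyl_word_wmult wmult_assoc can)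
  moreover have "c e = negacycle" by (simp add: c_def x(2) can)
  ultimately have "\<exists>m'\<in>carrier M. c m = \<theta> m'" if "m \<in> carrier M" for m
    using rel[of c m] that by blast
  moreover have "wmult (h m) x = wmult x (c m)" for m by (simp add: c_def can)
  ultimately show ?thesis using x(1) by metis
qed

section \<open>The three groups\<close>

text \<open>
  A common form of the dihedral (\<open>k = - 1\<close>) and the semidihedral (\<open>k = 3\<close>) group of order 16.
\<close>

definition octic_semidirect :: "int \<Rightarrow> (int \<times> int) monoid" where
  "octic_semidirect k = semidirect (integer_mod_group 8) (integer_mod_group 2) (\<lambda>h a. if h = 0 then a else (k * a) mod 8)"

lemma dihedral_16_octic: "dihedral_16 = octic_semidirect (- 1)"
  by (simp add: dihedral_16_def octic_semidirect_def cong: if_cong)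

lemma semidihedral_16_octic: "semidihedral_16 = octic_semidirect 3"
  by (simp add: semidihedral_16_def octic_semidirect_def)

lemma octic_carrier: "carrier (octic_semidirect k) = set octic_indices"
proof -
  have 8: "carrier (integer_mod_group 8) = {0, 1, 2, 3, 4, 5, 6, 7}"
    by (auto simp: carrier_integer_mod_group)
  show ?thesis
    unfolding octic_semidirect_def semidirect_simps carrier_integer_mod_group_2 8 octic_indices_def by auto
qed

lemma group_octic:
  assumes "(k * k) mod 8 = 1" shows "group (octic_semidirect k)"
  unfolding octic_semidirect_def
proof (rule group_semidirect_C2)
  show "(\<lambda>a. if (1::int) = 0 then a else (k * a) mod 8) \<in> hom (integer_mod_group 8) (integer_mod_group 8)"
    by (auto simp: hom_def carrier_integer_mod_group mod_add_eq mod_mult_right_eq distrib_left)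
  fix a :: int assume a: "a \<in> carrier (integer_mod_group 8)"
  have "(k * (k * a mod 8)) mod 8 = ((k * k) mod 8 * a) mod 8"
    by (simp add: mod_mult_right_eq mod_mult_left_eq mult.assoc)
  then show "(if (1::int) = 0 then if (1::int) = 0 then a else (k * a) mod 8
      else (k * (if (1::int) = 0 then a else (k * a) mod 8)) mod 8) = a"
    using a assms by (simp add: carrier_integer_mod_group)
qed simp_all

lemma octic_hom:
  assumes K: "monoid K" and x: "x \<in> carrier K" "x [^]\<^bsub>K\<^esub> (8::nat) = \<one>\<^bsub>K\<^esub>"
    and s: "s \<in> carrier K" "s \<otimes>\<^bsub>K\<^esub> s = \<one>\<^bsub>K\<^esub>" "s \<otimes>\<^bsub>K\<^esub> x = x [^]\<^bsub>K\<^esub> (j::nat) \<otimes>\<^bsub>K\<^esub> s"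
    and k: "int j mod 8 = k mod 8"
  shows "(\<lambda>(a, h). x [^]\<^bsub>K\<^esub> nat a \<otimes>\<^bsub>K\<^esub> (if h = 0 then \<one>\<^bsub>K\<^esub> else s)) \<in> hom (octic_semidirect k) K"
  unfolding octic_semidirect_def
proof (rule semidirect_C2_hom[OF K group_integer_mod_group _ s(1,2)])
  interpret K: monoid K by fact
  show "(\<lambda>a. x [^]\<^bsub>K\<^esub> nat a) \<in> hom (integer_mod_group 8) K"
    by (rule cyclic_hom[OF K x]) simp
  fix a assume "a \<in> carrier (integer_mod_group 8)"
  then have a: "0 \<le> a" by (simp add: carrier_integer_mod_group)
  have "int ((j * nat a) mod 8) = (int j * a) mod 8" using a by (simp add: zmod_int)
  also have "\<dots> = (k * a) mod 8" by (rule mod_mult_cong[OF k refl])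
  also have "\<dots> = int (nat ((k * a) mod 8) mod 8)" by (simp add: zmod_int)
  finally have "(j * nat a) mod 8 = nat ((k * a) mod 8) mod 8" by (simp only: of_nat_eq_iff)
  then have "x [^]\<^bsub>K\<^esub> (j * nat a) = x [^]\<^bsub>K\<^esub> nat ((k * a) mod 8)" by (rule K.pow_cong[OF x])
  then show "s \<otimes>\<^bsub>K\<^esub> x [^]\<^bsub>K\<^esub> nat a = x [^]\<^bsub>K\<^esub> nat (if (1::int) = 0 then a else (k * a) mod 8) \<otimes>\<^bsub>K\<^esub> s"
    using K.intertwine_pow[OF x(1) _ s(1,3), of "nat a"] x(1) by (simp add: K.nat_pow_pow)
qed (auto simp: carrier_integer_mod_group)

lemma inj_on_set_if_distinct: "distinct (map f xs) \<Longrightarrow> inj_on f (set xs)"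
  by (simp add: distinct_map)

definition diag4 :: "'k::zero \<Rightarrow> 'k \<Rightarrow> 'k \<Rightarrow> 'k \<Rightarrow> 'k mat" where
  "diag4 a b c d = mat4 [[a, 0, 0, 0], [0, b, 0, 0], [0, 0, c, 0], [0, 0, 0, d]]"

lemma less_4_cases: "i < (4::nat) \<Longrightarrow> i = 0 \<or> i = 1 \<or> i = 2 \<or> i = 3" by auto

lemma mat4_mult:
  "(mat4 A :: 'k::comm_ring_1 mat) * mat4 B =
     mat4 (map (\<lambda>i. map (\<lambda>j. A!i!0 * B!0!j + A!i!1 * B!1!j + A!i!2 * B!2!j + A!i!3 * B!3!j) [0, 1, 2, 3]) [0, 1, 2, 3])"
  by (rule eq_matI) (auto simp: mat4_def scalar_prod_def sum_4 dest!: less_4_cases)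

lemma one_mat4: "1\<^sub>m 4 = (diag4 1 1 1 1 :: 'k::comm_ring_1 mat)"
  by (rule eq_matI) (auto simp: diag4_def mat4_def dest!: less_4_cases)

lemma diag4_carrier [simp]: "diag4 a b c d \<in> carrier_mat 4 4"
  by (simp add: diag4_def)

lemma diag4_mult: "diag4 a b c d * diag4 p q r s = diag4 (a * p) (b * q) (c * r) (d * s :: 'k::comm_ring_1)"
  by (simp add: diag4_def mat4_mult)

lemma diag4_pow: "diag4 a b c d ^\<^sub>m n = diag4 (a ^ n) (b ^ n) (c ^ n) (d ^ n :: 'k::comm_ring_1)"
proof (induction n)
  case 0
  have "dim_row (diag4 a b c d) = 4" using diag4_carrier[of a b c d] by (rule carrier_matD)
  then show ?case by (simp add: one_mat4)
next
  case (Suc n) then show ?case by (simp add: diag4_mult mult.commute)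
qed

lemma diag4_mult_vec:
  "v \<in> carrier_vec 4 \<Longrightarrow> diag4 a b c d *\<^sub>v v = vec4 (a * v$0) (b * v$1) (c * v$2) (d * v$3 :: 'k::comm_ring_1)"
  by (rule vec4_eqI) (simp_all add: diag4_def mat4_mult_vec)

lemma diag4_GL:
  assumes "a \<noteq> 0" "b \<noteq> 0" "c \<noteq> 0" "d \<noteq> (0 :: 'k::field)"
  shows "diag4 a b c d \<in> carrier (GL 4)"
  by (rule GL_memI[of _ _ "diag4 (1/a) (1/b) (1/c) (1/d)"]) (use assms in \<open>simp_all add: diag4_mult one_mat4\<close>)

lemma involution_GL: "A \<in> carrier_mat n n \<Longrightarrow> A * A = 1\<^sub>m n \<Longrightarrow> A \<in> carrier (GL n)"
  by (rule GL_memI)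

lemma word_mat_mult_vec:
  assumes "x \<in> carrier_vec 5"
  shows "word_mat (Word a b c d e) *\<^sub>v x = vec 5 (\<lambda>i. entry a i * x$0 + entry b i * x$1 + entry c i * x$2 + entry d i * x$3 + entry e i * x$4)"
  by (rule eq_vecI) (use assms in \<open>auto simp: mult_vec5[of _ 5] word_mat_def ix_of_nat_def simp del: index_mult_mat_vec\<close>)

lemma vec4_index: "vec4 a b c d $ 0 = a" "vec4 a b c d $ 1 = b" "vec4 a b c d $ 2 = c" "vec4 a b c d $ 3 = d"
  by simp_all

lemma vec5_index: "vec5 a b c d e $ 0 = a" "vec5 a b c d e $ 1 = b" "vec5 a b c d e $ 2 = c"
  "vec5 a b c d e $ 3 = d" "vec5 a b c d e $ 4 = e"
  by simp_all

lemma vec5_smult: "k \<cdot>\<^sub>v vec5 a b c d e = vec5 (k * a) (k * b) (k * c) (k * d) (k * e)"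
  by (rule vec5_eqI) simp_all

lemma vec5_cong:
  "a = a' \<Longrightarrow> b = b' \<Longrightarrow> c = c' \<Longrightarrow> d = d' \<Longrightarrow> e = e' \<Longrightarrow> vec5 a b c d e = vec5 a' b' c' d' e'"
  by simp

lemma plane_map_carrier: "plane_map v \<in> carrier_vec 5" and flag_map_carrier: "flag_map \<iota> v \<in> carrier_vec 5"
  by (simp_all add: plane_map_def flag_map_def Let_def)

lemma eighth_coords_negacycle:
  fixes z :: "'k::field_char_0"
  assumes z: "z ^ 4 = - 1" and x: "x \<in> carrier_vec 5"
  shows "eighth_coords z *\<^sub>v (word_mat negacycle *\<^sub>v x) =
    (\<lambda>y. vec5 (z * y$0) (- (z ^ 3) * y$1) (z ^ 3 * y$2) (- z * y$3) (- y$4)) (eighth_coords z *\<^sub>v x)"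
proof -
  define h where "h = (z - z ^ 3) / 2"
  show ?thesis
    unfolding eighth_coords_def h_def[symmetric] Let_def negacycle_def
    by (rule vec5_eqI; use x in \<open>simp add: word_mat_mult_vec mat5_mult_vec\<close>; use z in Groebner_Basis.algebra)
qed

lemma eighth_coords_inverting:
  fixes z :: "'k::field_char_0"
  assumes x: "x \<in> carrier_vec 5"
  shows "eighth_coords z *\<^sub>v (word_mat inverting_word *\<^sub>v x) =
    (\<lambda>y. vec5 (y$1) (y$0) (y$3) (y$2) (- y$4)) (eighth_coords z *\<^sub>v x)"
  by (rule vec5_eqI) (use x in \<open>simp_all add: eighth_coords_def Let_def inverting_word_def word_mat_mult_vec mat5_mult_vec algebra_simps\<close>)

lemma eighth_coords_cubing:
  fixes z :: "'k::field_char_0"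
  assumes x: "x \<in> carrier_vec 5"
  shows "eighth_coords z *\<^sub>v (word_mat cubing_word *\<^sub>v x) =
    (\<lambda>y. vec5 (y$2) (y$3) (y$0) (y$1) (- y$4)) (eighth_coords z *\<^sub>v x)"
  by (rule vec5_eqI) (use x in \<open>simp_all add: eighth_coords_def Let_def cubing_word_def word_mat_mult_vec mat5_mult_vec algebra_simps\<close>)

text \<open>
  What the dihedral and the semidihedral case share.  The predicate \<open>rel\<close> expresses that an element
  conjugates the negacycle to its \<open>k\<close>-th power; elements of the cyclic subgroup commute with it.
\<close>

lemma octic_linearizable:
  fixes C C' :: "'k::field_char_0 mat"
  assumes k: "(k * k) mod 8 = 1" "int j mod 8 = k mod 8"
    and coords: "split_coords C C'" and param: "split_parametrization F H D E"
    and F: "\<And>v. v \<in> carrier_vec 4 \<Longrightarrow> F v \<in> carrier_vec 5"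
    and R: "(negacycle, R) \<in> carrier (equivariant_pairs C C' F)" "R ^\<^sub>m 8 = 1\<^sub>m 4"
    and S: "(t, S) \<in> carrier (equivariant_pairs C C' F)" "S * S = 1\<^sub>m 4" "S * R = R ^\<^sub>m j * S"
    and t: "wmult t t = one_word" "wmult t negacycle = wmult (wpow negacycle j) t"
    and dist: "distinct (map (octic_word t) octic_indices)"
    and check: "\<And>g. weyl_word g \<Longrightarrow> wmult g negacycle = wmult negacycle g \<or> rel g \<Longrightarrow> g \<in> set (map (octic_word t) octic_indices)"
    and rel: "\<And>c a. c \<in> hom (octic_semidirect k) weyl_words \<Longrightarrow> c (1, 0) = negacycle \<Longrightarrow>
      (a, 1) \<in> carrier (octic_semidirect k) \<Longrightarrow> rel (c (a, 1))"
  shows "unique_up_to_conj (weyl_D 5 :: 'k mat monoid) (octic_semidirect k) \<and>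
    (\<forall>G. subgroup_of_type G (weyl_D 5 :: 'k mat monoid) (octic_semidirect k) \<longrightarrow>
      linearizable ((weyl_D 5)\<lparr>carrier := G\<rparr>) proj_action 5 (quadric :: 'k vec set set))"
proof -
  let ?M = "octic_semidirect k" and ?K = "equivariant_pairs C C' F"
  have RS: "R \<in> carrier_mat 4 4" "S \<in> carrier_mat 4 4" using equivariant_pairs_carrier(3) R(1) S(1) by fastforce+
  have negacycle_8: "wpow negacycle 8 = one_word" by code_simp
  define f where "f = (\<lambda>(a, h). (negacycle, R) [^]\<^bsub>?K\<^esub> nat a \<otimes>\<^bsub>?K\<^esub> (if h = (0::int) then \<one>\<^bsub>?K\<^esub> else (t, S)))"
  have f: "f \<in> hom ?M ?K"
    unfolding f_def
    by (rule octic_hom[OF monoid_equivariant_pairs[OF coords F] R(1) _ S(1)])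
       (use R(2) S(2,3) t k(2) negacycle_8 RS in \<open>simp_all add: equivariant_pairs_pow\<close>)
  have fst_f: "fst (f m) = octic_word t m" for m
    by (cases m) (simp add: f_def octic_word_def equivariant_pairs_pow[OF RS(1)])
  have M: "group ?M" by (rule group_octic[OF k(1)])
  have inj: "inj_on (fst \<circ> f) (carrier ?M)"
    unfolding octic_carrier comp_def fst_f by (rule inj_on_set_if_distinct[OF dist])
  show ?thesis
  proof (rule subgroups_of_type_linearizable[OF M _ coords param f inj])
    show "finite (carrier ?M)" by (simp add: octic_carrier)
    fix h assume h: "h \<in> hom ?M weyl_words" "inj_on h (carrier ?M)"
    show "\<exists>x. weyl_word x \<and> (\<forall>m\<in>carrier ?M. \<exists>m'\<in>carrier ?M. wmult (h m) x = wmult x (fst (f m')))"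
    proof (rule conjugate_by_relation[OF M, where e = "(1, 0)"])
      show "(1, 0) \<in> carrier ?M" by (simp add: octic_carrier octic_indices_def)
      show "((1, 0) \<otimes>\<^bsub>?M\<^esub> (1, 0)) \<otimes>\<^bsub>?M\<^esub> ((1, 0) \<otimes>\<^bsub>?M\<^esub> (1, 0)) \<noteq> \<one>\<^bsub>?M\<^esub>"
        "(((1, 0) \<otimes>\<^bsub>?M\<^esub> (1, 0)) \<otimes>\<^bsub>?M\<^esub> ((1, 0) \<otimes>\<^bsub>?M\<^esub> (1, 0))) \<otimes>\<^bsub>?M\<^esub> (((1, 0) \<otimes>\<^bsub>?M\<^esub> (1, 0)) \<otimes>\<^bsub>?M\<^esub> ((1, 0) \<otimes>\<^bsub>?M\<^esub> (1, 0))) = \<one>\<^bsub>?M\<^esub>"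
        by (simp_all add: octic_semidirect_def semidirect_simps)
      fix c m assume c: "c \<in> hom ?M weyl_words" "c (1, 0) = negacycle" and m: "m \<in> carrier ?M"
      have cm: "weyl_word (c m)" using c(1) m by (auto simp: hom_def)
      obtain a b where ab: "m = (a, b)" "b = 0 \<or> b = 1"
        using m by (cases m) (auto simp: octic_semidirect_def semidirect_simps carrier_integer_mod_group_2)
      have "wmult (c m) negacycle = wmult negacycle (c m) \<or> rel (c m)"
      proof (cases "b = 0")
        case True
        have "m \<otimes>\<^bsub>?M\<^esub> (1, 0) = (1, 0) \<otimes>\<^bsub>?M\<^esub> m"
          using ab True by (simp add: octic_semidirect_def semidirect_simps add.commute)
        moreover have "(1, 0) \<in> carrier ?M" by (simp add: octic_carrier octic_indices_def)
        ultimately have "wmult (c m) (c (1, 0)) = wmult (c (1, 0)) (c m)"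
          using hom_mult[OF c(1) m, of "(1, 0)"] hom_mult[OF c(1) _ m, of "(1, 0)"] by simp
        then show ?thesis using c(2) by simp
      next
        case False then show ?thesis using rel[OF c] m ab by auto
      qed
      then have "c m \<in> octic_word t ` set octic_indices" using check[OF cm] by simp
      then show "c m \<in> (\<lambda>m'. fst (f m')) ` carrier ?M" unfolding octic_carrier fst_f .
    qed (use h in auto)
  qed
qed

lemma dihedral_linearizable:
  fixes z :: "'k::field_char_0"
  assumes z: "z ^ 4 = - 1"
  shows "unique_up_to_conj (weyl_D 5 :: 'k mat monoid) dihedral_16 \<and>
    (\<forall>G. subgroup_of_type G (weyl_D 5 :: 'k mat monoid) dihedral_16 \<longrightarrow>
      linearizable ((weyl_D 5)\<lparr>carrier := G\<rparr>) proj_action 5 (quadric :: 'k vec set set))"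
proof -
  define \<iota> where "\<iota> = z ^ 2"
  have \<iota>: "\<iota> ^ 2 = - 1" using z by (simp add: \<iota>_def flip: power_mult)
  have z0: "z \<noteq> 0" using z by auto
  have "z ^ 8 = (z ^ 4) ^ 2" by (simp flip: power_mult)
  then have z8: "z ^ 8 = 1" using z by simp
  have "z ^ 24 = (z ^ 8) ^ 3" by (simp flip: power_mult)
  then have z24: "z ^ 24 = 1" using z8 by simp
  let ?C = "eighth_coords z" and ?C' = "eighth_coords_inv z"
  (* On a, b, m, n the rotation has the eigenvalues z^(-3) = - z, z^3, 1, 1: then r = b / a has the
     eigenvalue z^6 = z^(-2), as it should, and A = a / n, B = b / m have z^(-3), z^3.  The entries
     - 1 of the reflection account for A and B being exchanged up to sign. *)
  let ?R = "diag4 (- z) (z ^ 3) 1 1" and ?S = "mat4 [[0, 1, 0, 0], [1, 0, 0, 0], [0, 0, 0, - 1], [0, 0, - 1, 0]] :: 'k mat"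
  note coords = split_eighth_coords[OF z]
  have SS: "?S * ?S = 1\<^sub>m 4" by (simp add: mat4_mult one_mat4 diag4_def)
  have R: "(negacycle, ?R) \<in> carrier (equivariant_pairs ?C ?C' (flag_map \<iota>))"
  proof (rule equivariant_pairs_generator[OF coords flag_map_carrier _ _ _ eighth_coords_negacycle[OF z]])
    show "weyl_word negacycle" by (simp add: weyl_word_def negacycle_def)
    show "?R \<in> carrier (GL 4)" using z0 by (intro diag4_GL) auto
    show "flag_map \<iota> (?R *\<^sub>v v) = 1 \<cdot>\<^sub>v (\<lambda>y. vec5 (z * y$0) (- (z ^ 3) * y$1) (z ^ 3 * y$2) (- z * y$3) (- y$4)) (flag_map \<iota> v)"
      if "v \<in> carrier_vec 4" for v
      by (simp only: diag4_mult_vec[OF that] flag_map_def Let_def vec4_index vec5_index vec5_smult)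
        (rule vec5_cong; (simp add: algebra_simps power2_eq_square; fail | use z in Groebner_Basis.algebra))
  qed simp_all
  have S: "(inverting_word, ?S) \<in> carrier (equivariant_pairs ?C ?C' (flag_map \<iota>))"
  proof (rule equivariant_pairs_generator[OF coords flag_map_carrier _ _ _ eighth_coords_inverting])
    show "weyl_word inverting_word" by (simp add: weyl_word_def inverting_word_def)
    show "?S \<in> carrier (GL 4)" by (rule involution_GL[OF mat4_carrier SS])
    show "flag_map \<iota> (?S *\<^sub>v v) = 1 \<cdot>\<^sub>v (\<lambda>y. vec5 (y$1) (y$0) (y$3) (y$2) (- y$4)) (flag_map \<iota> v)"
      if "v \<in> carrier_vec 4" for v
      by (rule vec5_eqI) (use that in \<open>simp_all add: mat4_mult_vec flag_map_def Let_def algebra_simps power2_eq_square\<close>)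
  qed simp_all
  show ?thesis
    unfolding dihedral_16_octic
  proof (rule octic_linearizable[where j = 7 and rel = "\<lambda>g. wmult (wmult negacycle g) negacycle = g", OF _ _ coords flag_parametrization[OF \<iota>] flag_map_carrier R _ S SS])
    show "?R ^\<^sub>m 8 = 1\<^sub>m 4" using z8 z24 by (simp add: diag4_pow one_mat4 flip: power_mult)
    show "?S * ?R = ?R ^\<^sub>m 7 * ?S"
    proof -
      have "(- z) ^ 7 = z ^ 3" "(z ^ 3) ^ 7 = - z" using z by Groebner_Basis.algebra+
      then show ?thesis by (simp add: diag4_pow) (simp add: diag4_def mat4_mult)
    qed
    show "wmult inverting_word inverting_word = one_word" "wmult inverting_word negacycle = wmult (wpow negacycle 7) inverting_word"
      by code_simp+
    show "distinct (map (octic_word inverting_word) octic_indices)" by (rule distinct_octic)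
    show "g \<in> set (map (octic_word inverting_word) octic_indices)"
      if "weyl_word g" "wmult g negacycle = wmult negacycle g \<or> wmult (wmult negacycle g) negacycle = g" for g
      using all_weyl_wordsD[OF all_dihedral_check that(1)] that(2) unfolding dihedral_check_def by argo
    fix c :: "int \<times> int \<Rightarrow> word" and a :: int
    assume c: "c \<in> hom (octic_semidirect (- 1)) weyl_words" "c (1, 0) = negacycle" "(a, 1) \<in> carrier (octic_semidirect (- 1))"
    let ?M = "octic_semidirect (- 1)"
    have 1: "(1, 0) \<in> carrier ?M" by (simp add: octic_carrier octic_indices_def)
    have "0 \<le> a" "a < 8" using c(3) by (auto simp: octic_semidirect_def semidirect_simps carrier_integer_mod_group)
    then have "((1, 0) \<otimes>\<^bsub>?M\<^esub> (a, 1)) \<otimes>\<^bsub>?M\<^esub> (1, 0) = (a, 1)"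
      by (simp add: octic_semidirect_def semidirect_simps mod_add_left_eq)
    moreover have "(1, 0) \<otimes>\<^bsub>?M\<^esub> (a, 1) \<in> carrier ?M"
      using group_octic[of "- 1"] 1 c(3) by (simp add: group.is_monoid monoid.m_closed)
    ultimately have "wmult (wmult (c (1, 0)) (c (a, 1))) (c (1, 0)) = c (a, 1)"
      using hom_mult[OF c(1) 1 c(3)] hom_mult[OF c(1) _ 1, of "(1, 0) \<otimes>\<^bsub>?M\<^esub> (a, 1)"] by simp
    then show "wmult (wmult negacycle (c (a, 1))) negacycle = c (a, 1)" using c(2) by simp
  qed simp_all
qed

lemma semidihedral_linearizable:
  fixes z :: "'k::field_char_0"
  assumes z: "z ^ 4 = - 1"
  shows "unique_up_to_conj (weyl_D 5 :: 'k mat monoid) semidihedral_16 \<and>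
    (\<forall>G. subgroup_of_type G (weyl_D 5 :: 'k mat monoid) semidihedral_16 \<longrightarrow>
      linearizable ((weyl_D 5)\<lparr>carrier := G\<rparr>) proj_action 5 (quadric :: 'k vec set set))"
proof -
  have z0: "z \<noteq> 0" using z by auto
  have "z ^ 8 = (z ^ 4) ^ 2" by (simp flip: power_mult)
  then have z8: "z ^ 8 = 1" using z by simp
  have "z ^ 24 = (z ^ 8) ^ 3" by (simp flip: power_mult)
  then have z24: "z ^ 24 = 1" using z8 by simp
  let ?C = "eighth_coords z" and ?C' = "eighth_coords_inv z"
  (* The first two coordinates are those of the isotropic plane divided by the last coordinate of the
     quadric, on which both generators act by - 1; the third one changes sign when the two products
     of dual coordinates are exchanged. *)
  let ?R = "diag4 (- z) (- (z ^ 3)) 1 1" and ?S = "mat4 [[0, - 1, 0, 0], [- 1, 0, 0, 0], [0, 0, - 1, 0], [0, 0, 0, 1]] :: 'k mat"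
  note coords = split_eighth_coords[OF z]
  have SS: "?S * ?S = 1\<^sub>m 4" by (simp add: mat4_mult one_mat4 diag4_def)
  have R: "(negacycle, ?R) \<in> carrier (equivariant_pairs ?C ?C' plane_map)"
  proof (rule equivariant_pairs_generator[OF coords plane_map_carrier _ _ _ eighth_coords_negacycle[OF z]])
    show "weyl_word negacycle" by (simp add: weyl_word_def negacycle_def)
    show "?R \<in> carrier (GL 4)" using z0 by (intro diag4_GL) auto
    show "plane_map (?R *\<^sub>v v) = 1 \<cdot>\<^sub>v (\<lambda>y. vec5 (z * y$0) (- (z ^ 3) * y$1) (z ^ 3 * y$2) (- z * y$3) (- y$4)) (plane_map v)"
      if "v \<in> carrier_vec 4" for v
      by (simp only: diag4_mult_vec[OF that] plane_map_def vec4_index vec5_index vec5_smult)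
        (rule vec5_cong; (simp add: algebra_simps power2_eq_square; fail | use z in Groebner_Basis.algebra))
  qed simp_all
  have S: "(cubing_word, ?S) \<in> carrier (equivariant_pairs ?C ?C' plane_map)"
  proof (rule equivariant_pairs_generator[OF coords plane_map_carrier _ _ _ eighth_coords_cubing])
    show "weyl_word cubing_word" by (simp add: weyl_word_def cubing_word_def)
    show "?S \<in> carrier (GL 4)" by (rule involution_GL[OF mat4_carrier SS])
    show "plane_map (?S *\<^sub>v v) = (- 1) \<cdot>\<^sub>v (\<lambda>y. vec5 (y$2) (y$3) (y$0) (y$1) (- y$4)) (plane_map v)"
      if "v \<in> carrier_vec 4" for v
      by (rule vec5_eqI) (use that in \<open>simp_all add: mat4_mult_vec plane_map_def algebra_simps power2_eq_square\<close>)
  qed simp_all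
  show ?thesis
    unfolding semidihedral_16_octic
  proof (rule octic_linearizable[where j = 3 and rel = "\<lambda>g. wmult g negacycle = wmult (wmult negacycle (wmult negacycle negacycle)) g", OF _ _ coords plane_parametrization plane_map_carrier R _ S SS])
    show "?R ^\<^sub>m 8 = 1\<^sub>m 4" using z8 z24 by (simp add: diag4_pow one_mat4 flip: power_mult)
    show "?S * ?R = ?R ^\<^sub>m 3 * ?S"
    proof -
      have "(- z) ^ 3 = - (z ^ 3)" by simp
      moreover have "(- (z ^ 3)) ^ 3 = - z" using z by Groebner_Basis.algebra
      ultimately show ?thesis by (simp add: diag4_pow) (simp add: diag4_def mat4_mult)
    qed
    show "wmult cubing_word cubing_word = one_word" "wmult cubing_word negacycle = wmult (wpow negacycle 3) cubing_word"
      by code_simp+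
    show "distinct (map (octic_word cubing_word) octic_indices)" by (rule distinct_octic)
    show "g \<in> set (map (octic_word cubing_word) octic_indices)"
      if "weyl_word g" "wmult g negacycle = wmult negacycle g \<or> wmult g negacycle = wmult (wmult negacycle (wmult negacycle negacycle)) g" for g
      using all_weyl_wordsD[OF all_semidihedral_check that(1)] that(2) unfolding semidihedral_check_def by argo
    fix c :: "int \<times> int \<Rightarrow> word" and a :: int
    assume c: "c \<in> hom (octic_semidirect 3) weyl_words" "c (1, 0) = negacycle" "(a, 1) \<in> carrier (octic_semidirect 3)"
    let ?M = "octic_semidirect 3"
    have 1: "(1, 0) \<in> carrier ?M" "(2, 0) \<in> carrier ?M" "(3, 0) \<in> carrier ?M"
      by (simp_all add: octic_carrier octic_indices_def)
    have "(1, 0) \<otimes>\<^bsub>?M\<^esub> (1, 0) = (2, 0)" "(1, 0) \<otimes>\<^bsub>?M\<^esub> (2, 0) = (3, 0)" "(a, 1) \<otimes>\<^bsub>?M\<^esub> (1, 0) = (3, 0) \<otimes>\<^bsub>?M\<^esub> (a, 1)"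
      by (simp_all add: octic_semidirect_def semidirect_simps add.commute)
    then show "wmult (c (a, 1)) negacycle = wmult (wmult negacycle (wmult negacycle negacycle)) (c (a, 1))"
      using hom_mult[OF c(1) 1(1) 1(1)] hom_mult[OF c(1) 1(1) 1(2)] hom_mult[OF c(1) c(3) 1(1)] hom_mult[OF c(1) 1(3) c(3)] c(2)
      by simp
  qed simp_all
qed

lemma group_C4_wr_C2: "group C4_wr_C2"
  unfolding C4_wr_C2_def
proof (rule group_semidirect_C2)
  show "group (integer_mod_group 4 \<times>\<times> integer_mod_group 4)"
    by (intro DirProd_group group_integer_mod_group)
  show "(\<lambda>(a, b). if (1::int) = 0 then (a, b) else (b, a))
      \<in> hom (integer_mod_group 4 \<times>\<times> integer_mod_group 4) (integer_mod_group 4 \<times>\<times> integer_mod_group 4)"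
    by (auto simp: hom_def)
qed auto

lemma C4_wr_C2_carrier: "carrier C4_wr_C2 = set wreath_indices"
proof -
  have 4: "carrier (integer_mod_group 4) = {0, 1, 2, 3}"
    by (auto simp: carrier_integer_mod_group)
  show ?thesis
    unfolding C4_wr_C2_def semidirect_simps carrier_DirProd carrier_integer_mod_group_2 4 wreath_indices_def by auto
qed

lemma C4_wr_C2_hom:
  assumes K: "monoid K" and x: "x \<in> carrier K" "x [^]\<^bsub>K\<^esub> (4::nat) = \<one>\<^bsub>K\<^esub>"
    and y: "y \<in> carrier K" "y [^]\<^bsub>K\<^esub> (4::nat) = \<one>\<^bsub>K\<^esub>" and xy: "x \<otimes>\<^bsub>K\<^esub> y = y \<otimes>\<^bsub>K\<^esub> x"
    and s: "s \<in> carrier K" "s \<otimes>\<^bsub>K\<^esub> s = \<one>\<^bsub>K\<^esub>" "s \<otimes>\<^bsub>K\<^esub> x = y \<otimes>\<^bsub>K\<^esub> s" "s \<otimes>\<^bsub>K\<^esub> y = x \<otimes>\<^bsub>K\<^esub> s"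
  shows "(\<lambda>(n, h). (case n of (a, b) \<Rightarrow> x [^]\<^bsub>K\<^esub> nat a \<otimes>\<^bsub>K\<^esub> y [^]\<^bsub>K\<^esub> nat b) \<otimes>\<^bsub>K\<^esub> (if h = 0 then \<one>\<^bsub>K\<^esub> else s))
    \<in> hom C4_wr_C2 K"
  unfolding C4_wr_C2_def
proof (rule semidirect_C2_hom[OF K _ _ s(1,2)])
  interpret K: monoid K by fact
  have xc: "x [^]\<^bsub>K\<^esub> i \<in> carrier K" and yc: "y [^]\<^bsub>K\<^esub> i \<in> carrier K" for i :: nat using x(1) y(1) by simp_all
  have "x [^]\<^bsub>K\<^esub> i \<otimes>\<^bsub>K\<^esub> y = y \<otimes>\<^bsub>K\<^esub> x [^]\<^bsub>K\<^esub> i" for i :: nat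
    by (rule K.group_commutes_pow[OF xy x(1) y(1)])
  then have comm: "y [^]\<^bsub>K\<^esub> j \<otimes>\<^bsub>K\<^esub> x [^]\<^bsub>K\<^esub> i = x [^]\<^bsub>K\<^esub> i \<otimes>\<^bsub>K\<^esub> y [^]\<^bsub>K\<^esub> j" for i j :: nat
    using K.group_commutes_pow[of y "x [^]\<^bsub>K\<^esub> i" j] x(1) y(1) by simp
  have sx: "s \<otimes>\<^bsub>K\<^esub> x [^]\<^bsub>K\<^esub> i = y [^]\<^bsub>K\<^esub> i \<otimes>\<^bsub>K\<^esub> s" for i :: nat
    by (rule K.intertwine_pow[OF x(1) y(1) s(1,3)])
  have sy: "s \<otimes>\<^bsub>K\<^esub> y [^]\<^bsub>K\<^esub> i = x [^]\<^bsub>K\<^esub> i \<otimes>\<^bsub>K\<^esub> s" for i :: nat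
    by (rule K.intertwine_pow[OF y(1) x(1) s(1,4)])
  have hom_x: "x [^]\<^bsub>K\<^esub> nat ((a + b) mod 4) = x [^]\<^bsub>K\<^esub> nat a \<otimes>\<^bsub>K\<^esub> x [^]\<^bsub>K\<^esub> nat b"
    if "a \<in> {0..<4}" "b \<in> {0..<4}" for a b :: int
    using hom_mult[OF cyclic_hom[OF K x], of a b] that by (simp add: carrier_integer_mod_group)
  have hom_y: "y [^]\<^bsub>K\<^esub> nat ((a + b) mod 4) = y [^]\<^bsub>K\<^esub> nat a \<otimes>\<^bsub>K\<^esub> y [^]\<^bsub>K\<^esub> nat b"
    if "a \<in> {0..<4}" "b \<in> {0..<4}" for a b :: int
    using hom_mult[OF cyclic_hom[OF K y], of a b] that by (simp add: carrier_integer_mod_group)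
  have "x [^]\<^bsub>K\<^esub> i \<otimes>\<^bsub>K\<^esub> x [^]\<^bsub>K\<^esub> j \<otimes>\<^bsub>K\<^esub> (y [^]\<^bsub>K\<^esub> k \<otimes>\<^bsub>K\<^esub> y [^]\<^bsub>K\<^esub> l) =
      x [^]\<^bsub>K\<^esub> i \<otimes>\<^bsub>K\<^esub> y [^]\<^bsub>K\<^esub> k \<otimes>\<^bsub>K\<^esub> (x [^]\<^bsub>K\<^esub> j \<otimes>\<^bsub>K\<^esub> y [^]\<^bsub>K\<^esub> l)" for i j k l :: nat
  proof -
    have "x [^]\<^bsub>K\<^esub> i \<otimes>\<^bsub>K\<^esub> y [^]\<^bsub>K\<^esub> k \<otimes>\<^bsub>K\<^esub> (x [^]\<^bsub>K\<^esub> j \<otimes>\<^bsub>K\<^esub> y [^]\<^bsub>K\<^esub> l) =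
        x [^]\<^bsub>K\<^esub> i \<otimes>\<^bsub>K\<^esub> (y [^]\<^bsub>K\<^esub> k \<otimes>\<^bsub>K\<^esub> x [^]\<^bsub>K\<^esub> j) \<otimes>\<^bsub>K\<^esub> y [^]\<^bsub>K\<^esub> l"
      using xc yc by (simp add: K.m_assoc)
    then show ?thesis unfolding comm using xc yc by (simp add: K.m_assoc)
  qed
  then show "(\<lambda>(a, b). x [^]\<^bsub>K\<^esub> nat a \<otimes>\<^bsub>K\<^esub> y [^]\<^bsub>K\<^esub> nat b) \<in> hom (integer_mod_group 4 \<times>\<times> integer_mod_group 4) K"
    using xc yc by (auto simp: hom_def carrier_integer_mod_group hom_x hom_y simp del: pow_nat)
  show "group (integer_mod_group 4 \<times>\<times> integer_mod_group 4)"
    by (intro DirProd_group group_integer_mod_group)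
  fix n assume "n \<in> carrier (integer_mod_group 4 \<times>\<times> integer_mod_group 4)"
  obtain a b where n: "n = (a, b)" by (cases n)
  let ?a = "nat a" and ?b = "nat b"
  have "s \<otimes>\<^bsub>K\<^esub> (x [^]\<^bsub>K\<^esub> ?a \<otimes>\<^bsub>K\<^esub> y [^]\<^bsub>K\<^esub> ?b) = (s \<otimes>\<^bsub>K\<^esub> x [^]\<^bsub>K\<^esub> ?a) \<otimes>\<^bsub>K\<^esub> y [^]\<^bsub>K\<^esub> ?b"
    using xc yc s(1) by (simp add: K.m_assoc)
  also have "\<dots> = y [^]\<^bsub>K\<^esub> ?a \<otimes>\<^bsub>K\<^esub> (s \<otimes>\<^bsub>K\<^esub> y [^]\<^bsub>K\<^esub> ?b)"
    unfolding sx using xc yc s(1) by (simp add: K.m_assoc)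
  also have "\<dots> = (y [^]\<^bsub>K\<^esub> ?a \<otimes>\<^bsub>K\<^esub> x [^]\<^bsub>K\<^esub> ?b) \<otimes>\<^bsub>K\<^esub> s"
    unfolding sy using xc yc s(1) by (simp add: K.m_assoc)
  finally show "s \<otimes>\<^bsub>K\<^esub> (case n of (a, b) \<Rightarrow> x [^]\<^bsub>K\<^esub> nat a \<otimes>\<^bsub>K\<^esub> y [^]\<^bsub>K\<^esub> nat b) =
      (case (\<lambda>(a, b). if (1::int) = 0 then (a, b) else (b, a)) n of (a, b) \<Rightarrow> x [^]\<^bsub>K\<^esub> nat a \<otimes>\<^bsub>K\<^esub> y [^]\<^bsub>K\<^esub> nat b) \<otimes>\<^bsub>K\<^esub> s"
    by (simp add: n comm)
qed auto

lemma quarter_coords_words: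
  fixes \<iota> :: "'k::field_char_0"
  assumes \<iota>: "\<iota> ^ 2 = - 1" and x: "x \<in> carrier_vec 5"
  shows "quarter_coords \<iota> *\<^sub>v (word_mat first_quarter *\<^sub>v x) =
      (\<lambda>y. vec5 (\<iota> * y$0) (- \<iota> * y$1) (y$2) (y$3) (- y$4)) (quarter_coords \<iota> *\<^sub>v x)"
    "quarter_coords \<iota> *\<^sub>v (word_mat second_quarter *\<^sub>v x) =
      (\<lambda>y. vec5 (y$0) (y$1) (\<iota> * y$2) (- \<iota> * y$3) (- y$4)) (quarter_coords \<iota> *\<^sub>v x)"
    "quarter_coords \<iota> *\<^sub>v (word_mat quarter_swap *\<^sub>v x) =
      (\<lambda>y. vec5 (y$2) (y$3) (y$0) (y$1) (y$4)) (quarter_coords \<iota> *\<^sub>v x)"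
  unfolding quarter_coords_def first_quarter_def second_quarter_def quarter_swap_def
  by (rule vec5_eqI; use x in \<open>simp add: word_mat_mult_vec mat5_mult_vec\<close>; use \<iota> in Groebner_Basis.algebra)+

text \<open>
  The embedding of the abstract group is the one of \<open>wreath_word\<close>.  In the group, the square of
  \<open>((1, 0), 1)\<close>, an element of order eight, is the central element \<open>((1, 1), 0)\<close>.
\<close>

lemma wreath_linearizable:
  fixes \<iota> :: "'k::field_char_0"
  assumes \<iota>: "\<iota> ^ 2 = - 1"
  shows "unique_up_to_conj (weyl_D 5 :: 'k mat monoid) C4_wr_C2 \<and>
    (\<forall>G. subgroup_of_type G (weyl_D 5 :: 'k mat monoid) C4_wr_C2 \<longrightarrow>
      linearizable ((weyl_D 5)\<lparr>carrier := G\<rparr>) proj_action 5 (quadric :: 'k vec set set))"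
proof -
  have \<iota>0: "\<iota> \<noteq> 0" using \<iota> by auto
  have "\<iota> ^ 4 = (\<iota> ^ 2) ^ 2" by (simp flip: power_mult)
  then have \<iota>4: "\<iota> ^ 4 = 1" using \<iota> by simp
  let ?C = "quarter_coords \<iota>" and ?C' = "quarter_coords_inv \<iota>"
  let ?A = "diag4 (- \<iota>) (- 1) 1 1" and ?B = "diag4 (- 1) (- \<iota>) 1 1"
    and ?S = "mat4 [[0, 1, 0, 0], [1, 0, 0, 0], [0, 0, - 1, 0], [0, 0, 0, 1]] :: 'k mat"
  let ?M = "C4_wr_C2" and ?K = "equivariant_pairs ?C ?C' plane_map"
  note coords = split_quarter_coords[OF \<iota>]
  have SS: "?S * ?S = 1\<^sub>m 4" by (simp add: mat4_mult one_mat4 diag4_def)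
  have A: "(first_quarter, ?A) \<in> carrier ?K"
  proof (rule equivariant_pairs_generator[OF coords plane_map_carrier _ _ _ quarter_coords_words(1)[OF \<iota>]])
    show "weyl_word first_quarter" by (simp add: weyl_word_def first_quarter_def)
    show "?A \<in> carrier (GL 4)" using \<iota>0 by (intro diag4_GL) auto
    show "plane_map (?A *\<^sub>v v) = (- \<iota>) \<cdot>\<^sub>v (\<lambda>y. vec5 (\<iota> * y$0) (- \<iota> * y$1) (y$2) (y$3) (- y$4)) (plane_map v)"
      if "v \<in> carrier_vec 4" for v
      by (simp only: diag4_mult_vec[OF that] plane_map_def vec4_index vec5_index vec5_smult)
        (rule vec5_cong; (simp add: algebra_simps power2_eq_square; fail | use \<iota> in Groebner_Basis.algebra))
  qed (use \<iota>0 in simp_all)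
  have B: "(second_quarter, ?B) \<in> carrier ?K"
  proof (rule equivariant_pairs_generator[OF coords plane_map_carrier _ _ _ quarter_coords_words(2)[OF \<iota>]])
    show "weyl_word second_quarter" by (simp add: weyl_word_def second_quarter_def)
    show "?B \<in> carrier (GL 4)" using \<iota>0 by (intro diag4_GL) auto
    show "plane_map (?B *\<^sub>v v) = (- \<iota>) \<cdot>\<^sub>v (\<lambda>y. vec5 (y$0) (y$1) (\<iota> * y$2) (- \<iota> * y$3) (- y$4)) (plane_map v)"
      if "v \<in> carrier_vec 4" for v
      by (simp only: diag4_mult_vec[OF that] plane_map_def vec4_index vec5_index vec5_smult)
        (rule vec5_cong; (simp add: algebra_simps power2_eq_square; fail | use \<iota> in Groebner_Basis.algebra))
  qed (use \<iota>0 in simp_all)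
  have S: "(quarter_swap, ?S) \<in> carrier ?K"
  proof (rule equivariant_pairs_generator[OF coords plane_map_carrier _ _ _ quarter_coords_words(3)[OF \<iota>]])
    show "weyl_word quarter_swap" by (simp add: weyl_word_def quarter_swap_def)
    show "?S \<in> carrier (GL 4)" by (rule involution_GL[OF mat4_carrier SS])
    show "plane_map (?S *\<^sub>v v) = 1 \<cdot>\<^sub>v (\<lambda>y. vec5 (y$2) (y$3) (y$0) (y$1) (y$4)) (plane_map v)"
      if "v \<in> carrier_vec 4" for v
      by (rule vec5_eqI) (use that in \<open>simp_all add: mat4_mult_vec plane_map_def algebra_simps power2_eq_square\<close>)
  qed simp_all
  have words: "wpow first_quarter 4 = one_word" "wpow second_quarter 4 = one_word" "wmult quarter_swap quarter_swap = one_word"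
    "wmult first_quarter second_quarter = wmult second_quarter first_quarter"
    "wmult quarter_swap first_quarter = wmult second_quarter quarter_swap"
    "wmult quarter_swap second_quarter = wmult first_quarter quarter_swap"
    by code_simp+
  have mats: "?A ^\<^sub>m 4 = 1\<^sub>m 4" "?B ^\<^sub>m 4 = 1\<^sub>m 4" "?A * ?B = ?B * ?A" "?S * ?A = ?B * ?S" "?S * ?B = ?A * ?S"
    using \<iota>4 by (simp_all add: diag4_pow diag4_mult one_mat4) (simp_all add: diag4_def mat4_mult)
  define f where "f = (\<lambda>(n, h). (case n of (a, b) \<Rightarrow>
      (first_quarter, ?A) [^]\<^bsub>?K\<^esub> nat a \<otimes>\<^bsub>?K\<^esub> (second_quarter, ?B) [^]\<^bsub>?K\<^esub> nat b) \<otimes>\<^bsub>?K\<^esub>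
      (if h = (0::int) then \<one>\<^bsub>?K\<^esub> else (quarter_swap, ?S)))"
  have f: "f \<in> hom ?M ?K"
    unfolding f_def
    by (rule C4_wr_C2_hom[OF monoid_equivariant_pairs[OF coords plane_map_carrier] A _ B _ _ S])
       (use words mats SS in \<open>simp_all add: equivariant_pairs_pow\<close>)
  have fst_f: "fst (f m) = wreath_word m" for m
    by (cases m; cases "fst m") (simp add: f_def wreath_word_def equivariant_pairs_pow)
  have inj: "inj_on (fst \<circ> f) (carrier ?M)"
    unfolding C4_wr_C2_carrier comp_def fst_f by (rule inj_on_set_if_distinct[OF distinct_wreath])
  let ?e = "((1, 0), 1) :: (int \<times> int) \<times> int"
  have mult: "((a, b), h) \<otimes>\<^bsub>?M\<^esub> ((a', b'), h') =
      (if h = 0 then (((a + a') mod 4, (b + b') mod 4), (h + h') mod 2) else (((a + b') mod 4, (b + a') mod 4), (h + h') mod 2))" for a b h a' b' h'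
    by (simp add: C4_wr_C2_def semidirect_simps)
  have e: "?e \<in> carrier ?M" by (simp add: C4_wr_C2_carrier wreath_indices_def)
  show ?thesis
  proof (rule subgroups_of_type_linearizable[OF group_C4_wr_C2 _ coords plane_parametrization f inj])
    show "finite (carrier ?M)" by (simp add: C4_wr_C2_carrier)
    fix h assume h: "h \<in> hom ?M weyl_words" "inj_on h (carrier ?M)"
    show "\<exists>x. weyl_word x \<and> (\<forall>m\<in>carrier ?M. \<exists>m'\<in>carrier ?M. wmult (h m) x = wmult x (fst (f m')))"
    proof (rule conjugate_by_relation[OF group_C4_wr_C2 e _ _ h])
      show "(?e \<otimes>\<^bsub>?M\<^esub> ?e) \<otimes>\<^bsub>?M\<^esub> (?e \<otimes>\<^bsub>?M\<^esub> ?e) \<noteq> \<one>\<^bsub>?M\<^esub>"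
        "((?e \<otimes>\<^bsub>?M\<^esub> ?e) \<otimes>\<^bsub>?M\<^esub> (?e \<otimes>\<^bsub>?M\<^esub> ?e)) \<otimes>\<^bsub>?M\<^esub> ((?e \<otimes>\<^bsub>?M\<^esub> ?e) \<otimes>\<^bsub>?M\<^esub> (?e \<otimes>\<^bsub>?M\<^esub> ?e)) = \<one>\<^bsub>?M\<^esub>"
        by (simp_all add: mult) (simp_all add: C4_wr_C2_def semidirect_simps)
      fix c m assume c: "c \<in> hom ?M weyl_words" "c ?e = negacycle" and m: "m \<in> carrier ?M"
      let ?z = "((1, 1), 0) :: (int \<times> int) \<times> int"
      have z: "?z \<in> carrier ?M" by (simp add: C4_wr_C2_carrier wreath_indices_def)
      have "?e \<otimes>\<^bsub>?M\<^esub> ?e = ?z" by (simp add: mult)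
      then have cz: "c ?z = wmult negacycle negacycle" using hom_mult[OF c(1) e e] c(2) by simp
      have "m \<otimes>\<^bsub>?M\<^esub> ?z = ?z \<otimes>\<^bsub>?M\<^esub> m" by (cases m; cases "fst m") (simp add: mult add.commute)
      then have "wmult (c m) (wmult negacycle negacycle) = wmult (wmult negacycle negacycle) (c m)"
        using hom_mult[OF c(1) m z] hom_mult[OF c(1) z m] cz by simp
      moreover have "weyl_word (c m)" using c(1) m by (auto simp: hom_def)
      ultimately have "c m \<in> set (map wreath_word wreath_indices)"
        using all_weyl_wordsD[OF all_wreath_check] unfolding wreath_check_def by metis
      then show "c m \<in> (\<lambda>m'. fst (f m')) ` carrier ?M" unfolding C4_wr_C2_carrier fst_f by simp
    qed
  qed
qed

theorem proposition6p4:
  shows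
    "(unique_up_to_conj (weyl_D 5 :: ('k :: {alg_closed_field, field_char_0}) mat monoid) C4_wr_C2 \<and>
       (\<forall>G. subgroup_of_type G (weyl_D 5 :: 'k mat monoid) C4_wr_C2 \<longrightarrow>
          linearizable ((weyl_D 5)\<lparr>carrier := G\<rparr>) proj_action 5 (quadric :: 'k vec set set))) \<and>
     (unique_up_to_conj (weyl_D 5 :: 'k mat monoid) semidihedral_16 \<and>
       (\<forall>G. subgroup_of_type G (weyl_D 5 :: 'k mat monoid) semidihedral_16 \<longrightarrow>
          linearizable ((weyl_D 5)\<lparr>carrier := G\<rparr>) proj_action 5 (quadric :: 'k vec set set))) \<and>
     (unique_up_to_conj (weyl_D 5 :: 'k mat monoid) dihedral_16 \<and>
       (\<forall>G. subgroup_of_type G (weyl_D 5 :: 'k mat monoid) dihedral_16 \<longrightarrow>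
          linearizable ((weyl_D 5)\<lparr>carrier := G\<rparr>) proj_action 5 (quadric :: 'k vec set set)))"
proof -
  obtain z :: 'k where z: "z ^ 4 = - 1" using nth_root_exists[of 4 "- 1 :: 'k"] by auto
  then have "(z ^ 2) ^ 2 = - 1" by (simp flip: power_mult)
  then show ?thesis
    using wreath_linearizable semidihedral_linearizable[OF z] dihedral_linearizable[OF z] by blast
qed

end
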